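(* Let $(\xi_n)_{n\in\mathbb{Z}}$ be a stationary Markov chain with marginal distribution $\pi$ and normal transition operator $Q$, let $g\in\mathbb{L}_0^2(\pi)$, $X_i:=g(\xi_i)$, $S_n=\sum_{i=1}^nX_i$, and let $\nu$ be the transition spectral measure of $Q$ with respect to $g$, on $D=\{z\in\mathbb{C}:|z|\le1\}$. Set $$\sigma^2:=\int_D\frac{1-|z|^2}{|1-z|^2}\,\nu(\mathrm{d}z),\qquad I_n:=\frac1n\int_D\frac{|1-z^n|^2}{|1-z|^2}\,\nu(\mathrm{d}z).$$ (a) The limit $\mathrm{var}(S_n)/n\to K<\infty$ exists if and only if $\sigma^2<\infty$ and $I_n\to L$ for some finite $L$; in this case $K=\sigma^2+L$. (b) Moreover, if $\sigma^2<\infty$, then for $C\in[0,\infty)$ the following are equivalent: (i) $I_n\to L$ with $L=\pi C$; (ii) $\nu(U_x)/x\to C$ as $x\to0^+$, where $U_x=\{z=(1-r)e^{\mathrm{i}u}\in D:0\le r\le|u|\le x\}$; (iii) $n\,\nu(D_n)\to C$ as $n\to\infty$, where $D_n=\{z=re^{\mathrm{i}\theta}:1-\frac1n\le r\le1,\ -\frac1n\le\theta\le\frac1n\}$.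
   Context: $(\xi_n)_{n\in\mathbb{Z}}$ is a stationary Markov chain with values in a measurable space $(S,\mathcal{A})$, marginal law $\pi$ and regular conditional distribution $Q(x,A)=\mathbb{P}(\xi_1\in A\mid\xi_0=x)$; $Q$ also denotes the transition operator $(Qg)(x)=\int_S g(s)Q(x,\mathrm{d}s)$, which is normal if $QQ^*=Q^*Q$. $\mathbb{L}_0^2(\pi)$ is the set of real measurable $g$ with $\int g^2\,\mathrm{d}\pi<\infty$ and $\int g\,\mathrm{d}\pi=0$. The transition spectral measure $\nu$ is the finite measure on $D$ given by the spectral theorem for the normal operator $Q$ and the vector $g$; it satisfies $\langle Q^ig,Q^jg\rangle=\int_D z^i\bar z^j\nu(\mathrm{d}z)$ for $i,j\ge0$, in particular $\mathrm{cov}(X_0,X_n)=\int_D z^n\nu(\mathrm{d}z)$, $n\ge 0$. Conventions at the point $z=1$: the quotient $|1-z^n|^2/|1-z|^2$ is read as $|1+z+\dots+z^{n-1}|^2$ (so it equals $n^2$ at $z=1$), and the integrand of $\sigma^2$ is read as $0$ on the whole unit circle, including $z=1$. *)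

theory Defs
  imports "HOL-Probability.Probability"
begin

definition past_algebra ::
    "'w measure \<Rightarrow> 'a measure \<Rightarrow> (int \<Rightarrow> 'w \<Rightarrow> 'a) \<Rightarrow> int \<Rightarrow> 'w measure" where
  "past_algebra M S \<xi> n =
     sigma (space M) (\<Union>k\<in>{..n}. {\<xi> k -` A \<inter> space M | A. A \<in> sets S})"

text \<open>
  A strictly stationary Markov chain indexed by the integers, defined on the probability space
  \<open>M\<close> and with values in the measurable space \<open>S\<close>. The law of \<open>\<xi> 0\<close> is \<open>\<pi>\<close> and the probability
  kernel \<open>Q\<close> is a regular conditional distribution of \<open>\<xi> 1\<close> given \<open>\<xi> 0\<close>.
\<close>

locale stationary_markov_chain = prob_space M
  for M :: "'w measure"
  and S :: "'a measure"
  and \<xi> :: "int \<Rightarrow> 'w \<Rightarrow> 'a"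
  and \<pi> :: "'a measure"
  and Q :: "'a \<Rightarrow> 'a measure" +
  assumes measurable_chain: "\<And>i. \<xi> i \<in> measurable M S"
    and stationary: "\<And>k. distr M (\<Pi>\<^sub>M i\<in>UNIV. S) (\<lambda>\<omega> i. \<xi> (i + k) \<omega>)
                        = distr M (\<Pi>\<^sub>M i\<in>UNIV. S) (\<lambda>\<omega> i. \<xi> i \<omega>)"
    and marginal: "distr M S (\<xi> 0) = \<pi>"
    and markov: "\<And>n A. A \<in> sets S \<Longrightarrow> AE \<omega> in M.
          real_cond_exp M (past_algebra M S \<xi> n) (\<lambda>\<omega>. indicator A (\<xi> (n + 1) \<omega>)) \<omega>
        = real_cond_exp M (vimage_algebra (space M) (\<xi> n) S) (\<lambda>\<omega>. indicator A (\<xi> (n + 1) \<omega>)) \<omega>"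
    and kernel: "Q \<in> measurable S (prob_algebra S)"
    and regular_conditional_distribution: "\<And>A. A \<in> sets S \<Longrightarrow> AE \<omega> in M.
          real_cond_exp M (vimage_algebra (space M) (\<xi> 0) S) (\<lambda>\<omega>. indicator A (\<xi> 1 \<omega>)) \<omega>
        = measure (Q (\<xi> 0 \<omega>)) A"

text \<open>
  The complex Hilbert space \<open>L\<^sup>2(\<pi>)\<close> is represented by square-integrable functions, and equality of
  its elements by equality almost everywhere. The inner product is linear in the first argument.
\<close>

definition L2 :: "'a measure \<Rightarrow> ('a \<Rightarrow> complex) set" where
  "L2 \<pi> = {f \<in> borel_measurable \<pi>. integrable \<pi> (\<lambda>x. (norm (f x))\<^sup>2)}"

definition L2_inner :: "'a measure \<Rightarrow> ('a \<Rightarrow> complex) \<Rightarrow> ('a \<Rightarrow> complex) \<Rightarrow> complex" where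
  "L2_inner \<pi> f h = (LINT x|\<pi>. f x * cnj (h x))"

definition real_L2_0 :: "'a measure \<Rightarrow> ('a \<Rightarrow> real) set" where
  "real_L2_0 \<pi> = {g \<in> borel_measurable \<pi>. integrable \<pi> (\<lambda>x. (g x)\<^sup>2) \<and> (LINT x|\<pi>. g x) = 0}"

definition transition_operator :: "('a \<Rightarrow> 'a measure) \<Rightarrow> ('a \<Rightarrow> complex) \<Rightarrow> 'a \<Rightarrow> complex" where
  "transition_operator Q f x = (LINT s|Q x. f s)"

definition L2_adjoint ::
    "'a measure \<Rightarrow> (('a \<Rightarrow> complex) \<Rightarrow> 'a \<Rightarrow> complex) \<Rightarrow> (('a \<Rightarrow> complex) \<Rightarrow> 'a \<Rightarrow> complex) \<Rightarrow> bool" where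
  "L2_adjoint \<pi> T T' \<longleftrightarrow>
     (\<forall>f\<in>L2 \<pi>. T f \<in> L2 \<pi> \<and> T' f \<in> L2 \<pi>) \<and>
     (\<forall>f\<in>L2 \<pi>. \<forall>h\<in>L2 \<pi>. L2_inner \<pi> (T f) h = L2_inner \<pi> f (T' h))"

text \<open>
  The adjoint is determined up to null sets, so that it does not matter which version \<open>T'\<close> is chosen.
\<close>

definition normal_operator :: "'a measure \<Rightarrow> (('a \<Rightarrow> complex) \<Rightarrow> 'a \<Rightarrow> complex) \<Rightarrow> bool" where
  "normal_operator \<pi> T \<longleftrightarrow>
     (\<exists>T'. L2_adjoint \<pi> T T' \<and> (\<forall>f\<in>L2 \<pi>. AE x in \<pi>. T (T' f) x = T' (T f) x))"

abbreviation unit_disc :: "complex set" where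
  "unit_disc \<equiv> cball 0 1"

abbreviation borel_disc :: "complex measure" where
  "borel_disc \<equiv> restrict_space borel unit_disc"

text \<open>
  A projection-valued measure on the Borel sets of the closed unit disc, acting on \<open>L\<^sup>2(\<pi>)\<close>:
  the operators \<open>E A\<close> are self-adjoint, multiplicative in \<open>A\<close> (in particular idempotent), the whole
  disc is sent to the identity, and \<open>E\<close> is countably additive in the weak operator topology.
  Linearity of \<open>E A\<close> and compatibility with almost everywhere equality follow from self-adjointness.
\<close>

definition projection_valued_measure ::
    "'a measure \<Rightarrow> (complex set \<Rightarrow> ('a \<Rightarrow> complex) \<Rightarrow> 'a \<Rightarrow> complex) \<Rightarrow> bool" where
  "projection_valued_measure \<pi> E \<longleftrightarrow>
     (\<forall>A\<in>sets borel_disc. L2_adjoint \<pi> (E A) (E A)) \<and>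
     (\<forall>A\<in>sets borel_disc. \<forall>B\<in>sets borel_disc. \<forall>f\<in>L2 \<pi>.
        AE x in \<pi>. E A (E B f) x = E (A \<inter> B) f x) \<and>
     (\<forall>f\<in>L2 \<pi>. AE x in \<pi>. E unit_disc f x = f x) \<and>
     (\<forall>A :: nat \<Rightarrow> complex set. range A \<subseteq> sets borel_disc \<longrightarrow> disjoint_family A \<longrightarrow>
        (\<forall>f\<in>L2 \<pi>. \<forall>h\<in>L2 \<pi>.
           (\<lambda>i. L2_inner \<pi> (E (A i) f) h) sums L2_inner \<pi> (E (\<Union>i. A i) f) h))"

text \<open>The measure \<open>A \<mapsto> \<langle>E(A) f, f\<rangle>\<close>, whose values are real and nonnegative.\<close>

definition scalar_spectral_measure ::
    "'a measure \<Rightarrow> (complex set \<Rightarrow> ('a \<Rightarrow> complex) \<Rightarrow> 'a \<Rightarrow> complex) \<Rightarrow> ('a \<Rightarrow> complex) \<Rightarrow> complex measure" where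
  "scalar_spectral_measure \<pi> E f =
     measure_of unit_disc (sets borel_disc) (\<lambda>A. ennreal (Re (L2_inner \<pi> (E A f) f)))"

text \<open>
  \<open>E\<close> is the resolution of the identity of \<open>T\<close>, that is \<open>T = \<integral> z E(dz)\<close> in the weak sense. On a complex
  Hilbert space an operator is determined by its quadratic form (polarization), so that testing
  with pairs \<open>(f, f)\<close> suffices and only nonnegative scalar measures occur.
\<close>

definition resolution_of_identity ::
    "'a measure \<Rightarrow> (('a \<Rightarrow> complex) \<Rightarrow> 'a \<Rightarrow> complex) \<Rightarrow>
     (complex set \<Rightarrow> ('a \<Rightarrow> complex) \<Rightarrow> 'a \<Rightarrow> complex) \<Rightarrow> bool" where
  "resolution_of_identity \<pi> T E \<longleftrightarrow>
     projection_valued_measure \<pi> E \<and>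
     (\<forall>f\<in>L2 \<pi>. L2_inner \<pi> (T f) f = (LINT z|scalar_spectral_measure \<pi> E f. z))"

text \<open>
  The spectral theorem provides exactly one such measure for each normal \<open>Q\<close> and each \<open>g\<close>. Its
  space is the closed unit disc, so that integrals with respect to it are integrals over the disc.
\<close>

definition transition_spectral_measure ::
    "'a measure \<Rightarrow> ('a \<Rightarrow> 'a measure) \<Rightarrow> ('a \<Rightarrow> real) \<Rightarrow> complex measure \<Rightarrow> bool" where
  "transition_spectral_measure \<pi> Q g \<nu> \<longleftrightarrow>
     (\<exists>E. resolution_of_identity \<pi> (transition_operator Q) E \<and>
          \<nu> = scalar_spectral_measure \<pi> E (\<lambda>x. complex_of_real (g x)))"

text \<open>
  The integrand vanishes on the whole unit circle; at \<open>z = 1\<close> this is the convention \<open>0 / 0 = 0\<close>.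
\<close>

definition spectral_sigma2 :: "complex measure \<Rightarrow> ennreal" where
  "spectral_sigma2 \<nu> = (\<integral>\<^sup>+z. ennreal ((1 - (norm z)\<^sup>2) / (norm (1 - z))\<^sup>2) \<partial>\<nu>)"

text \<open>
  The integrand is \<open>|1 + z + \<dots> + z\<^bsup>n-1\<^esup>|\<^sup>2\<close>, which is the meaning of \<open>|1 - z\<^bsup>n\<^esup>|\<^sup>2 / |1 - z|\<^sup>2\<close> at \<open>z = 1\<close>.
\<close>

definition fejer_integral :: "complex measure \<Rightarrow> nat \<Rightarrow> real" where
  "fejer_integral \<nu> n = (1 / real n) * (LINT z|\<nu>. (norm (\<Sum>k<n. z ^ k))\<^sup>2)"

lemma fejer_integrand_eq:
  fixes z :: complex
  assumes "z \<noteq> 1"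
  shows "(norm (\<Sum>k<n. z ^ k))\<^sup>2 = (norm (1 - z ^ n))\<^sup>2 / (norm (1 - z))\<^sup>2"
proof -
  have "(\<Sum>k<n. z ^ k) = (1 - z ^ n) / (1 - z)"
    using assms by (simp add: sum_gp_strict)
  thus ?thesis
    by (simp add: norm_divide power_divide)
qed

definition cusp_region :: "real \<Rightarrow> complex set" where
  "cusp_region x =
     {z \<in> unit_disc. \<exists>r u. z = complex_of_real (1 - r) * cis u \<and> 0 \<le> r \<and> r \<le> \<bar>u\<bar> \<and> \<bar>u\<bar> \<le> x}"

definition box_region :: "nat \<Rightarrow> complex set" where
  "box_region n =
     {complex_of_real r * cis \<theta> | r \<theta>.
        1 - 1 / real n \<le> r \<and> r \<le> 1 \<and> - (1 / real n) \<le> \<theta> \<and> \<theta> \<le> 1 / real n}"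

end

theory Submission
  imports Defs
begin

text \<open>
  Write \<open>A\<^sub>m(z) = 1 + z + \<dots> + z\<^bsup>m-1\<^esup>\<close> (\<open>geom_sum\<close>). By the Markov property and the spectral
  theorem the covariance of \<open>X\<^sub>0\<close> and \<open>X\<^sub>k\<close> is the real part of \<open>\<integral> z\<^sup>k \<nu>(dz)\<close>, so the variance of
  \<open>S\<^sub>n\<close> is the integral of an explicit kernel. The point is that this kernel splits exactly as
  \<open>|A\<^sub>n(z)|\<^sup>2 + (1 - |z|\<^sup>2) (|A\<^sub>0(z)|\<^sup>2 + \<dots> + |A\<^sub>n\<^sub>-\<^sub>1(z)|\<^sup>2)\<close>, the variance of a sum of a complex first-order
  autoregression with coefficient \<open>z\<close>, split into the contributions of its initial value and of its
  innovations (\<open>corr_kernel_Suc\<close>). After division by \<open>n\<close> the first part integrates to \<open>I\<^sub>n\<close>. The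
  second part is nonnegative, at most four times the integrand of \<open>\<sigma>\<^sup>2\<close>, and converges to that
  integrand pointwise. Dominated convergence gives the limit \<open>\<sigma>\<^sup>2\<close> if \<open>\<sigma>\<^sup>2\<close> is finite, and
  Fatou's lemma shows that a bounded variance ratio forces \<open>\<sigma>\<^sup>2\<close> to be finite. This is part (a)
  (\<open>variance_limit_iff\<close>).

  For part (b), finiteness of \<open>\<sigma>\<^sup>2\<close> controls the points inside the circle. Up to an error whose integral
  vanishes in the limit, \<open>|A\<^sub>n(z)|\<^sup>2 / n\<close> depends only on \<open>t = |1 - z|\<close>, as the Fejer-type kernel
  \<open>n k(n t)\<close> with \<open>k(v) = (sin (v/2) / (v/2))\<^sup>2\<close> (\<open>kernel_comparison\<close>), and the cusps and the boxes
  may be replaced by the sets \<open>|1 - z| \<le> x\<close> (\<open>region_limit_iff\<close>). What remains is a statement about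
  the image \<open>R\<close> of \<open>\<nu>\<close> on the half-line: \<open>n \<integral> k(n t) R(dt)\<close> tends to \<open>\<pi> C\<close> if and only if
  \<open>R[0, x] / x\<close> tends to \<open>C\<close> (\<open>kernel_limit_iff_cdf_limit\<close>).

  The Abelian half of that equivalence becomes dominated convergence once \<open>R\<close>, normalised to mass \<open>1\<close>, is written as
  the image of Lebesgue measure on the unit interval under its quantile function, because the assumption says that the quantile
  function is asymptotically linear at \<open>0\<close>. The Tauberian half uses the Levy continuity
  theorem: the laws with density proportional to \<open>k(n t)\<close> with respect to \<open>R\<close>, rescaled by \<open>n\<close> and
  symmetrised, have characteristic functions that are second differences of
  \<open>s \<mapsto> \<integral> s\<^sup>2 k(s t) R(dt)\<close>. The hypothesis determines the asymptotics of this function, so these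
  laws converge weakly to the law with density \<open>k / (2 \<pi>)\<close>, and division by \<open>k\<close> recovers the
  mass of \<open>R\<close> on \<open>[0, 1/n]\<close>.

  The spectral measure enters only through its moments (\<open>spectral_moments\<close>). They are obtained
  without complex measures: the operator leaves the range of each spectral projection invariant, on the
  range belonging to a small set it is close to multiplication by a constant, and the disc is cut into
  small sets.
\<close>

section \<open>The Fejer kernel on the line\<close>

text \<open>
  The rescalings \<open>n * line_kernel (n * t)\<close> are the kernels obtained from the Fejer kernels of the
  circle by replacing the chord by the arc in the denominator. In terms of \<open>sinc\<close> the value at \<open>0\<close> needs
  no separate treatment.
\<close>

definition line_kernel :: "real \<Rightarrow> real" where
  "line_kernel v = (sinc (v / 2))\<^sup>2"

lemma line_kernel_0 [simp]: "line_kernel 0 = 1"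
  by (simp add: line_kernel_def)

lemma line_kernel_minus [simp]: "line_kernel (- v) = line_kernel v"
  by (simp add: line_kernel_def)

lemma line_kernel_nonneg [simp]: "0 \<le> line_kernel v"
  by (simp add: line_kernel_def)

lemma line_kernel_eq_sin: "v \<noteq> 0 \<Longrightarrow> line_kernel v = 4 * (sin (v / 2))\<^sup>2 / v\<^sup>2"
  by (simp add: line_kernel_def power_divide field_simps)

lemma line_kernel_eq_cos: "v \<noteq> 0 \<Longrightarrow> line_kernel v = 2 * (1 - cos v) / v\<^sup>2"
  using cos_double_sin[of "v / 2"] by (simp add: line_kernel_eq_sin)

lemma line_kernel_le_1: "line_kernel v \<le> 1"
proof -
  have "\<bar>sinc (v / 2)\<bar> \<le> 1"
    using abs_sin_x_le_abs_x[of "v / 2"] by (auto simp: divide_simps abs_mult)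
  thus ?thesis
    by (simp add: line_kernel_def abs_square_le_1)
qed

lemma line_kernel_le: "v \<noteq> 0 \<Longrightarrow> line_kernel v \<le> 4 / v\<^sup>2"
  by (simp add: line_kernel_eq_sin divide_right_mono abs_square_le_1)

lemma isCont_line_kernel: "isCont line_kernel v"
  unfolding line_kernel_def
  by (intro continuous_intros isCont_o2[OF _ isCont_sinc]) auto

lemma continuous_on_line_kernel: "continuous_on A line_kernel"
  by (simp add: continuous_at_imp_continuous_on isCont_line_kernel)

lemma borel_measurable_line_kernel [measurable]: "line_kernel \<in> borel_measurable borel"
  unfolding line_kernel_def[abs_def] by measurable

lemma line_kernel_pos: "\<bar>v\<bar> \<le> 1 \<Longrightarrow> 0 < line_kernel v"
proof (cases "v = 0")
  case False
  assume "\<bar>v\<bar> \<le> 1"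
  hence "\<bar>v / 2\<bar> < pi" using pi_gt3 by auto
  hence "sin (v / 2) \<noteq> 0" using False sin_gt_zero[of "v/2"] sin_gt_zero[of "-v/2"]
    by (cases "v > 0") auto
  thus ?thesis using False by (simp add: line_kernel_def)
qed simp

lemma line_kernel_lower_bound: "\<exists>c>0. \<forall>v. \<bar>v\<bar> \<le> 1 \<longrightarrow> c \<le> line_kernel v"
proof -
  obtain x where x: "x \<in> {-1..1::real}" "\<forall>y\<in>{-1..1}. line_kernel x \<le> line_kernel y"
    using continuous_attains_inf[of "{-1..1::real}" line_kernel] continuous_on_line_kernel
    by auto
  show ?thesis
    by (rule exI[of _ "line_kernel x"]) (use x line_kernel_pos in \<open>auto simp: abs_le_iff\<close>)
qed

lemma integrable_min_inverse_square:
  "integrable lborel (\<lambda>x::real. a * inverse (1 + x\<^sup>2))"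
  using integrable_inverse_1_plus_square
  by (simp add: set_integrable_def einterval_def)

text \<open>
  With \<open>v\<close> a function of \<open>x\<close> that grows at least linearly this is an integrable majorant. It combines the
  bound \<open>1\<close>, good near the origin, with the bound \<open>4 / v\<^sup>2\<close>, good away from it.
\<close>

lemma line_kernel_scaled_le:
  assumes "0 < c" "v \<noteq> 0 \<Longrightarrow> \<bar>v\<bar> \<ge> c * \<bar>x\<bar>"  "v = 0 \<Longrightarrow> x = 0"
  shows "line_kernel v \<le> (1 + 4 / c\<^sup>2) * inverse (1 + x\<^sup>2)"
proof (cases "x\<^sup>2 \<le> 4 / c\<^sup>2")
  case True
  have "line_kernel v \<le> 1" by (rule line_kernel_le_1)
  also have "1 \<le> (1 + 4 / c\<^sup>2) * inverse (1 + x\<^sup>2)"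
    using True by (subst divide_inverse[symmetric], subst le_divide_eq_1_pos)
      (auto simp: add_pos_nonneg)
  finally show ?thesis .
next
  case False
  hence x0: "x \<noteq> 0" using assms(1) by auto
  hence v0: "v \<noteq> 0" using assms by auto
  have "(c * \<bar>x\<bar>)\<^sup>2 \<le> \<bar>v\<bar>\<^sup>2"
    using assms v0 by (intro power_mono) auto
  hence cv: "c\<^sup>2 * x\<^sup>2 \<le> v\<^sup>2" by (simp add: power_mult_distrib)
  have "line_kernel v \<le> 4 / v\<^sup>2" by (rule line_kernel_le[OF v0])
  also have "\<dots> \<le> 4 / (c\<^sup>2 * x\<^sup>2)"
    by (rule divide_left_mono[OF cv]) (use assms(1) x0 v0 in \<open>simp_all add: zero_less_mult_iff\<close>)
  also have "\<dots> \<le> (1 + 4 / c\<^sup>2) * inverse (1 + x\<^sup>2)"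
  proof -
    have "4 / (c\<^sup>2 * x\<^sup>2) * (1 + x\<^sup>2) = (4 / c\<^sup>2) / x\<^sup>2 + 4 / c\<^sup>2"
      using x0 assms(1) by (simp add: field_simps)
    also have "(4 / c\<^sup>2) / x\<^sup>2 \<le> 1"
      using False x0 by (subst divide_le_eq_1_pos) auto
    finally show ?thesis
      by (subst divide_inverse[symmetric], subst pos_le_divide_eq) (auto simp: add_pos_nonneg)
  qed
  finally show ?thesis .
qed

lemma integrable_line_kernel: "integrable lborel line_kernel"
proof (rule Bochner_Integration.integrable_bound[OF integrable_min_inverse_square[of 5]])
  have "line_kernel x \<le> 5 * inverse (1 + x\<^sup>2)" for x
    using line_kernel_scaled_le[of 1 x x] by simp
  thus "AE x in lborel. norm (line_kernel x) \<le> norm (5 * inverse (1 + x\<^sup>2))"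
    by (auto intro!: AE_I2 order.trans[OF _ abs_ge_self])
qed simp

text \<open>
  Integration by parts: \<open>2 * Si v - v * line_kernel v\<close> is an antiderivative, its second summand vanishes
  at infinity, and \<open>Si\<close> tends to \<open>pi / 2\<close>.
\<close>

lemma LBINT_line_kernel_half: "(LINT x|lborel. indicator {0<..} x * line_kernel x) = pi"
proof -
  define F where "F = (\<lambda>v. 2 * Si v - v * line_kernel v)"
  have lim: "((\<lambda>v. v * line_kernel v) \<longlongrightarrow> 0) at_top"
  proof (rule tendsto_sandwich)
    show "\<forall>\<^sub>F v in at_top. v * line_kernel v \<le> 4 / v"
      using eventually_gt_at_top[of 0]
    proof eventually_elim
      case (elim v)
      have "v * line_kernel v \<le> v * (4 / v\<^sup>2)"
        using elim line_kernel_le[of v] by (intro mult_left_mono) auto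
      thus ?case using elim by (simp add: power2_eq_square)
    qed
    show "\<forall>\<^sub>F v in at_top. 0 \<le> v * line_kernel v"
      using eventually_gt_at_top[of 0] by eventually_elim simp
    show "((\<lambda>v::real. 4 / v) \<longlongrightarrow> 0) at_top"
      by (intro tendsto_divide_0[OF tendsto_const] filterlim_at_top_imp_at_infinity filterlim_ident)
  qed simp
  have F: "(F has_real_derivative line_kernel x) (at x)" if "x > 0" for x
  proof -
    have ev: "\<forall>\<^sub>F v in nhds x. 2 * Si v - 2 * (1 - cos v) / v = F v"
      using eventually_nhds_in_open[of "{0<..}" x] that
      by (auto elim!: eventually_mono simp: F_def line_kernel_eq_cos power2_eq_square)
    have "((\<lambda>v. 2 * Si v - 2 * (1 - cos v) / v) has_real_derivative line_kernel x) (at x)"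
    proof -
      have "((\<lambda>v. 2 * (1 - cos v)) has_real_derivative 2 * sin x) (at x)"
        by (auto intro!: derivative_eq_intros)
      note DERIV_diff[OF DERIV_cmult[OF DERIV_Si, where c = 2] DERIV_divide[OF this DERIV_ident]]
      hence "((\<lambda>v. 2 * Si v - 2 * (1 - cos v) / v) has_real_derivative
          (2 * sinc x - (2 * sin x * x - 2 * (1 - cos x) * 1) / (x * x))) (at x)"
        using that by blast
      also have "2 * sinc x - (2 * sin x * x - 2 * (1 - cos x) * 1) / (x * x) = line_kernel x"
        using that unfolding line_kernel_eq_cos[OF less_imp_neq[OF that, symmetric]]
        by (simp add: power2_eq_square diff_divide_distrib)
      finally show ?thesis .
    qed
    thus ?thesis using DERIV_cong_ev[OF refl ev refl] by simp
  qed
  have F0: "((F \<circ> real_of_ereal) \<longlongrightarrow> 0) (at_right 0)"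
  proof -
    have "isCont F 0" unfolding F_def
      by (intro continuous_intros isCont_Si isCont_line_kernel)
    hence "(F \<longlongrightarrow> F 0) (at_right 0)"
      by (auto simp: continuous_at filterlim_at_split)
    moreover have "F 0 = 0" using Si_neg[of 0] by (simp add: F_def)
    ultimately show ?thesis
      unfolding zero_ereal_def by (subst ereal_tendsto_simps) simp
  qed
  have F1: "((F \<circ> real_of_ereal) \<longlongrightarrow> pi) (at_left \<infinity>)"
    unfolding ereal_tendsto_simps F_def
    using tendsto_diff[OF tendsto_mult[OF tendsto_const[of 2] Si_at_top] lim] by simp
  have "(LBINT x=0..\<infinity>. line_kernel x) = pi - 0"
    by (rule interval_integral_FTC_nonneg(2)[where F = F])
      (use F F0 F1 isCont_line_kernel in \<open>auto simp: zero_ereal_def\<close>)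
  thus ?thesis
    by (simp add: interval_lebesgue_integral_0_infty set_lebesgue_integral_def)
qed

lemma LBINT_line_kernel: "(LINT x|lborel. line_kernel x) = 2 * pi"
proof -
  have int: "integrable lborel (\<lambda>x. indicator A x * line_kernel x)" if "A \<in> sets borel" for A
    using integrable_mult_indicator[OF _ integrable_line_kernel, of A] that by simp
  have neg: "(LINT x|lborel. indicator {..<0} x * line_kernel x) = pi"
  proof -
    have "(LINT x|lborel. indicator {..<0} x * line_kernel x)
        = (LINT x|lborel. indicator {..<0} (0 + -1 * x) * line_kernel (0 + -1 * x))"
      by (subst lborel_integral_real_affine[of "-1" _ 0]) auto
    also have "\<dots> = (LINT x|lborel. indicator {0<..} x * line_kernel x)"
      by (intro Bochner_Integration.integral_cong) (auto simp: indicator_def)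
    finally show ?thesis by (simp add: LBINT_line_kernel_half)
  qed
  have "(LINT x|lborel. line_kernel x)
      = (LINT x|lborel. indicator {0<..} x * line_kernel x + indicator {..<0} x * line_kernel x)"
    using AE_lborel_singleton[of 0]
    by (intro integral_cong_AE) (auto elim!: eventually_mono simp: indicator_def)
  also have "\<dots> = 2 * pi"
    by (subst Bochner_Integration.integral_add) (auto simp: int neg LBINT_line_kernel_half)
  finally show ?thesis .
qed

section \<open>An Abelian theorem by quantile transforms\<close>

context cdf_distribution
begin

text \<open>
  The quantile function \<open>I\<close> is a generalised inverse of the distribution function \<open>C\<close>. Therefore slope
  \<open>c\<close> of \<open>C\<close> at \<open>0\<close> means slope \<open>1 / c\<close> of \<open>I\<close> at \<open>0\<close>, which is infinite for \<open>c = 0\<close>.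
\<close>

lemma quantile_near_0:
  assumes C: "((\<lambda>x. C x / x) \<longlongrightarrow> c) (at_right 0)" and a: "0 < a"
  shows "1 < a * c \<Longrightarrow> \<forall>\<^sub>F y in at_right 0. I y \<le> a * y"
    and "a * c < 1 \<Longrightarrow> \<forall>\<^sub>F y in at_right 0. a * y < I y"
proof -
  have lim: "filterlim (\<lambda>y. a * y) (at_right 0) (at_right 0)"
    using a by real_asymp
  have ev: "\<forall>\<^sub>F y in at_right 0. 0 < y \<and> y < (1::real)"
    by (intro eventually_conj eventually_at_right_less eventually_at_rightI[of 0 1]) auto
  have lim': "((\<lambda>y. C (a * y) / (a * y)) \<longlongrightarrow> c) (at_right 0)"
    using filterlim_compose[OF C lim] .
  show "\<forall>\<^sub>F y in at_right 0. I y \<le> a * y" if "1 < a * c"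
  proof -
    have "1 / a < c" using that a by (simp add: field_simps)
    from order_tendstoD(1)[OF lim' this] ev show ?thesis
    proof eventually_elim
      case (elim y)
      hence "y \<le> C (a * y)" using a by (simp add: field_simps)
      thus ?case using pseudoinverse[of y "a * y"] elim by simp
    qed
  qed
  show "\<forall>\<^sub>F y in at_right 0. a * y < I y" if "a * c < 1"
  proof -
    have "c < 1 / a" using that a by (simp add: field_simps)
    from order_tendstoD(2)[OF lim' this] ev show ?thesis
    proof eventually_elim
      case (elim y)
      hence "C (a * y) < y" using a by (simp add: field_simps)
      thus ?case using pseudoinverse[of y "a * y"] elim by auto
    qed
  qed
qed

lemma cdf_linear_bound:
  assumes C: "((\<lambda>x. C x / x) \<longlongrightarrow> c) (at_right 0)"
  shows "\<exists>B>0. \<forall>x>0. C x \<le> B * x"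
proof -
  have "\<forall>\<^sub>F x in at_right 0. C x / x < c + 1"
    by (rule order_tendstoD(2)[OF C]) simp
  then obtain d where d: "d > 0" "\<And>x. 0 < x \<Longrightarrow> x < d \<Longrightarrow> C x / x < c + 1"
    by (auto simp: eventually_at_right_field)
  have "C x \<le> (\<bar>c\<bar> + 1 + 1 / d) * x" if "x > 0" for x
  proof (cases "x < d")
    case True
    have "C x \<le> (c + 1) * x" using d(2)[OF that True] that by (simp add: field_simps)
    also have "c + 1 \<le> \<bar>c\<bar> + 1 + 1 / d"
      using abs_ge_self[of c] divide_pos_pos[OF zero_less_one d(1)] by linarith
    hence "(c + 1) * x \<le> (\<bar>c\<bar> + 1 + 1 / d) * x"
      using that by (intro mult_right_mono) auto
    finally show ?thesis .
  next
    case False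
    have "C x \<le> 1" by (rule cdf_bounded_prob)
    also have "1 \<le> 1 / d * x" using False d(1) by simp
    also have "\<dots> \<le> (\<bar>c\<bar> + 1 + 1 / d) * x"
      using that d(1) by (intro mult_right_mono) auto
    finally show ?thesis .
  qed
  moreover have "0 < \<bar>c\<bar> + 1 + 1 / d" using d(1) by (simp add: add_nonneg_pos)
  ultimately show ?thesis by blast
qed

text \<open>
  The substitution \<open>t = I (x / n)\<close> moves all dependence on the measure into the integrand, so
  that limits can be taken pointwise.
\<close>

lemma kernel_integral_eq_quantile:
  assumes "0 < n"
  shows "n * (LINT t|M. line_kernel (n * t))
       = (LINT x|lborel. indicator {0<..<n} x * line_kernel (n * I (x / n)))"
proof -
  have "(LINT t|M. line_kernel (n * t))
      = (LINT t|distr (restrict_space lborel {0<..<1::real}) borel I. line_kernel (n * t))"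
    by (simp add: distr_I_eq_M)
  also have "\<dots> = (LINT y|restrict_space lborel {0<..<1::real}. line_kernel (n * I y))"
    by (rule integral_distr) (simp_all add: measurable_CI[unfolded measurable_lborel2[symmetric]])
  also have "\<dots> = (LINT y|lborel. indicator {0<..<1} y * line_kernel (n * I y))"
    by (subst integral_restrict_space) auto
  also have "n * \<dots> = (LINT x|lborel. indicator {0<..<1} (0 + (1/n) * x) * line_kernel (n * I (0 + (1/n) * x)))"
    using assms by (subst lborel_integral_real_affine[of "1 / n" _ 0]) auto
  also have "\<dots> = (LINT x|lborel. indicator {0<..<n} x * line_kernel (n * I (x / n)))"
    using assms by (intro Bochner_Integration.integral_cong) (auto simp: indicator_def field_simps)
  finally show ?thesis .
qed

lemma measurable_quantile_kernel:
  assumes "0 < n"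
  shows "(\<lambda>x. indicator {0<..<n} x * line_kernel (n * I (x / n))) \<in> borel_measurable borel"
proof -
  have "(\<lambda>y. line_kernel (n * I y)) \<in> borel_measurable (restrict_space borel {0<..<1})"
    by measurable
  hence m: "(\<lambda>y. indicator {0<..<1} y *\<^sub>R line_kernel (n * I y)) \<in> borel_measurable borel"
    by (subst (asm) borel_measurable_restrict_space_iff) auto
  have "(\<lambda>x. indicator {0<..<1} (x / n) *\<^sub>R line_kernel (n * I (x / n))) \<in> borel_measurable borel"
    by (rule measurable_compose[OF _ m]) simp
  also have "(\<lambda>x. indicator {0<..<1} (x / n) *\<^sub>R line_kernel (n * I (x / n)))
      = (\<lambda>x. indicator {0<..<n} x * line_kernel (n * I (x / n)))"
    using assms by (auto simp: indicator_def field_simps)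
  finally show ?thesis .
qed

text \<open>
  The Abelian direction. The integrand after the quantile substitution converges to
  \<open>line_kernel (x / c)\<close>, and the linear bound on \<open>C\<close> turns into a linear lower bound on \<open>I\<close>, which
  provides an integrable majorant.
\<close>

lemma kernel_limit_of_cdf_limit:
  assumes C: "((\<lambda>x. C x / x) \<longlongrightarrow> c) (at_right 0)" and c: "0 \<le> c"
  shows "(\<lambda>n. real n * (LINT t|M. line_kernel (real n * t))) \<longlonglongrightarrow> pi * c"
proof -
  obtain B where B: "B > 0" "\<And>x. x > 0 \<Longrightarrow> C x \<le> B * x"
    using cdf_linear_bound[OF C] by blast
  have "((\<lambda>x. x * (C x / x)) \<longlongrightarrow> 0 * c) (at_right 0)"
    by (intro tendsto_mult C tendsto_ident_at)
  hence lim0: "(C \<longlongrightarrow> 0) (at_right 0)"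
    unfolding mult_zero_left by (rule Lim_transform_eventually) (auto simp: eventually_at_filter)
  have "(C \<longlongrightarrow> C 0) (at_right 0)"
    using cont[of 0] by (simp add: continuous_within)
  from tendsto_unique[OF _ this lim0] have C0: "C 0 = 0"
    by simp
  \<comment> \<open>a linear upper bound on the distribution function is a linear lower bound on the quantile function\<close>
  have I_lower: "0 < I y \<and> y \<le> B * I y" if "0 < y" "y < 1" for y
  proof -
    have y: "y \<le> C (I y)" by (rule iffD2[OF pseudoinverse[OF that] order_refl])
    have "0 < I y"
    proof (rule ccontr)
      assume "\<not> 0 < I y"
      hence "C (I y) \<le> C 0" by (intro monoD[OF mono]) auto
      thus False using y that C0 by simp
    qed
    thus ?thesis using y B(2)[of "I y"] by auto
  qed
  \<comment> \<open>for \<open>c = 0\<close> the rescaled quantile function tends to infinity, where the kernel vanishes\<close>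
  define h where "h = (\<lambda>x. if c = 0 then 0 else line_kernel (x / c))"
  have near0: "filterlim (\<lambda>n. x / real n) (at_right 0) sequentially" if "x > 0" for x
    using that by real_asymp
  have pointwise: "(\<lambda>n. line_kernel (real n * I (x / real n))) \<longlonglongrightarrow> h x" if x: "x > 0" for x
  proof (cases "c = 0")
    case True
    have "filterlim (\<lambda>n. real n * I (x / real n)) at_top sequentially"
      unfolding filterlim_at_top_gt[where c = 0]
    proof (intro allI impI)
      fix Z :: real assume Z: "0 < Z"
      have "\<forall>\<^sub>F y in at_right 0. (Z / x) * y < I y"
        by (rule quantile_near_0(2)[OF C]) (use Z x True in auto)
      from eventually_compose_filterlim[OF this near0[OF x]] eventually_gt_at_top[of 0]
      show "\<forall>\<^sub>F n in sequentially. Z \<le> real n * I (x / real n)"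
        by eventually_elim (use x in \<open>auto simp: field_simps\<close>)
    qed
    note top = this
    have zero: "(line_kernel \<longlongrightarrow> 0) at_top"
    proof (rule tendsto_sandwich[of "\<lambda>_. 0" _ _ "\<lambda>v. 4 / v\<^sup>2"])
      show "\<forall>\<^sub>F v in at_top. line_kernel v \<le> 4 / v\<^sup>2"
        using eventually_gt_at_top[of 0] by eventually_elim (simp add: line_kernel_le)
      show "((\<lambda>v::real. 4 / v\<^sup>2) \<longlongrightarrow> 0) at_top" by real_asymp
    qed auto
    show ?thesis
      using filterlim_compose[OF zero top] by (simp add: h_def True)
  next
    case False
    hence c: "c > 0" using c by simp
    have "(\<lambda>n. real n * I (x / real n)) \<longlonglongrightarrow> x / c"
    proof (rule order_tendstoI)
      fix a assume a: "a < x / c"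
      have "max a 0 < x / c" using a c x by simp
      then obtain a' where "max a 0 < a'" and "a' < x / c"
        using dense by blast
      hence a': "0 < a'" "a \<le> a'" "a' < x / c" by auto
      have "\<forall>\<^sub>F y in at_right 0. (a' / x) * y < I y"
        by (rule quantile_near_0(2)[OF C]) (use a' x c in \<open>auto simp: field_simps\<close>)
      from eventually_compose_filterlim[OF this near0[OF x]] eventually_gt_at_top[of 0]
      show "\<forall>\<^sub>F n in sequentially. a < real n * I (x / real n)"
        by eventually_elim (use x a' in \<open>auto simp: field_simps\<close>)
    next
      fix a assume a: "x / c < a"
      obtain a' where a': "x / c < a'" "a' < a" using dense[OF a] by blast
      have "0 < x / c" using x c by simp
      hence a'0: "0 < a'" using a' by linarith
      have "\<forall>\<^sub>F y in at_right 0. I y \<le> (a' / x) * y"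
        by (rule quantile_near_0(1)[OF C]) (use a' a'0 x c in \<open>auto simp: field_simps\<close>)
      from eventually_compose_filterlim[OF this near0[OF x]] eventually_gt_at_top[of 0]
      show "\<forall>\<^sub>F n in sequentially. real n * I (x / real n) < a"
      proof eventually_elim
        case (elim n)
        hence "real n * I (x / real n) \<le> a'" using x by (simp add: field_simps)
        thus ?case using a' by simp
      qed
    qed
    from isCont_tendsto_compose[OF isCont_line_kernel this] show ?thesis
      using c by (simp add: h_def)
  qed
  have limit: "(LINT x|lborel. indicator {0<..} x * h x) = pi * c"
  proof (cases "c = 0")
    case False
    hence c: "c > 0" using c by simp
    have "pi = (LINT x|lborel. indicator {0<..} x * line_kernel x)"
      by (rule LBINT_line_kernel_half[symmetric])
    also have "\<dots> = (1 / c) * (LINT x|lborel. indicator {0<..} (0 + (1/c) * x) * line_kernel (0 + (1/c) * x))"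
      using c by (subst lborel_integral_real_affine[of "1 / c" _ 0]) auto
    also have "(LINT x|lborel. indicator {0<..} (0 + (1/c) * x) * line_kernel (0 + (1/c) * x))
        = (LINT x|lborel. indicator {0<..} x * h x)"
      using c by (intro Bochner_Integration.integral_cong) (auto simp: h_def indicator_def zero_less_divide_iff)
    finally show ?thesis using c by (simp add: field_simps)
  qed (simp add: h_def)
  have "(\<lambda>n. LINT x|lborel. indicator {0<..<real n} x * line_kernel (real n * I (x / real n)))
      \<longlonglongrightarrow> (LINT x|lborel. indicator {0<..} x * h x)"
  proof (rule integral_dominated_convergence[where w = "\<lambda>x. (1 + 4 / (1 / B)\<^sup>2) * inverse (1 + x\<^sup>2)"])
    show "integrable lborel (\<lambda>x::real. (1 + 4 / (1 / B)\<^sup>2) * inverse (1 + x\<^sup>2))"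
      by (rule integrable_min_inverse_square)
    have "(\<lambda>x. indicator {0<..<real n} x * line_kernel (real n * I (x / real n)))
        \<in> borel_measurable borel" for n :: nat
      using measurable_quantile_kernel[of "real n"] by (cases "n = 0") auto
    thus "(\<lambda>x. indicator {0<..<real n} x * line_kernel (real n * I (x / real n)))
        \<in> borel_measurable lborel" for n :: nat
      by simp
    show "(\<lambda>x. indicator {0<..} x * h x) \<in> borel_measurable lborel"
      unfolding h_def by (cases "c = 0") simp_all
    show "AE x in lborel. (\<lambda>n. indicator {0<..<real n} x * line_kernel (real n * I (x / real n)))
        \<longlonglongrightarrow> indicator {0<..} x * h x"
    proof (intro AE_I2)
      fix x :: real
      show "(\<lambda>n. indicator {0<..<real n} x * line_kernel (real n * I (x / real n)))
        \<longlonglongrightarrow> indicator {0<..} x * h x"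
      proof (cases "x > 0")
        case True
        have "\<forall>\<^sub>F n in sequentially. x < real n"
          by real_asymp
        hence "\<forall>\<^sub>F n in sequentially. line_kernel (real n * I (x / real n))
            = indicator {0<..<real n} x * line_kernel (real n * I (x / real n))"
          by eventually_elim (use True in auto)
        from Lim_transform_eventually[OF pointwise[OF True] this] True show ?thesis
          by simp
      qed simp
    qed
    show "AE x in lborel. norm (indicator {0<..<real n} x * line_kernel (real n * I (x / real n)))
        \<le> (1 + 4 / (1 / B)\<^sup>2) * inverse (1 + x\<^sup>2)" for n
    proof (intro AE_I2)
      fix x :: real
      show "norm (indicator {0<..<real n} x * line_kernel (real n * I (x / real n)))
        \<le> (1 + 4 / (1 / B)\<^sup>2) * inverse (1 + x\<^sup>2)"
      proof (cases "0 < x \<and> x < real n")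
        case True
        hence "0 < x / real n" "x / real n < 1" by auto
        from I_lower[OF this] have *: "0 < I (x / real n)" "x / real n \<le> B * I (x / real n)"
          by auto
        have "x / B \<le> real n * I (x / real n)"
          using *(2) True B(1) by (simp add: field_simps)
        hence "line_kernel (real n * I (x / real n)) \<le> (1 + 4 / (1 / B)\<^sup>2) * inverse (1 + x\<^sup>2)"
          using True * B(1) by (intro line_kernel_scaled_le) auto
        thus ?thesis using True by simp
      next
        case False
        have "0 \<le> (1 + 4 / (1 / B)\<^sup>2) * inverse (1 + x\<^sup>2)"
          by (intro mult_nonneg_nonneg add_nonneg_nonneg) auto
        thus ?thesis using False by (auto simp: indicator_def)
      qed
    qed
  qed
  hence "(\<lambda>n. LINT x|lborel. indicator {0<..<real n} x * line_kernel (real n * I (x / real n)))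
      \<longlonglongrightarrow> pi * c"
    by (simp add: limit)
  moreover have "\<forall>\<^sub>F n in sequentially.
      (LINT x|lborel. indicator {0<..<real n} x * line_kernel (real n * I (x / real n)))
      = real n * (LINT t|M. line_kernel (real n * t))"
    using eventually_gt_at_top[of 0] by eventually_elim (simp add: kernel_integral_eq_quantile)
  ultimately show ?thesis
    by (rule Lim_transform_eventually)
qed

end

section \<open>A Tauberian theorem by characteristic functions\<close>

text \<open>
  The law of \<open>\<epsilon> V\<close> for a random variable \<open>V\<close> with law \<open>N\<close> and an independent fair sign \<open>\<epsilon>\<close>. Symmetry makes
  the characteristic function real.
\<close>

definition symmetrization :: "real measure \<Rightarrow> real measure" where
  "symmetrization N =
     distr (N \<Otimes>\<^sub>M measure_pmf (bernoulli_pmf (1/2))) borel (\<lambda>(v, b). if b then v else - v)"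

lemma real_distribution_symmetrization:
  assumes "real_distribution N"
  shows "real_distribution (symmetrization N)"
proof -
  interpret N: real_distribution N by fact
  interpret P: pair_prob_space N "measure_pmf (bernoulli_pmf (1/2))" ..
  have "(\<lambda>(v, b). if b then v else - v) \<in> borel_measurable (N \<Otimes>\<^sub>M measure_pmf (bernoulli_pmf (1/2)))"
    by measurable
  thus ?thesis
    unfolding symmetrization_def
    by (auto simp: real_distribution_def real_distribution_axioms_def intro!: P.prob_space_distr)
qed

lemma integral_symmetrization:
  fixes f :: "real \<Rightarrow> 'b::{banach, second_countable_topology}"
  assumes "real_distribution N" and [measurable]: "f \<in> borel_measurable borel"
    and f: "\<And>x. norm (f x) \<le> B"
  shows "(LINT v|symmetrization N. f v) = (LINT v|N. (1/2) *\<^sub>R (f v + f (- v)))"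
proof -
  interpret N: real_distribution N by fact
  interpret P: pair_prob_space N "measure_pmf (bernoulli_pmf (1/2))" ..
  have [measurable]: "(\<lambda>(v, b). if b then v else - v) \<in> borel_measurable (N \<Otimes>\<^sub>M measure_pmf (bernoulli_pmf (1/2)))"
    by measurable
  have int: "integrable (N \<Otimes>\<^sub>M measure_pmf (bernoulli_pmf (1/2))) (\<lambda>x. f (case x of (v, b) \<Rightarrow> if b then v else - v))"
    by (rule P.integrable_const_bound[of _ B]) (auto intro!: AE_I2 f)
  have "(LINT v|symmetrization N. f v)
      = (LINT x|(N \<Otimes>\<^sub>M measure_pmf (bernoulli_pmf (1/2))). f (case x of (v, b) \<Rightarrow> if b then v else - v))"
    unfolding symmetrization_def by (rule integral_distr) auto
  also have "\<dots> = (LINT v|N. LINT b|measure_pmf (bernoulli_pmf (1/2)). f (if b then v else - v))"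
    using P.integral_fst'[OF int] by simp
  also have "(\<lambda>v. LINT b|measure_pmf (bernoulli_pmf (1/2)). f (if b then v else - v))
       = (\<lambda>v. (1/2) *\<^sub>R (f v + f (- v)))"
    by (intro ext, subst integral_measure_pmf[of UNIV]) (auto simp: UNIV_bool scaleR_add_right)
  finally show ?thesis .
qed

lemma char_symmetrization:
  assumes "real_distribution N"
  shows "char (symmetrization N) t = of_real (LINT v|N. cos (t * v))"
proof -
  have "char (symmetrization N) t = (LINT v|N. (1/2) *\<^sub>R (iexp (t * v) + iexp (t * - v)))"
    unfolding char_def
    by (rule integral_symmetrization[OF assms, where B = 1]) (auto simp: norm_exp_i_times)
  also have "(\<lambda>v. (1/2) *\<^sub>R (iexp (t * v) + iexp (t * - v))) = (\<lambda>v. complex_of_real (cos (t * v)))"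
    by (rule ext) (auto simp: complex_eq_iff Re_exp Im_exp)
  finally show ?thesis by simp
qed

text \<open>
  Multiplication by a cosine turns \<open>line_kernel\<close> into a second difference of its own dilations, since
  \<open>2 cos (s v) cos v = cos ((s + 1) v) + cos ((s - 1) v)\<close>. This is why characteristic functions of laws
  with this density are governed by the dilated kernels alone.
\<close>

lemma line_kernel_cos:
  "cos (s * v) * line_kernel v
    = ((s + 1)\<^sup>2 * line_kernel ((s + 1) * v) + (s - 1)\<^sup>2 * line_kernel ((s - 1) * v)
        - 2 * (s\<^sup>2 * line_kernel (s * v))) / 2"
proof (cases "v = 0")
  case False
  have k: "r\<^sup>2 * line_kernel (r * v) = 2 * (1 - cos (r * v)) / v\<^sup>2" for r
    using False by (cases "r = 0") (auto simp: line_kernel_eq_cos power_mult_distrib)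
  have c: "cos ((s + 1) * v) + cos ((s - 1) * v) = 2 * cos (s * v) * cos v"
    by (simp add: distrib_right left_diff_distrib cos_add cos_diff)
  have "((s + 1)\<^sup>2 * line_kernel ((s + 1) * v) + (s - 1)\<^sup>2 * line_kernel ((s - 1) * v)
        - 2 * (s\<^sup>2 * line_kernel (s * v))) / 2
      = (2 * (1 - cos ((s + 1) * v)) + 2 * (1 - cos ((s - 1) * v)) - 4 * (1 - cos (s * v))) / v\<^sup>2 / 2"
    unfolding k by (simp add: add_divide_distrib diff_divide_distrib)
  also have "\<dots> = (4 * cos (s * v) - 2 * (cos ((s + 1) * v) + cos ((s - 1) * v))) / v\<^sup>2 / 2"
    by simp
  also have "\<dots> = cos (s * v) * (2 * (1 - cos v) / v\<^sup>2)"
    unfolding c by (simp add: right_diff_distrib diff_divide_distrib mult_ac)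
  finally show ?thesis using False by (simp add: line_kernel_eq_cos)
qed (simp add: power2_eq_square algebra_simps)

lemma LBINT_line_kernel_scaled: "(LINT v|lborel. s\<^sup>2 * line_kernel (s * v)) = 2 * pi * \<bar>s\<bar>"
proof (cases "s = 0")
  case False
  have "2 * pi = \<bar>s\<bar> * (LINT v|lborel. line_kernel (0 + s * v))"
    using False by (subst LBINT_line_kernel[symmetric], subst lborel_integral_real_affine[of s _ 0]) auto
  hence "2 * pi * \<bar>s\<bar> = \<bar>s\<bar> * \<bar>s\<bar> * (LINT v|lborel. line_kernel (s * v))" by simp
  thus ?thesis by (simp add: power2_eq_square)
qed simp

lemma integrable_line_kernel_scaled: "integrable lborel (\<lambda>v. s\<^sup>2 * line_kernel (s * v))"
  using lborel_integrable_real_affine_iff[of s line_kernel 0] integrable_line_kernel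
  by (cases "s = 0") auto

text \<open>
  The tent \<open>max 0 (1 - |s|)\<close>, written as the second difference of the absolute value, which is the form in
  which it arises.
\<close>

definition triangle :: "real \<Rightarrow> real" where
  "triangle s = (\<bar>s + 1\<bar> + \<bar>s - 1\<bar> - 2 * \<bar>s\<bar>) / 2"

lemma LBINT_line_kernel_cos: "(LINT v|lborel. cos (s * v) * line_kernel v) = 2 * pi * triangle s"
proof -
  have "(LINT v|lborel. cos (s * v) * line_kernel v)
      = ((LINT v|lborel. (s + 1)\<^sup>2 * line_kernel ((s + 1) * v))
         + (LINT v|lborel. (s - 1)\<^sup>2 * line_kernel ((s - 1) * v))
         - 2 * (LINT v|lborel. s\<^sup>2 * line_kernel (s * v))) / 2"
    unfolding line_kernel_cos
    by (subst integral_divide_zero, subst Bochner_Integration.integral_diff,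
        intro Bochner_Integration.integrable_add integrable_line_kernel_scaled,
        intro integrable_mult_right integrable_line_kernel_scaled,
        subst Bochner_Integration.integral_add)
      (simp_all only: integrable_line_kernel_scaled integral_mult_right_zero)
  thus ?thesis
    unfolding LBINT_line_kernel_scaled triangle_def by (simp add: algebra_simps)
qed

text \<open>
  The limit law of the Tauberian argument, whose characteristic function is the tent.
\<close>

definition fejer_law :: "real measure" where
  "fejer_law = density lborel (\<lambda>v. ennreal (line_kernel v / (2 * pi)))"

lemma integral_fejer_law:
  assumes [measurable]: "f \<in> borel_measurable borel"
  shows "(LINT v|fejer_law. f v) = (LINT v|lborel. line_kernel v / (2 * pi) * f v)"
  unfolding fejer_law_def by (subst integral_density) auto

lemma real_distribution_fejer_law: "real_distribution fejer_law"
proof -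
  have "emeasure fejer_law (space fejer_law) = (\<integral>\<^sup>+v. ennreal (line_kernel v / (2 * pi)) \<partial>lborel)"
    by (simp add: fejer_law_def emeasure_density)
  also have "\<dots> = ennreal (LINT v|lborel. line_kernel v / (2 * pi))"
    by (rule nn_integral_eq_integral) (auto intro: integrable_line_kernel)
  also have "\<dots> = 1" by (simp add: LBINT_line_kernel)
  finally have "prob_space fejer_law" by (rule prob_spaceI)
  thus ?thesis
    by (simp add: real_distribution_def real_distribution_axioms_def fejer_law_def)
qed

text \<open>
  The Fourier transform needs no contour integral: the integral of \<open>s\<^sup>2 * line_kernel (s * v)\<close> over the line
  is \<open>2 * pi * |s|\<close> by scaling, and the transform is the second difference of these.
\<close>

lemma char_fejer_law: "char fejer_law s = of_real (triangle s)"
proof -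
  interpret real_distribution fejer_law by (rule real_distribution_fejer_law)
  have i: "integrable fejer_law (\<lambda>v. iexp (s * v))"
    by (rule integrable_const_bound[of _ 1]) (auto simp: fejer_law_def)
  have "Im (char fejer_law s) = (LINT v|fejer_law. sin (s * v))"
    unfolding char_def by (subst integral_Im[OF i, symmetric]) (simp_all add: i Im_exp)
  also have "\<dots> = (LINT v|lborel. line_kernel v / (2 * pi) * sin (s * v))"
    by (rule integral_fejer_law) simp
  also have "\<dots> = (LINT v|lborel. line_kernel (0 + -1 * v) / (2 * pi) * sin (s * (0 + -1 * v)))"
    by (subst lborel_integral_real_affine[of "-1" _ 0]) auto
  also have "\<dots> = - (LINT v|lborel. line_kernel v / (2 * pi) * sin (s * v))"
    by simp
  also have "\<dots> = - (LINT v|fejer_law. sin (s * v))"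
    by (subst integral_fejer_law) auto
  also have "(LINT v|fejer_law. sin (s * v)) = Im (char fejer_law s)"
    unfolding char_def by (subst integral_Im[OF i, symmetric]) (simp_all add: i Im_exp)
  finally have Im: "Im (char fejer_law s) = 0"
    by simp
  have "Re (char fejer_law s) = (LINT v|fejer_law. cos (s * v))"
    unfolding char_def by (subst integral_Re[OF i, symmetric]) (simp_all add: i Re_exp)
  also have "\<dots> = (LINT v|lborel. line_kernel v / (2 * pi) * cos (s * v))"
    by (rule integral_fejer_law) simp
  also have "\<dots> = (LINT v|lborel. cos (s * v) * line_kernel v) / (2 * pi)"
    by (subst integral_divide_zero[symmetric]) (simp add: mult_ac)
  also have "\<dots> = triangle s"
    by (simp add: LBINT_line_kernel_cos)
  finally show ?thesis using Im by (simp add: complex_eq_iff)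
qed

lemma line_kernel_nonzero: "- 1 \<le> v \<Longrightarrow> v \<le> 1 \<Longrightarrow> line_kernel v \<noteq> 0"
  using line_kernel_pos[of v] by (simp add: abs_le_iff)

text \<open>
  The weighted form of \<open>(p + q)\<^sup>2 \<le> 2 p\<^sup>2 + 2 q\<^sup>2\<close>: the constant in front of the main term can be
  made arbitrarily close to \<open>1\<close>.
\<close>

lemma kernel_split_aux:
  assumes e: "0 < (e::real)" and pqr: "\<bar>r\<bar> \<le> \<bar>p\<bar> + \<bar>q\<bar>"
  shows "r\<^sup>2 \<le> (1 + e) * p\<^sup>2 + (1 + 1 / e) * q\<^sup>2"
proof -
  have "\<bar>r\<bar>\<^sup>2 \<le> (\<bar>p\<bar> + \<bar>q\<bar>)\<^sup>2"
    using pqr by (intro power_mono) auto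
  moreover have "0 \<le> (e * \<bar>p\<bar> - \<bar>q\<bar>)\<^sup>2 / e" using e by simp
  moreover have "(e * \<bar>p\<bar> - \<bar>q\<bar>)\<^sup>2 / e = e * p\<^sup>2 + q\<^sup>2 / e - 2 * \<bar>p\<bar> * \<bar>q\<bar>"
    using e by (simp add: field_simps power2_eq_square)
  ultimately show ?thesis
    by (simp add: power2_sum algebra_simps)
qed

text \<open>
  For \<open>t \<noteq> 0\<close> the quantity \<open>a\<^sup>2 * line_kernel (a * t)\<close> is the square of \<open>2 sin (a t / 2) / t\<close>, and
  \<open>a \<mapsto> |sin (a t / 2)|\<close> is subadditive.
\<close>

lemma kernel_split:
  assumes e: "0 < e"
  shows "(a + b)\<^sup>2 * line_kernel ((a + b) * t)
     \<le> (1 + e) * (a\<^sup>2 * line_kernel (a * t)) + (1 + 1 / e) * (b\<^sup>2 * line_kernel (b * t))"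
proof (cases "t = 0")
  case True
  show ?thesis using kernel_split_aux[OF e abs_triangle_ineq[of a b]] by (simp add: True)
next
  case False
  have k: "s\<^sup>2 * line_kernel (s * t) = 4 * (sin (s * t / 2))\<^sup>2 / t\<^sup>2" for s
    using False by (cases "s = 0") (auto simp: line_kernel_eq_sin power_mult_distrib)
  have "sin ((a + b) * t / 2) = sin (a * t / 2) * cos (b * t / 2) + cos (a * t / 2) * sin (b * t / 2)"
    by (simp add: distrib_right add_divide_distrib sin_add)
  also have "\<bar>\<dots>\<bar> \<le> \<bar>sin (a * t / 2)\<bar> * \<bar>cos (b * t / 2)\<bar> + \<bar>cos (a * t / 2)\<bar> * \<bar>sin (b * t / 2)\<bar>"
    by (metis abs_mult abs_triangle_ineq)
  also have "\<dots> \<le> \<bar>sin (a * t / 2)\<bar> * 1 + 1 * \<bar>sin (b * t / 2)\<bar>"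
    by (intro add_mono mult_mono) auto
  finally have "\<bar>sin ((a + b) * t / 2)\<bar> \<le> \<bar>sin (a * t / 2)\<bar> + \<bar>sin (b * t / 2)\<bar>" by simp
  from kernel_split_aux[OF e this]
  have "4 / t\<^sup>2 * (sin ((a + b) * t / 2))\<^sup>2
      \<le> 4 / t\<^sup>2 * ((1 + e) * (sin (a * t / 2))\<^sup>2 + (1 + 1 / e) * (sin (b * t / 2))\<^sup>2)"
    by (intro mult_left_mono) auto
  thus ?thesis
    unfolding k by (simp add: distrib_left mult_ac)
qed

context real_distribution
begin

text \<open>
  At a positive integer \<open>n\<close> this is \<open>n\<close> times the integral of the \<open>n\<close>-th kernel. Real parameters are needed
  because the characteristic functions below involve all dilations.
\<close>

definition kernel_energy :: "real \<Rightarrow> real" where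
  "kernel_energy s = (LINT t|M. s\<^sup>2 * line_kernel (s * t))"

lemma integrable_kernel: "integrable M (\<lambda>t. s\<^sup>2 * line_kernel (s * t))"
  by (rule integrable_const_bound[of _ "s\<^sup>2"])
    (auto simp: abs_mult mult_left_le line_kernel_le_1)

lemma kernel_energy_minus [simp]: "kernel_energy (- s) = kernel_energy s"
  by (simp add: kernel_energy_def)

lemma kernel_energy_0 [simp]: "kernel_energy 0 = 0"
  by (simp add: kernel_energy_def)

lemma kernel_energy_le: "kernel_energy s \<le> s\<^sup>2"
proof -
  have "kernel_energy s \<le> (LINT t|M. s\<^sup>2)"
    unfolding kernel_energy_def
    by (intro integral_mono integrable_kernel) (auto simp: mult_left_le line_kernel_le_1)
  thus ?thesis using prob_space by simp
qed

text \<open>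
  A change of the parameter by at most \<open>1\<close> costs a factor close to \<open>1\<close> and an additive constant, which
  allows one to pass from integer to real parameters.
\<close>

lemma kernel_energy_add:
  assumes e: "0 < e" and b: "\<bar>b\<bar> \<le> 1"
  shows "kernel_energy (a + b) \<le> (1 + e) * kernel_energy a + (1 + 1 / e)"
proof -
  have "kernel_energy (a + b)
      \<le> (LINT t|M. (1 + e) * (a\<^sup>2 * line_kernel (a * t)) + (1 + 1 / e) * (b\<^sup>2 * line_kernel (b * t)))"
    unfolding kernel_energy_def
    by (intro integral_mono integrable_kernel Bochner_Integration.integrable_add
        integrable_mult_right kernel_split[OF e])
  also have "\<dots> = (1 + e) * kernel_energy a + (1 + 1 / e) * kernel_energy b"
    unfolding kernel_energy_def
    by (subst Bochner_Integration.integral_add)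
      (simp_all only: integrable_mult_right integrable_kernel integral_mult_right_zero)
  also have "kernel_energy b \<le> 1"
    using kernel_energy_le[of b] b by (meson abs_square_le_1 order_trans)
  hence "(1 + e) * kernel_energy a + (1 + 1 / e) * kernel_energy b
      \<le> (1 + e) * kernel_energy a + (1 + 1 / e)"
    using e by (intro add_left_mono mult_left_le) auto
  finally show ?thesis .
qed

text \<open>
  Along the integers the hypothesis is the claim for \<open>s = 1\<close>. For other \<open>s > 0\<close> the parameter \<open>s n\<close> is
  compared with its integer part.
\<close>

lemma kernel_energy_limit:
  assumes lim: "(\<lambda>n. real n * (LINT t|M. line_kernel (real n * t))) \<longlonglongrightarrow> l"
  shows "(\<lambda>n. kernel_energy (s * real n) / real n) \<longlonglongrightarrow> \<bar>s\<bar> * l"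
proof -
  have pos: "(\<lambda>n. kernel_energy (s * real n) / real n) \<longlonglongrightarrow> s * l" if s: "s > 0" for s
  proof -
    define a where "a = (\<lambda>n. nat \<lfloor>s * real n\<rfloor>)"
    have a: "real (a n) \<le> s * real n" "s * real n - 1 \<le> real (a n)" for n
      using s by (simp_all add: a_def of_nat_nat)
    have a_div: "(\<lambda>n. real (a n) / real n) \<longlonglongrightarrow> s"
    proof (rule tendsto_sandwich)
      show "\<forall>\<^sub>F n in sequentially. (s * real n - 1) / real n \<le> real (a n) / real n"
        by (intro always_eventually allI divide_right_mono a) auto
      show "\<forall>\<^sub>F n in sequentially. real (a n) / real n \<le> s * real n / real n"
        by (intro always_eventually allI divide_right_mono a) auto
      show "(\<lambda>n. (s * real n - 1) / real n) \<longlonglongrightarrow> s" by real_asymp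
      show "(\<lambda>n. s * real n / real n) \<longlonglongrightarrow> s" by real_asymp
    qed
    have "filterlim (\<lambda>n. s * real n - 1) at_top sequentially"
      using s by real_asymp
    hence "filterlim (\<lambda>n. real (a n)) at_top sequentially"
      by (rule filterlim_at_top_mono) (simp add: a)
    hence a_top: "filterlim a at_top sequentially"
      by (simp add: filterlim_sequentially_iff_filterlim_real)
    have "(\<lambda>n. real (a n) / real n * (real (a n) * (LINT t|M. line_kernel (real (a n) * t)))) \<longlonglongrightarrow> s * l"
      by (intro tendsto_mult a_div filterlim_compose[OF lim a_top])
    also have "(\<lambda>n. real (a n) / real n * (real (a n) * (LINT t|M. line_kernel (real (a n) * t))))
        = (\<lambda>n. kernel_energy (real (a n)) / real n)"
      by (simp add: kernel_energy_def power2_eq_square mult_ac)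
    finally have Da: "(\<lambda>n. kernel_energy (real (a n)) / real n) \<longlonglongrightarrow> s * l" .
    \<comment> \<open>\<open>e = 1 / sqrt n\<close> balances the two error terms: both \<open>e\<close> and \<open>(1 + 1 / e) / n\<close> tend to \<open>0\<close>\<close>
    show ?thesis
    proof (rule tendsto_sandwich)
      show "\<forall>\<^sub>F n in sequentially. kernel_energy (s * real n) / real n
          \<le> (1 + 1 / sqrt (real n)) * (kernel_energy (real (a n)) / real n) + (1 + sqrt (real n)) / real n"
        using eventually_gt_at_top[of 0]
      proof eventually_elim
        case (elim n)
        have "kernel_energy (real (a n) + (s * real n - real (a n)))
            \<le> (1 + 1 / sqrt (real n)) * kernel_energy (real (a n)) + (1 + 1 / (1 / sqrt (real n)))"
          by (rule kernel_energy_add) (use elim a[of n] in auto)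
        hence "kernel_energy (s * real n) / real n
            \<le> ((1 + 1 / sqrt (real n)) * kernel_energy (real (a n)) + (1 + sqrt (real n))) / real n"
          by (intro divide_right_mono) auto
        thus ?case by (simp add: add_divide_distrib)
      qed
      show "\<forall>\<^sub>F n in sequentially.
          (kernel_energy (real (a n)) / real n - (1 + sqrt (real n)) / real n) / (1 + 1 / sqrt (real n))
          \<le> kernel_energy (s * real n) / real n"
        using eventually_gt_at_top[of 0]
      proof eventually_elim
        case (elim n)
        have "kernel_energy (s * real n + (real (a n) - s * real n))
            \<le> (1 + 1 / sqrt (real n)) * kernel_energy (s * real n) + (1 + 1 / (1 / sqrt (real n)))"
          by (rule kernel_energy_add) (use elim a[of n] in auto)
        hence "kernel_energy (real (a n)) / real n
            \<le> ((1 + 1 / sqrt (real n)) * kernel_energy (s * real n) + (1 + sqrt (real n))) / real n"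
          by (intro divide_right_mono) auto
        also have "\<dots> = (1 + 1 / sqrt (real n)) * (kernel_energy (s * real n) / real n) + (1 + sqrt (real n)) / real n"
          by (simp add: add_divide_distrib)
        finally have *: "kernel_energy (real (a n)) / real n - (1 + sqrt (real n)) / real n
            \<le> (1 + 1 / sqrt (real n)) * (kernel_energy (s * real n) / real n)" by simp
        have "0 < 1 + 1 / sqrt (real n)" using elim by (intro add_pos_pos) auto
        thus ?case using * by (subst pos_divide_le_eq) (simp_all add: mult_ac)
      qed
      have 1: "(\<lambda>n. 1 + 1 / sqrt (real n)) \<longlonglongrightarrow> 1" by real_asymp
      have 2: "(\<lambda>n. (1 + sqrt (real n)) / real n) \<longlonglongrightarrow> 0" by real_asymp
      show "(\<lambda>n. (1 + 1 / sqrt (real n)) * (kernel_energy (real (a n)) / real n) + (1 + sqrt (real n)) / real n)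
          \<longlonglongrightarrow> s * l"
        using tendsto_add[OF tendsto_mult[OF 1 Da] 2] by simp
      show "(\<lambda>n. (kernel_energy (real (a n)) / real n - (1 + sqrt (real n)) / real n) / (1 + 1 / sqrt (real n)))
          \<longlonglongrightarrow> s * l"
        using tendsto_divide[OF tendsto_diff[OF Da 2] 1] by simp
    qed
  qed
  consider "s > 0" | "s = 0" | "s < 0" by linarith
  thus ?thesis
  proof cases
    case 3
    thus ?thesis using pos[of "- s"] by simp
  qed (use pos[of s] in auto)
qed

text \<open>
  The measure with density proportional to the \<open>n\<close>-th kernel, normalised to a probability measure and rescaled
  by \<open>n\<close>, so that the mass within \<open>1 / n\<close> of the origin is seen on \<open>[-1, 1]\<close>.
\<close>

definition kernel_law :: "nat \<Rightarrow> real measure" where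
  "kernel_law n = distr
     (density M (\<lambda>t. ennreal ((real n)\<^sup>2 * line_kernel (real n * t) / kernel_energy (real n))))
     borel (\<lambda>t. real n * t)"

lemma real_distribution_kernel_law:
  assumes "0 < kernel_energy (real n)"
  shows "real_distribution (kernel_law n)"
proof -
  let ?d = "\<lambda>t. (real n)\<^sup>2 * line_kernel (real n * t) / kernel_energy (real n)"
  have "emeasure (density M (\<lambda>t. ennreal (?d t))) (space (density M (\<lambda>t. ennreal (?d t))))
      = (\<integral>\<^sup>+t. ennreal (?d t) \<partial>M)"
    by (subst emeasure_density) (auto intro!: nn_integral_cong)
  also have "\<dots> = ennreal (LINT t|M. ?d t)"
    using assms by (intro nn_integral_eq_integral integrable_divide integrable_kernel) auto
  also have "(LINT t|M. ?d t) = kernel_energy (real n) / kernel_energy (real n)"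
    by (simp only: integral_divide_zero kernel_energy_def)
  also have "\<dots> = 1" using assms by simp
  finally have "prob_space (density M (\<lambda>t. ennreal (?d t)))"
    by (intro prob_spaceI) simp
  from prob_space.prob_space_distr[OF this, of "\<lambda>t. real n * t" borel] show ?thesis
    by (simp add: kernel_law_def real_distribution_def real_distribution_axioms_def)
qed

lemma integral_kernel_law:
  fixes f :: "real \<Rightarrow> real"
  assumes [measurable]: "f \<in> borel_measurable borel" and "0 < kernel_energy (real n)"
  shows "(LINT v|kernel_law n. f v)
    = (LINT t|M. (real n)\<^sup>2 * (line_kernel (real n * t) * f (real n * t))) / kernel_energy (real n)"
  using assms(2) unfolding kernel_law_def
  by (subst integral_distr, simp, simp, subst integral_density)
    (simp_all add: mult.assoc)

text \<open>
  The finite-\<open>n\<close> counterpart of the second difference that defines the tent.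
\<close>

lemma char_symmetrization_kernel_law:
  assumes "0 < kernel_energy (real n)"
  shows "char (symmetrization (kernel_law n)) s
    = of_real ((kernel_energy ((s + 1) * real n) + kernel_energy ((s - 1) * real n)
        - 2 * kernel_energy (s * real n)) / 2 / kernel_energy (real n))"
proof -
  let ?k = "\<lambda>r t. (r * real n)\<^sup>2 * line_kernel (r * real n * t)"
  have "(\<lambda>t. (real n)\<^sup>2 * (line_kernel (real n * t) * cos (s * (real n * t))))
      = (\<lambda>t. (?k (s + 1) t + ?k (s - 1) t - 2 * ?k s t) / 2)"
    unfolding mult.commute[of "line_kernel (real n * _)"] line_kernel_cos power_mult_distrib mult.assoc
    by (simp add: algebra_simps)
  hence "(LINT t|M. (real n)\<^sup>2 * (line_kernel (real n * t) * cos (s * (real n * t))))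
      = (LINT t|M. (?k (s + 1) t + ?k (s - 1) t - 2 * ?k s t) / 2)" by (simp only:)
  also have "\<dots> = (kernel_energy ((s + 1) * real n) + kernel_energy ((s - 1) * real n)
        - 2 * kernel_energy (s * real n)) / 2"
    unfolding kernel_energy_def
    by (subst integral_divide_zero, subst Bochner_Integration.integral_diff,
        intro Bochner_Integration.integrable_add integrable_kernel,
        intro integrable_mult_right integrable_kernel,
        subst Bochner_Integration.integral_add)
      (simp_all only: integrable_kernel integral_mult_right_zero)
  finally have "(LINT v|kernel_law n. cos (s * v)) = (kernel_energy ((s + 1) * real n)
      + kernel_energy ((s - 1) * real n) - 2 * kernel_energy (s * real n)) / 2 / kernel_energy (real n)"
    by (subst integral_kernel_law[OF _ assms]) (simp, simp only:)
  thus ?thesis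
    by (simp only: char_symmetrization[OF real_distribution_kernel_law[OF assms]])
qed

text \<open>
  For \<open>c = 0\<close> the normalising constants of the kernel laws are of smaller order than \<open>n\<close>, and positivity of the
  kernel on \<open>[-1, 1]\<close> already bounds the mass.
\<close>

lemma kernel_limit_imp_cdf_limit_seq_0:
  assumes lim: "(\<lambda>n. real n * (LINT t|M. line_kernel (real n * t))) \<longlonglongrightarrow> 0"
  shows "(\<lambda>n. real n * measure M {0..1 / real n}) \<longlonglongrightarrow> 0"
proof -
  obtain b where b: "b > 0" "\<And>v. \<bar>v\<bar> \<le> 1 \<Longrightarrow> b \<le> line_kernel v"
    using line_kernel_lower_bound by blast
  have int: "integrable M (\<lambda>t. line_kernel (real n * t))" for n
    by (rule integrable_const_bound[of _ 1]) (auto simp: line_kernel_le_1)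
  show ?thesis
  proof (rule tendsto_sandwich[of "\<lambda>_. 0"])
    show "\<forall>\<^sub>F n in sequentially. real n * measure M {0..1 / real n}
        \<le> real n * (LINT t|M. line_kernel (real n * t)) / b"
      using eventually_gt_at_top[of 0]
    proof eventually_elim
      case (elim n)
      have "b * measure M {0..1 / real n} = (LINT t|M. b * indicator {0..1 / real n} t)"
        by simp
      also have "\<dots> \<le> (LINT t|M. line_kernel (real n * t))"
      proof (intro integral_mono int)
        show "b * indicator {0..1 / real n} t \<le> line_kernel (real n * t)" for t
          using b(2)[of "real n * t"] elim by (auto simp: indicator_def field_simps)
      qed (auto intro!: integrable_mult_right integrable_real_indicator simp: emeasure_eq_measure)
      finally show ?case
        using b(1) elim by (simp add: field_simps)
    qed
    show "(\<lambda>n. real n * (LINT t|M. line_kernel (real n * t)) / b) \<longlonglongrightarrow> 0"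
      using tendsto_divide[OF lim tendsto_const[of b]] b(1) by simp
  qed (auto intro!: always_eventually)
qed

text \<open>
  The Tauberian direction. The characteristic functions of the symmetrised kernel laws converge to the
  tent, so the laws converge weakly to \<open>fejer_law\<close>. Testing with \<open>1 / line_kernel\<close> on \<open>[-1, 1]\<close>, which is
  bounded and discontinuous only at two points, removes the density and leaves the mass of the interval.
\<close>

lemma kernel_limit_imp_cdf_limit_seq_pos:
  assumes lim: "(\<lambda>n. real n * (LINT t|M. line_kernel (real n * t))) \<longlonglongrightarrow> pi * c"
    and c: "0 < c"
  shows "(\<lambda>n. real n * measure M {- (1 / real n)..1 / real n}) \<longlonglongrightarrow> c"
proof -
  have E: "(\<lambda>n. kernel_energy (s * real n) / real n) \<longlonglongrightarrow> \<bar>s\<bar> * (pi * c)" for s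
    by (rule kernel_energy_limit[OF lim])
  have "\<forall>\<^sub>F n in sequentially. 0 < kernel_energy (1 * real n) / real n"
    by (rule order_tendstoD(1)[OF E[of 1]]) (use c in simp)
  hence pos: "\<forall>\<^sub>F n in sequentially. 0 < kernel_energy (real n)"
    by eventually_elim (auto simp: zero_less_divide_iff)
  \<comment> \<open>the default is used for finitely many \<open>n\<close> only\<close>
  define Q where "Q = (\<lambda>n. if 0 < kernel_energy (real n)
      then symmetrization (kernel_law n) else fejer_law)"
  have Q: "real_distribution (Q n)" for n
    by (auto simp: Q_def real_distribution_fejer_law real_distribution_kernel_law
        intro!: real_distribution_symmetrization)
  have "(\<lambda>n. char (Q n) s) \<longlonglongrightarrow> char fejer_law s" for s
  proof -
    let ?D = "\<lambda>r n. kernel_energy (r * real n) / real n"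
    let ?c = "\<lambda>n. (?D (s + 1) n + ?D (s - 1) n - 2 * ?D s n) / 2 / ?D 1 n"
    have "?c \<longlonglongrightarrow> (\<bar>s + 1\<bar> * (pi * c) + \<bar>s - 1\<bar> * (pi * c) - 2 * (\<bar>s\<bar> * (pi * c))) / 2 / (\<bar>1\<bar> * (pi * c))"
      using c by (intro tendsto_intros E) auto
    also have "(\<bar>s + 1\<bar> * (pi * c) + \<bar>s - 1\<bar> * (pi * c) - 2 * (\<bar>s\<bar> * (pi * c))) / 2 / (\<bar>1\<bar> * (pi * c))
        = triangle s"
      using c by (simp add: triangle_def field_simps)
    finally have "(\<lambda>n. complex_of_real (?c n)) \<longlonglongrightarrow> char fejer_law s"
      unfolding char_fejer_law by (rule tendsto_of_real)
    moreover have "\<forall>\<^sub>F n in sequentially. complex_of_real (?c n) = char (Q n) s"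
      using pos eventually_gt_at_top[of 0]
    proof eventually_elim
      case (elim n)
      have "?c n = (kernel_energy ((s + 1) * real n) + kernel_energy ((s - 1) * real n)
        - 2 * kernel_energy (s * real n)) / real n / 2 / (kernel_energy (real n) / real n)"
        by (simp add: add_divide_distrib diff_divide_distrib)
      also have "\<dots> = (kernel_energy ((s + 1) * real n) + kernel_energy ((s - 1) * real n)
        - 2 * kernel_energy (s * real n)) / 2 / kernel_energy (real n)"
        using elim by (simp add: field_simps)
      finally show ?case
        using elim by (simp only: Q_def char_symmetrization_kernel_law if_True)
    qed
    ultimately show ?thesis by (rule Lim_transform_eventually)
  qed
  hence conv: "weak_conv_m Q fejer_law"
    by (intro levy_continuity Q real_distribution_fejer_law)
  obtain b where b: "b > 0" "\<And>v. \<bar>v\<bar> \<le> 1 \<Longrightarrow> b \<le> line_kernel v"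
    using line_kernel_lower_bound by blast
  define f where "f = (\<lambda>v. indicator {-1..1} v / line_kernel v)"
  have f_meas [measurable]: "f \<in> borel_measurable borel"
    unfolding f_def by measurable
  have f_bound: "norm (f v) \<le> 1 / b" for v
    using b(1) b(2)[of v] line_kernel_pos[of v] by (auto simp: f_def indicator_def intro!: divide_left_mono mult_pos_pos)
  have "isCont f v" if "v \<noteq> 1" "v \<noteq> -1" for v
  proof (cases "\<bar>v\<bar> < 1")
    case True
    have "\<forall>\<^sub>F u in nhds v. u \<in> {-1<..<1}"
      by (intro eventually_nhds_in_open) (use True in auto)
    hence ev: "\<forall>\<^sub>F u in nhds v. f u = 1 / line_kernel u"
      by eventually_elim (auto simp: f_def)
    have "isCont (\<lambda>u. 1 / line_kernel u) v"
      using True line_kernel_pos[of v] by (intro continuous_intros isCont_line_kernel) auto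
    thus ?thesis using isCont_cong[OF ev] by simp
  next
    case False
    have "\<forall>\<^sub>F u in nhds v. u \<in> - {-1..1}"
      by (intro eventually_nhds_in_open) (use False that in auto)
    hence ev: "\<forall>\<^sub>F u in nhds v. f u = 0"
      by eventually_elim (auto simp: f_def)
    show ?thesis using isCont_cong[OF ev] by simp
  qed
  hence "{v. \<not> isCont f v} \<subseteq> {-1, 1}" by blast
  moreover have "emeasure fejer_law {-1, 1} = 0"
  proof -
    have "AE v in lborel. ennreal (line_kernel v / (2 * pi)) * indicator {-1, 1} v = 0"
      using AE_lborel_singleton[of 1] AE_lborel_singleton[of "-1"]
      by eventually_elim (auto simp: indicator_def)
    thus ?thesis
      unfolding fejer_law_def by (subst emeasure_density) (auto simp: nn_integral_0_iff_AE)
  qed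
  ultimately have discont: "emeasure fejer_law {v. \<not> isCont f v} = 0"
    by (metis emeasure_mono emeasure_empty le_zero_eq fejer_law_def sets_density sets_lborel
        borel_closed finite_imp_closed finite.intros)
  have f_lim: "(\<lambda>n. LINT v|Q n. f v) \<longlonglongrightarrow> (LINT v|fejer_law. f v)"
    by (rule weak_conv_imp_bdd_ae_continuous_conv[OF Q real_distribution_fejer_law conv _ f_bound f_meas])
      (simp add: measure_def discont)
  have "(LINT v|fejer_law. f v) = (LINT v|lborel. indicator {-1..1::real} v / (2 * pi))"
    unfolding integral_fejer_law[OF f_meas]
  proof (rule Bochner_Integration.integral_cong[OF refl])
    fix v :: real
    show "line_kernel v / (2 * pi) * f v = indicator {-1..1} v / (2 * pi)"
      using line_kernel_nonzero[of v] by (cases "v \<in> {-1..1}") (auto simp: f_def)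
  qed
  also have "\<dots> = 1 / pi" by simp
  finally have f_lim: "(\<lambda>n. LINT v|Q n. f v) \<longlonglongrightarrow> 1 / pi" using f_lim by simp
  have "(\<lambda>n. (LINT v|Q n. f v) * (kernel_energy (1 * real n) / real n)) \<longlonglongrightarrow> 1 / pi * (\<bar>1\<bar> * (pi * c))"
    by (intro tendsto_mult f_lim E)
  hence "(\<lambda>n. (LINT v|Q n. f v) * (kernel_energy (1 * real n) / real n)) \<longlonglongrightarrow> c" by simp
  moreover have "\<forall>\<^sub>F n in sequentially. (LINT v|Q n. f v) * (kernel_energy (1 * real n) / real n)
      = real n * measure M {- (1 / real n)..1 / real n}"
    using pos eventually_gt_at_top[of 0]
  proof eventually_elim
    case (elim n)
    have "(LINT v|Q n. f v) = (LINT v|kernel_law n. (1/2) *\<^sub>R (f v + f (- v)))"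
      using elim f_bound
      by (simp add: Q_def integral_symmetrization[where B = "1 / b"] real_distribution_kernel_law)
    also have "(\<lambda>v. (1/2) *\<^sub>R (f v + f (- v))) = f"
      by (auto simp: f_def indicator_def)
    also have "(LINT v|kernel_law n. f v)
      = (LINT t|M. (real n)\<^sup>2 * (line_kernel (real n * t) * f (real n * t))) / kernel_energy (real n)"
      using elim by (intro integral_kernel_law) auto
    also have "(\<lambda>t. (real n)\<^sup>2 * (line_kernel (real n * t) * f (real n * t)))
        = (\<lambda>t. (real n)\<^sup>2 * indicator {- (1 / real n)..1 / real n} t)"
    proof
      fix t
      have "real n * t \<in> {-1..1} \<longleftrightarrow> t \<in> {- (1 / real n)..1 / real n}"
        using elim by (auto simp: field_simps)
      thus "(real n)\<^sup>2 * (line_kernel (real n * t) * f (real n * t))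
          = (real n)\<^sup>2 * indicator {- (1 / real n)..1 / real n} t"
        using line_kernel_nonzero[of "real n * t"]
        by (cases "real n * t \<in> {-1..1}") (auto simp: f_def indicator_def)
    qed
    finally show ?case using elim by (simp add: power2_eq_square)
  qed
  ultimately show ?thesis by (rule Lim_transform_eventually)
qed

end

section \<open>Measures on the half-line\<close>

text \<open>
  For monotone functions the limit along \<open>1 / n\<close> controls the whole limit, because consecutive points have
  ratio tending to \<open>1\<close>.
\<close>

lemma mono_ratio_limit_iff:
  fixes f :: "real \<Rightarrow> real"
  assumes mono: "\<And>x y. 0 < x \<Longrightarrow> x \<le> y \<Longrightarrow> f x \<le> f y" and nonneg: "\<And>x. 0 < x \<Longrightarrow> 0 \<le> f x"
  shows "(\<lambda>n. real n * f (1 / real n)) \<longlonglongrightarrow> c \<longleftrightarrow> ((\<lambda>x. f x / x) \<longlongrightarrow> c) (at_right 0)"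
proof
  assume "((\<lambda>x. f x / x) \<longlongrightarrow> c) (at_right 0)"
  moreover have "filterlim (\<lambda>n. 1 / real n) (at_right 0) sequentially" by real_asymp
  ultimately have "(\<lambda>n. f (1 / real n) / (1 / real n)) \<longlonglongrightarrow> c"
    by (rule filterlim_compose)
  thus "(\<lambda>n. real n * f (1 / real n)) \<longlonglongrightarrow> c" by (simp add: mult.commute)
next
  assume lim: "(\<lambda>n. real n * f (1 / real n)) \<longlonglongrightarrow> c"
  \<comment> \<open>\<open>1 / (N x + 1) \<le> x \<le> 1 / N x\<close> as soon as \<open>N x\<close> is positive\<close>
  define N where "N = (\<lambda>x::real. nat \<lfloor>1 / x\<rfloor>)"
  have N: "real (N x) \<le> 1 / x" "1 / x \<le> real (N x) + 1" if "x > 0" for x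
    using that by (simp_all add: N_def of_nat_nat)
  have "filterlim (\<lambda>x::real. 1 / x - 1) at_top (at_right 0)" by real_asymp
  hence "filterlim (\<lambda>x. real (N x)) at_top (at_right 0)"
  proof (rule filterlim_at_top_mono)
    show "\<forall>\<^sub>F x in at_right 0. 1 / x - 1 \<le> real (N x)"
      using eventually_at_right_less[of 0]
    proof eventually_elim
      case (elim x)
      from N(2)[OF this] show ?case by linarith
    qed
  qed
  hence N_top: "filterlim N at_top (at_right 0)"
    by (simp add: filterlim_sequentially_iff_filterlim_real)
  have ev: "\<forall>\<^sub>F x in at_right 0. 0 < (x::real) \<and> 0 < N x"
    by (intro eventually_conj eventually_at_right_less eventually_compose_filterlim[OF _ N_top]
        eventually_gt_at_top)
  show "((\<lambda>x. f x / x) \<longlongrightarrow> c) (at_right 0)"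
  proof (rule tendsto_sandwich)
    show "\<forall>\<^sub>F x in at_right 0. real (N x) / (real (N x) + 1) * (real (Suc (N x)) * f (1 / real (Suc (N x)))) \<le> f x / x"
      using ev
    proof eventually_elim
      case (elim x)
      have le: "1 / real (Suc (N x)) \<le> x" using N(2)[of x] elim by (simp add: field_simps)
      have "real (N x) / (real (N x) + 1) * (real (Suc (N x)) * f (1 / real (Suc (N x))))
          = real (N x) * f (1 / real (Suc (N x)))" by (simp add: field_simps)
      also have "\<dots> \<le> 1 / x * f x"
        using elim N(1)[of x] le by (intro mult_mono mono nonneg) auto
      finally show ?case by simp
    qed
    show "\<forall>\<^sub>F x in at_right 0. f x / x \<le> (real (N x) + 1) / real (N x) * (real (N x) * f (1 / real (N x)))"
      using ev
    proof eventually_elim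
      case (elim x)
      have le: "x \<le> 1 / real (N x)" using N(1)[of x] elim by (simp add: field_simps)
      have "1 / x * f x \<le> (real (N x) + 1) * f (1 / real (N x))"
        using elim N(2)[of x] le by (intro mult_mono mono nonneg) auto
      thus ?case using elim by simp
    qed
    have "(\<lambda>n. real n / (real n + 1)) \<longlonglongrightarrow> 1" by real_asymp
    from tendsto_mult[OF this LIMSEQ_Suc[OF lim]]
    have "(\<lambda>n. real n / (real n + 1) * (real (Suc n) * f (1 / real (Suc n)))) \<longlonglongrightarrow> c" by simp
    from filterlim_compose[OF this N_top]
    show "((\<lambda>x. real (N x) / (real (N x) + 1) * (real (Suc (N x)) * f (1 / real (Suc (N x))))) \<longlongrightarrow> c) (at_right 0)" .
    have "(\<lambda>n. (real n + 1) / real n) \<longlonglongrightarrow> 1" by real_asymp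
    from tendsto_mult[OF this lim]
    have "(\<lambda>n. (real n + 1) / real n * (real n * f (1 / real n))) \<longlonglongrightarrow> c" by simp
    from filterlim_compose[OF this N_top]
    show "((\<lambda>x. (real (N x) + 1) / real (N x) * (real (N x) * f (1 / real (N x)))) \<longlongrightarrow> c) (at_right 0)" .
  qed
qed

lemma (in real_distribution) kernel_limit_iff_cdf_limit_prob:
  assumes supp: "measure M {..<0} = 0" and c: "0 \<le> c"
  shows "(\<lambda>n. real n * (LINT t|M. line_kernel (real n * t))) \<longlonglongrightarrow> pi * c
    \<longleftrightarrow> ((\<lambda>x. measure M {..x} / x) \<longlongrightarrow> c) (at_right 0)"
proof
  assume "((\<lambda>x. measure M {..x} / x) \<longlongrightarrow> c) (at_right 0)"
  moreover have "cdf_distribution M" by (rule cdf_distribution.intro) (rule real_distribution_axioms)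
  ultimately show "(\<lambda>n. real n * (LINT t|M. line_kernel (real n * t))) \<longlonglongrightarrow> pi * c"
    using cdf_distribution.kernel_limit_of_cdf_limit[of M c] c by (simp add: cdf_def)
next
  assume lim: "(\<lambda>n. real n * (LINT t|M. line_kernel (real n * t))) \<longlonglongrightarrow> pi * c"
  have eq: "measure M A = measure M {..x}" if "{0..x} \<subseteq> A" "A \<subseteq> {..x}" "A \<in> sets borel" for A x
  proof -
    have "measure M {..x} \<le> measure M (A \<union> {..<0})"
    proof (rule finite_measure_mono)
      show "{..x} \<subseteq> A \<union> {..<0}"
      proof
        fix y assume "y \<in> {..x}"
        thus "y \<in> A \<union> {..<0}" using that(1) by (cases "y < 0") auto
      qed
    qed (use that in auto)
    also have "\<dots> \<le> measure M A + measure M {..<0}"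
      using that by (intro measure_Un_le) auto
    moreover have "measure M A \<le> measure M {..x}"
      using that by (intro finite_measure_mono) auto
    ultimately show ?thesis using supp by simp
  qed
  have "(\<lambda>n. real n * measure M {..1 / real n}) \<longlonglongrightarrow> c"
  proof (cases "c = 0")
    case True
    have "measure M {0..1 / real n} = measure M {..1 / real n}" for n by (rule eq) auto
    thus ?thesis using kernel_limit_imp_cdf_limit_seq_0 lim by (simp add: True)
  next
    case False
    with c have "0 < c" by simp
    have "measure M {- (1 / real n)..1 / real n} = measure M {..1 / real n}" for n
      by (rule eq) auto
    thus ?thesis using kernel_limit_imp_cdf_limit_seq_pos[OF lim \<open>0 < c\<close>] by simp
  qed
  thus "((\<lambda>x. measure M {..x} / x) \<longlongrightarrow> c) (at_right 0)"
    by (subst (asm) mono_ratio_limit_iff) (auto intro!: finite_measure_mono)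
qed

theorem kernel_limit_iff_cdf_limit:
  assumes "finite_measure N" and sets: "sets N = sets borel"
    and supp: "measure N {..<0} = 0" and c: "0 \<le> c"
  shows "(\<lambda>n. real n * (LINT t|N. line_kernel (real n * t))) \<longlonglongrightarrow> pi * c
    \<longleftrightarrow> ((\<lambda>x. measure N {..x} / x) \<longlongrightarrow> c) (at_right 0)"
proof (cases "measure N (space N) = 0")
  case True
  interpret finite_measure N by fact
  have z: "measure N A = 0" for A
    using True bounded_measure[of A] measure_nonneg[of N A] by linarith
  have "emeasure N A = 0" for A
    by (simp add: emeasure_eq_measure z)
  hence "AE t in N. t \<in> {}" 
    by (intro AE_I[where N = "space N"]) auto
  hence "(LINT t|N. f t) = 0" for f :: "real \<Rightarrow> real"
    by (intro integral_eq_zero_AE) (auto elim!: eventually_mono)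
  hence "(\<lambda>n. real n * (LINT t|N. line_kernel (real n * t))) = (\<lambda>_. 0)" by simp
  moreover have "(\<lambda>x. measure N {..x} / x) = (\<lambda>_. 0)" by (simp add: z)
  ultimately show ?thesis
    using pi_gt_zero by (auto simp: tendsto_const_iff)
next
  case False
  interpret finite_measure N by fact
  define m where "m = measure N (space N)"
  have m: "m > 0" using False by (simp add: m_def zero_less_measure_iff)
  define P where "P = density N (\<lambda>_. ennreal (1 / m))"
  have mP: "measure P A = measure N A / m" if "A \<in> sets borel" for A
    unfolding P_def measure_def using that sets m
    by (subst emeasure_density) (auto simp: nn_integral_cmult_indicator enn2real_mult)
  have spP: "space P = UNIV" "space N = UNIV"
    using sets_eq_imp_space_eq[OF sets] by (simp_all add: P_def)
  have "emeasure P (space P) = 1"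
    unfolding P_def using m spP sets
    by (subst emeasure_density) (auto simp: nn_integral_cmult_indicator emeasure_eq_measure m_def
        simp flip: ennreal_mult)
  hence "prob_space P" by (rule prob_spaceI)
  hence P: "real_distribution P"
    by (simp add: real_distribution_def real_distribution_axioms_def P_def sets)
  have iP: "(LINT t|P. line_kernel (s * t)) = (LINT t|N. line_kernel (s * t)) / m" for s
  proof -
    have meas: "(\<lambda>t. line_kernel (s * t)) \<in> borel_measurable N"
      by (subst measurable_cong_sets[OF sets refl]) measurable
    have "(LINT t|P. line_kernel (s * t)) = (LINT t|N. (1 / m) *\<^sub>R line_kernel (s * t))"
      unfolding P_def using m meas by (intro integral_density) auto
    thus ?thesis by simp
  qed
  have "(\<lambda>n. real n * (LINT t|N. line_kernel (real n * t))) \<longlonglongrightarrow> pi * c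
    \<longleftrightarrow> (\<lambda>n. real n * (LINT t|P. line_kernel (real n * t))) \<longlonglongrightarrow> pi * (c / m)"
    unfolding iP using m tendsto_divide[of "\<lambda>n. real n * (LINT t|N. line_kernel (real n * t))" "pi * c" _ "\<lambda>_. m" m]
      tendsto_mult[of "\<lambda>n. real n * ((LINT t|N. line_kernel (real n * t)) / m)" "pi * (c / m)" _ "\<lambda>_. m" m]
    by auto
  also have "\<dots> \<longleftrightarrow> ((\<lambda>x. measure P {..x} / x) \<longlongrightarrow> c / m) (at_right 0)"
    by (rule real_distribution.kernel_limit_iff_cdf_limit_prob[OF P]) (use m c supp in \<open>auto simp: mP\<close>)
  also have "\<dots> \<longleftrightarrow> ((\<lambda>x. measure N {..x} / x) \<longlongrightarrow> c) (at_right 0)"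
    using m tendsto_divide[of "\<lambda>x. measure N {..x} / x" c "at_right 0" "\<lambda>_. m" m]
      tendsto_mult[of "\<lambda>x. measure N {..x} / m / x" "c / m" "at_right 0" "\<lambda>_. m" m]
    by (auto simp: mP mult.commute)
  finally show ?thesis .
qed

section \<open>Kernels on the unit disc\<close>

definition geom_sum :: "nat \<Rightarrow> complex \<Rightarrow> complex" where
  "geom_sum n z = (\<Sum>k<n. z ^ k)"

lemma geom_sum_mult: "geom_sum n z * (1 - z) = 1 - z ^ n"
  by (metis geom_sum_def one_diff_power_eq mult.commute)

lemma geom_sum_Suc: "geom_sum (Suc n) z = 1 + z * geom_sum n z"
  unfolding geom_sum_def sum.lessThan_Suc_shift by (simp add: sum_distrib_left)

lemma norm_geom_sum_mult: "norm (geom_sum n z) * norm (1 - z) = norm (1 - z ^ n)"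
  by (metis geom_sum_mult norm_mult)

lemma norm_one_minus_power_le: "norm z \<le> 1 \<Longrightarrow> norm (1 - z ^ n) \<le> (2::real)" for z :: complex
  using norm_triangle_ineq4[of 1 "z ^ n"] power_le_one[of "norm z" n] by (simp add: norm_power)

lemma norm_geom_sum_le: "norm z \<le> 1 \<Longrightarrow> norm (geom_sum n z) \<le> real n"
  unfolding geom_sum_def
  by (rule order.trans[OF sum_norm_bound[where K = 1]]) (auto simp: norm_power power_le_one)

lemma norm_geom_sum_sq_le:
  assumes "norm z \<le> 1" "z \<noteq> 1"
  shows "(norm (geom_sum n z))\<^sup>2 \<le> 4 / (norm (1 - z))\<^sup>2"
proof -
  have "(norm (geom_sum n z) * norm (1 - z))\<^sup>2 \<le> 2\<^sup>2"
    unfolding norm_geom_sum_mult using norm_one_minus_power_le[OF assms(1), of n]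
    by (intro power_mono) auto
  thus ?thesis using assms(2) by (simp add: power_mult_distrib field_simps)
qed

text \<open>
  The integrand whose integral is the variance of the \<open>n\<close>-th partial sum, in the form in which the
  contributions of the initial value and of the innovations are separated.
\<close>

definition corr_kernel :: "nat \<Rightarrow> complex \<Rightarrow> real" where
  "corr_kernel n z = (norm (geom_sum n z))\<^sup>2 + (1 - (norm z)\<^sup>2) * (\<Sum>m<n. (norm (geom_sum m z))\<^sup>2)"

text \<open>
  The sum of \<open>Re (z ^ |i - j|)\<close> over \<open>i, j < n\<close>, which is the kernel of the variance, has the same increment.
  With \<open>A = geom_sum (Suc n) z = 1 + z * geom_sum n z\<close> the increment of \<open>corr_kernel\<close> is
  \<open>|A|\<^sup>2 - |A - 1|\<^sup>2 = 2 Re A - 1\<close>.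
\<close>

lemma corr_kernel_Suc:
  "corr_kernel (Suc n) z = corr_kernel n z + 1 + 2 * (\<Sum>k=1..n. Re (z ^ k))"
proof -
  have "(norm (z * geom_sum n z))\<^sup>2 = (norm (geom_sum (Suc n) z - 1))\<^sup>2"
    by (simp add: geom_sum_Suc)
  also have "\<dots> = (norm (geom_sum (Suc n) z))\<^sup>2 + 1 - 2 * Re (geom_sum (Suc n) z)"
    unfolding cmod_power2 by (simp add: power2_eq_square algebra_simps)
  finally have "(norm (geom_sum (Suc n) z))\<^sup>2 - (norm z)\<^sup>2 * (norm (geom_sum n z))\<^sup>2 = 2 * Re (geom_sum (Suc n) z) - 1"
    by (simp add: norm_mult power_mult_distrib)
  moreover have "Re (geom_sum (Suc n) z) = 1 + (\<Sum>k=1..n. Re (z ^ k))"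
    unfolding geom_sum_def lessThan_Suc_atMost atMost_atLeast0 Re_sum
    by (subst sum.atLeast_Suc_atMost) auto
  ultimately show ?thesis
    by (simp add: corr_kernel_def algebra_simps)
qed

definition sigma_kernel :: "complex \<Rightarrow> real" where
  "sigma_kernel z = (1 - (norm z)\<^sup>2) / (norm (1 - z))\<^sup>2"

text \<open>
  The innovation part of \<open>corr_kernel n\<close> divided by \<open>n\<close>.
\<close>

definition interior_kernel :: "nat \<Rightarrow> complex \<Rightarrow> real" where
  "interior_kernel n z = (1 / real n) * ((1 - (norm z)\<^sup>2) * (\<Sum>m<n. (norm (geom_sum m z))\<^sup>2))"

lemma one_minus_norm_sq_nonneg: "norm z \<le> 1 \<Longrightarrow> 0 \<le> 1 - (norm (z::complex))\<^sup>2"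
  by (simp add: abs_square_le_1)

lemma sigma_kernel_nonneg: "norm z \<le> 1 \<Longrightarrow> 0 \<le> sigma_kernel z"
  unfolding sigma_kernel_def by (intro divide_nonneg_nonneg one_minus_norm_sq_nonneg) auto

lemma interior_kernel_nonneg: "norm z \<le> 1 \<Longrightarrow> 0 \<le> interior_kernel n z"
  unfolding interior_kernel_def
  by (intro mult_nonneg_nonneg sum_nonneg one_minus_norm_sq_nonneg) auto

lemma interior_kernel_le:
  assumes z: "norm z \<le> 1"
  shows "interior_kernel n z \<le> 4 * sigma_kernel z"
proof (cases "z = 1")
  case False
  have "(\<Sum>m<n. (norm (geom_sum m z))\<^sup>2) \<le> real n * (4 / (norm (1 - z))\<^sup>2)"
    using sum_bounded_above[of "{..<n}" "\<lambda>m. (norm (geom_sum m z))\<^sup>2" "4 / (norm (1 - z))\<^sup>2"]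
      norm_geom_sum_sq_le[OF z False] by simp
  hence "interior_kernel n z \<le> (1 / real n) * ((1 - (norm z)\<^sup>2) * (real n * (4 / (norm (1 - z))\<^sup>2)))"
    unfolding interior_kernel_def
    by (intro mult_left_mono one_minus_norm_sq_nonneg z) auto
  also have "\<dots> \<le> 4 * sigma_kernel z"
  proof (cases "n = 0")
    case True
    thus ?thesis using sigma_kernel_nonneg[OF z] by simp
  next
    case False
    hence "(1 / real n) * (a * (real n * (4 / b))) = 4 * (a / b)" for a b by simp
    thus ?thesis by (simp only: sigma_kernel_def order_refl)
  qed
  finally show ?thesis .
qed (simp add: interior_kernel_def sigma_kernel_def)

text \<open>
  On the unit circle both sides vanish. Inside, the average of \<open>|1 - z\<^sup>m|\<^sup>2\<close> over \<open>m < n\<close> tends to \<open>1\<close>,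
  since the powers of \<open>z\<close> and of \<open>|z|\<^sup>2\<close> have bounded sums.
\<close>

lemma interior_kernel_limit:
  assumes z: "norm z \<le> 1"
  shows "(\<lambda>n. interior_kernel n z) \<longlonglongrightarrow> sigma_kernel z"
proof (cases "norm z = 1")
  case True
  thus ?thesis by (simp add: interior_kernel_def sigma_kernel_def)
next
  case False
  with z have z1: "norm z < 1" by simp
  hence ne: "z \<noteq> 1" by auto
  define t where "t = norm (1 - z)"
  have t: "t > 0" using ne by (simp add: t_def)
  define r where "r = (norm z)\<^sup>2"
  have r: "0 \<le> r" "r < 1" using z1 by (auto simp: r_def abs_square_less_1)
  have sq: "(norm (1 - z ^ m))\<^sup>2 = 1 - 2 * Re (z ^ m) + r ^ m" for m
  proof -
    have "r ^ m = (norm (z ^ m))\<^sup>2"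
      by (simp add: r_def norm_power power_mult[symmetric] mult.commute)
    thus ?thesis unfolding cmod_power2 by (simp add: power2_eq_square algebra_simps)
  qed
  have sum: "(\<Sum>m<n. (norm (geom_sum m z))\<^sup>2) = (real n - 2 * Re (geom_sum n z) + (1 - r ^ n) / (1 - r)) / t\<^sup>2" for n
  proof -
    have "(norm (geom_sum m z))\<^sup>2 = (1 - 2 * Re (z ^ m) + r ^ m) / t\<^sup>2" for m
      using norm_geom_sum_mult[of m z] t unfolding sq[symmetric] t_def[symmetric]
      by (metis nonzero_mult_div_cancel_right less_numeral_extra(3) power_divide)
    hence "(\<Sum>m<n. (norm (geom_sum m z))\<^sup>2) = (\<Sum>m<n. 1 - 2 * Re (z ^ m) + r ^ m) / t\<^sup>2"
      by (simp add: sum_divide_distrib)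
    also have "(\<Sum>m<n. 1 - 2 * Re (z ^ m) + r ^ m)
        = real n - 2 * Re (geom_sum n z) + (1 - r ^ n) / (1 - r)"
      using r sum_gp_strict[of r n]
      by (simp add: sum.distrib sum_subtractf geom_sum_def sum_distrib_left)
    finally show ?thesis .
  qed
  have "(\<lambda>n. Re (geom_sum n z) / real n) \<longlonglongrightarrow> 0"
  proof (rule Lim_null_comparison)
    show "\<forall>\<^sub>F n in sequentially. norm (Re (geom_sum n z) / real n) \<le> (2 / t) / real n"
    proof (intro always_eventually allI)
      fix n
      have "norm (geom_sum n z) \<le> 2 / t"
        using norm_geom_sum_mult[of n z] norm_one_minus_power_le[OF z, of n] t
        by (simp add: t_def field_simps)
      hence "\<bar>Re (geom_sum n z)\<bar> \<le> 2 / t" using abs_Re_le_cmod[of "geom_sum n z"] by linarith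
      thus "norm (Re (geom_sum n z) / real n) \<le> (2 / t) / real n"
        by (simp add: divide_right_mono del: divide_divide_eq_left)
    qed
    show "(\<lambda>n. (2 / t) / real n) \<longlonglongrightarrow> 0" by real_asymp
  qed
  moreover have "(\<lambda>n. (1 - r ^ n) / (1 - r) / real n) \<longlonglongrightarrow> 0"
  proof (rule Lim_null_comparison)
    show "\<forall>\<^sub>F n in sequentially. norm ((1 - r ^ n) / (1 - r) / real n) \<le> (1 / (1 - r)) / real n"
      using r by (intro always_eventually allI)
        (auto simp: power_le_one intro!: divide_right_mono simp del: divide_divide_eq_left)
    show "(\<lambda>n. (1 / (1 - r)) / real n) \<longlonglongrightarrow> 0" by real_asymp
  qed
  ultimately have "(\<lambda>n. (1 - r) / t\<^sup>2 * (1 - 2 * (Re (geom_sum n z) / real n) + (1 - r ^ n) / (1 - r) / real n))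
      \<longlonglongrightarrow> (1 - r) / t\<^sup>2 * (1 - 2 * 0 + 0)"
    by (intro tendsto_intros)
  hence "(\<lambda>n. (1 - r) / t\<^sup>2 * (1 - 2 * (Re (geom_sum n z) / real n) + (1 - r ^ n) / (1 - r) / real n))
      \<longlonglongrightarrow> sigma_kernel z"
    by (simp add: sigma_kernel_def r_def t_def)
  moreover have "\<forall>\<^sub>F n in sequentially.
      (1 - r) / t\<^sup>2 * (1 - 2 * (Re (geom_sum n z) / real n) + (1 - r ^ n) / (1 - r) / real n) = interior_kernel n z"
    using eventually_gt_at_top[of 0]
  proof eventually_elim
    case (elim n)
    have "interior_kernel n z
        = (1 - r) / t\<^sup>2 * ((real n - 2 * Re (geom_sum n z) + (1 - r ^ n) / (1 - r)) / real n)"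
      unfolding interior_kernel_def sum r_def[symmetric] by simp
    also have "(real n - 2 * Re (geom_sum n z) + (1 - r ^ n) / (1 - r)) / real n
        = 1 - 2 * (Re (geom_sum n z) / real n) + (1 - r ^ n) / (1 - r) / real n"
      using elim by (simp add: add_divide_distrib diff_divide_distrib)
    finally show ?case by simp
  qed
  ultimately show ?thesis by (rule Lim_transform_eventually)
qed

text \<open>
  The point \<open>w\<close> on the circle has argument \<open>t\<close> or \<open>- t\<close>, on the same side of the real axis as \<open>z\<close>.
  Both \<open>1 - Re z = (1 - |z|\<^sup>2 + t\<^sup>2) / 2\<close> and the modulus of the imaginary part of \<open>z\<close> are then
  determined by \<open>t\<close> up to an error of the order \<open>(1 - |z|\<^sup>2) + t\<^sup>2\<close>. This order matters: after division by
  \<open>t\<^sup>2\<close> it is \<open>sigma_kernel\<close> plus a constant.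
\<close>

lemma dist_circle_point_le:
  fixes z :: complex
  assumes z: "norm z \<le> 1" and ne: "z \<noteq> 1"
  defines "t \<equiv> norm (1 - z)"
  shows "\<exists>w. norm w = 1 \<and> (\<forall>n. norm (1 - w ^ n) = 2 * \<bar>sin (real n * t / 2)\<bar>)
          \<and> norm (z - w) \<le> (1 - (norm z)\<^sup>2) + 2 * t\<^sup>2"
proof -
  have t: "t > 0" using ne by (simp add: t_def)
  define e :: real where "e = (if Im z \<ge> 0 then 1 else -1)"
  have e: "e = 1 \<or> e = -1" "e * \<bar>Im z\<bar> = Im z" by (auto simp: e_def)
  define w where "w = cis (e * t)"
  define a where "a = 1 - Re z"
  have t2: "t\<^sup>2 = a\<^sup>2 + (Im z)\<^sup>2" unfolding t_def a_def cmod_power2 by simp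
  have a_eq: "2 * a = (1 - (norm z)\<^sup>2) + t\<^sup>2"
    unfolding t2 a_def cmod_power2 by (simp add: power2_eq_square algebra_simps)
  have a0: "0 \<le> a" using a_eq one_minus_norm_sq_nonneg[OF z] zero_le_power2[of t] by linarith
  have cos: "\<bar>Re z - cos t\<bar> \<le> a"
  proof -
    have "1 - cos t \<le> t\<^sup>2 / 2"
      using cos_double_sin[of "t/2"] abs_sin_x_le_abs_x[of "t/2"] power_mono[of "\<bar>sin (t/2)\<bar>" "\<bar>t/2\<bar>" 2]
      by (simp add: power_divide)
    moreover have "t\<^sup>2 / 2 \<le> a" using a_eq one_minus_norm_sq_nonneg[OF z] by linarith
    moreover have "cos t \<le> 1" by simp
    ultimately show ?thesis unfolding a_def by linarith
  qed
  have sin: "\<bar>\<bar>Im z\<bar> - sin t\<bar> \<le> a + t\<^sup>2 / 2"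
  proof -
    have y: "\<bar>Im z\<bar> \<le> t" unfolding t_def using abs_Im_le_cmod[of "1 - z"] by simp
    have "a \<le> t" unfolding t_def a_def using complex_Re_le_cmod[of "1 - z"] by simp
    hence "a\<^sup>2 \<le> a * t" using a0 by (simp add: power2_eq_square mult_left_mono)
    moreover have "a\<^sup>2 = (t - \<bar>Im z\<bar>) * (t + \<bar>Im z\<bar>)"
      using t2 by (simp add: power2_eq_square algebra_simps)
    moreover have "(t - \<bar>Im z\<bar>) * t \<le> (t - \<bar>Im z\<bar>) * (t + \<bar>Im z\<bar>)"
      using y by (intro mult_left_mono) auto
    ultimately have "(t - \<bar>Im z\<bar>) * t \<le> a * t" by linarith
    hence "t - \<bar>Im z\<bar> \<le> a" using t by simp
    moreover have "\<bar>sin t - t\<bar> \<le> t\<^sup>2 / 2"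
      using Maclaurin_sin_bound[of t 2] by (simp add: sin_coeff_def lessThan_nat_numeral)
    ultimately show ?thesis using y by linarith
  qed
  have Re_w: "Re w = cos t" using e(1) by (auto simp: w_def)
  have Im_w: "Im w = e * sin t" using e(1) by (auto simp: w_def)
  have "norm (z - w) \<le> \<bar>Re (z - w)\<bar> + \<bar>Im (z - w)\<bar>" by (rule cmod_le)
  also have "\<bar>Re (z - w)\<bar> = \<bar>Re z - cos t\<bar>" by (simp add: Re_w)
  also have "Im (z - w) = e * (\<bar>Im z\<bar> - sin t)" using e(2) by (simp add: Im_w right_diff_distrib)
  also have "\<bar>e * (\<bar>Im z\<bar> - sin t)\<bar> = \<bar>\<bar>Im z\<bar> - sin t\<bar>" using e(1) by (auto simp: abs_mult)
  finally have "norm (z - w) \<le> 2 * a + t\<^sup>2 / 2" using cos sin by linarith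
  also have "\<dots> \<le> (1 - (norm z)\<^sup>2) + 2 * t\<^sup>2" unfolding a_eq by simp
  finally have close: "norm (z - w) \<le> (1 - (norm z)\<^sup>2) + 2 * t\<^sup>2" .
  have "norm (1 - w ^ n) = 2 * \<bar>sin (real n * t / 2)\<bar>" for n
  proof -
    have "w ^ n = cis (real n * (e * t))" unfolding w_def by (rule Complex.DeMoivre)
    also have "norm (1 - cis (real n * (e * t))) = 2 * \<bar>sin (real n * (e * t) / 2)\<bar>"
      using dist_exp_i_1[of "real n * (e * t)"] 
      by (simp add: cis_conv_exp norm_minus_commute)
    finally show ?thesis using e(1) by auto
  qed
  moreover have "norm w = 1" by (simp add: w_def)
  ultimately show ?thesis using close by blast
qed

text \<open>
  The difference of the squares of \<open>|1 - z\<^sup>n|\<close> and \<open>|1 - w\<^sup>n|\<close> is at most \<open>4 n |z - w|\<close>, for the point \<open>w\<close>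
  of the circle that corresponds to \<open>t\<close>. The factor \<open>n\<close> cancels, so the bound is uniform in \<open>n\<close>.
\<close>

lemma kernel_comparison:
  fixes z :: complex
  assumes z: "norm z \<le> 1"
  shows "\<bar>(1 / real n) * (norm (geom_sum n z))\<^sup>2 - real n * line_kernel (real n * norm (1 - z))\<bar>
    \<le> 4 * sigma_kernel z + 8"
proof (cases "z = 1 \<or> n = 0")
  case True
  moreover have "geom_sum n 1 = of_nat n" by (simp add: geom_sum_def)
  ultimately show ?thesis
    using sigma_kernel_nonneg[OF z] by (auto simp: power2_eq_square)
next
  case False
  define t where "t = norm (1 - z)"
  have t: "t > 0" using False by (simp add: t_def)
  obtain w where w: "norm w = 1" "\<And>n. norm (1 - w ^ n) = 2 * \<bar>sin (real n * t / 2)\<bar>"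
    and close: "norm (z - w) \<le> (1 - (norm z)\<^sup>2) + 2 * t\<^sup>2"
    using dist_circle_point_le[OF z] False unfolding t_def by blast
  have n: "real n > 0" using False by simp
  have 1: "(norm (geom_sum n z))\<^sup>2 = (norm (1 - z ^ n))\<^sup>2 / t\<^sup>2"
    using norm_geom_sum_mult[of n z] t unfolding t_def[symmetric]
    by (metis nonzero_mult_div_cancel_right less_numeral_extra(3) power_divide)
  have 2: "real n * line_kernel (real n * t) = (1 / real n) * ((norm (1 - w ^ n))\<^sup>2 / t\<^sup>2)"
    using n t by (simp add: w(2) line_kernel_eq_sin power_mult_distrib power2_eq_square)
  have "\<bar>(norm (1 - z ^ n))\<^sup>2 - (norm (1 - w ^ n))\<^sup>2\<bar>
      = \<bar>norm (1 - z ^ n) - norm (1 - w ^ n)\<bar> * (norm (1 - z ^ n) + norm (1 - w ^ n))"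
    by (simp add: power2_eq_square square_diff_square_factored abs_mult)
  also have "\<dots> \<le> (real n * norm (z - w)) * 4"
  proof (intro mult_mono)
    have "\<bar>norm (1 - z ^ n) - norm (1 - w ^ n)\<bar> \<le> norm ((1 - z ^ n) - (1 - w ^ n))"
      by (rule norm_triangle_ineq3)
    also have "\<dots> = norm (z ^ n - w ^ n)" by (simp add: norm_minus_commute)
    also have "\<dots> \<le> real n * norm (z - w)"
      using norm_power_diff[of z w n] z w(1) by simp
    finally show "\<bar>norm (1 - z ^ n) - norm (1 - w ^ n)\<bar> \<le> real n * norm (z - w)" .
    show "norm (1 - z ^ n) + norm (1 - w ^ n) \<le> 4"
      using norm_one_minus_power_le[OF z, of n] norm_one_minus_power_le[of w n] w(1) by simp
  qed auto
  also have "\<dots> \<le> (real n * ((1 - (norm z)\<^sup>2) + 2 * t\<^sup>2)) * 4"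
    using close by (intro mult_right_mono mult_left_mono) auto
  finally have key: "\<bar>(norm (1 - z ^ n))\<^sup>2 - (norm (1 - w ^ n))\<^sup>2\<bar>
      \<le> (real n * ((1 - (norm z)\<^sup>2) + 2 * t\<^sup>2)) * 4" .
  have "\<bar>(1 / real n) * (norm (geom_sum n z))\<^sup>2 - real n * line_kernel (real n * t)\<bar>
      = \<bar>(norm (1 - z ^ n))\<^sup>2 - (norm (1 - w ^ n))\<^sup>2\<bar> / (real n * t\<^sup>2)"
    unfolding 1 2 using n t
    by (simp add: diff_divide_distrib[symmetric] abs_divide abs_mult)
  also have "\<dots> \<le> (real n * ((1 - (norm z)\<^sup>2) + 2 * t\<^sup>2)) * 4 / (real n * t\<^sup>2)"
    using key n by (intro divide_right_mono) auto
  also have "\<dots> = 4 * sigma_kernel z + 8"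
    using n t unfolding sigma_kernel_def t_def[symmetric]
    by (simp add: add_divide_distrib distrib_left distrib_right diff_divide_distrib right_diff_distrib)
  finally show ?thesis unfolding t_def .
qed

text \<open>
  At \<open>z = 1\<close> the two terms coincide, and elsewhere each of them is \<open>O(1 / n)\<close>.
\<close>

lemma kernel_comparison_limit:
  fixes z :: complex
  assumes z: "norm z \<le> 1"
  shows "(\<lambda>n. (1 / real n) * (norm (geom_sum n z))\<^sup>2 - real n * line_kernel (real n * norm (1 - z))) \<longlonglongrightarrow> 0"
proof (cases "z = 1")
  case True
  have "geom_sum n 1 = of_nat n" for n by (simp add: geom_sum_def)
  hence "(1 / real n) * (norm (geom_sum n 1))\<^sup>2 - real n * line_kernel (real n * norm (1 - 1 :: complex)) = 0" for n
    by (simp add: power2_eq_square)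
  thus ?thesis by (simp only: True tendsto_const)
next
  case False
  define t where "t = norm (1 - z)"
  have t: "t > 0" using False by (simp add: t_def)
  show ?thesis
  proof (rule Lim_null_comparison)
    show "\<forall>\<^sub>F n in sequentially. norm ((1 / real n) * (norm (geom_sum n z))\<^sup>2 - real n * line_kernel (real n * norm (1 - z)))
        \<le> (8 / t\<^sup>2) / real n"
      using eventually_gt_at_top[of 0]
    proof eventually_elim
      case (elim n)
      have 1: "(1 / real n) * (norm (geom_sum n z))\<^sup>2 \<le> (1 / real n) * (4 / t\<^sup>2)"
        using norm_geom_sum_sq_le[OF z False, of n] unfolding t_def by (intro mult_left_mono) auto
      have "real n * line_kernel (real n * t) \<le> real n * (4 / (real n * t)\<^sup>2)"
        using elim t by (intro mult_left_mono line_kernel_le) auto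
      also have "\<dots> = (1 / real n) * (4 / t\<^sup>2)"
        using elim by (simp add: power_mult_distrib power2_eq_square)
      finally have 2: "real n * line_kernel (real n * t) \<le> (1 / real n) * (4 / t\<^sup>2)" .
      have "0 \<le> real n * line_kernel (real n * t)" "0 \<le> (1 / real n) * (norm (geom_sum n z))\<^sup>2" by auto
      with 1 2 have "norm ((1 / real n) * (norm (geom_sum n z))\<^sup>2 - real n * line_kernel (real n * t))
          \<le> (1 / real n) * (4 / t\<^sup>2) + (1 / real n) * (4 / t\<^sup>2)"
        unfolding real_norm_def by linarith
      also have "\<dots> = (8 / t\<^sup>2) / real n" by simp
      finally show ?case by (simp add: t_def)
    qed
    show "(\<lambda>n. (8 / t\<^sup>2) / real n) \<longlonglongrightarrow> 0" by real_asymp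
  qed
qed

lemma measurable_geom_sum [measurable]: "geom_sum n \<in> borel_measurable borel"
  unfolding geom_sum_def[abs_def] by measurable

lemma measurable_sigma_kernel [measurable]: "sigma_kernel \<in> borel_measurable borel"
  unfolding sigma_kernel_def[abs_def] by measurable

lemma measurable_interior_kernel [measurable]: "interior_kernel n \<in> borel_measurable borel"
  unfolding interior_kernel_def[abs_def] by measurable

lemma measurable_corr_kernel [measurable]: "corr_kernel n \<in> borel_measurable borel"
  unfolding corr_kernel_def[abs_def] by measurable

locale disc_measure = finite_measure \<nu> for \<nu> :: "complex measure" +
  assumes sets_disc: "sets \<nu> = sets borel_disc"
begin

lemma space_disc: "space \<nu> = unit_disc"
  using sets_eq_imp_space_eq[OF sets_disc] by (simp add: space_restrict_space)

lemma norm_le_1: "z \<in> space \<nu> \<Longrightarrow> norm z \<le> 1"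
  by (simp add: space_disc)

lemma measurable_disc: "f \<in> measurable borel N \<Longrightarrow> f \<in> measurable \<nu> N"
  using measurable_cong_sets[OF sets_disc refl, of N] by (simp add: measurable_restrict_space1)

lemma sets_discI: "A \<in> sets borel \<Longrightarrow> A \<subseteq> unit_disc \<Longrightarrow> A \<in> sets \<nu>"
  unfolding sets_disc by (subst sets_restrict_space_iff) auto

lemma integrable_disc:
  fixes f :: "complex \<Rightarrow> 'b::{banach, second_countable_topology}"
  assumes "f \<in> borel_measurable borel" "\<And>z. norm z \<le> 1 \<Longrightarrow> norm (f z) \<le> B"
  shows "integrable \<nu> f"
  by (rule integrable_const_bound[of _ B])
    (auto intro!: AE_I2 assms(2) norm_le_1 measurable_disc[OF assms(1)])

lemma integrable_geom_sum_sq: "integrable \<nu> (\<lambda>z. (norm (geom_sum n z))\<^sup>2)"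
  by (rule integrable_disc[where B = "(real n)\<^sup>2"]) (auto intro!: power_mono norm_geom_sum_le)

lemma integrable_interior_kernel: "integrable \<nu> (interior_kernel n)"
proof (rule integrable_disc)
  fix z :: complex assume z: "norm z \<le> 1"
  have "(\<Sum>m<n. (norm (geom_sum m z))\<^sup>2) \<le> (\<Sum>m<n. (real m)\<^sup>2)"
    by (intro sum_mono power_mono norm_geom_sum_le z) auto
  moreover have "1 - (norm z)\<^sup>2 \<le> 1" by simp
  ultimately have "(1 - (norm z)\<^sup>2) * (\<Sum>m<n. (norm (geom_sum m z))\<^sup>2) \<le> 1 * (\<Sum>m<n. (real m)\<^sup>2)"
    by (intro mult_mono) (auto intro: sum_nonneg)
  hence "interior_kernel n z \<le> (1 / real n) * (1 * (\<Sum>m<n. (real m)\<^sup>2))"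
    unfolding interior_kernel_def by (intro mult_left_mono) auto
  thus "norm (interior_kernel n z) \<le> (1 / real n) * (1 * (\<Sum>m<n. (real m)\<^sup>2))"
    using interior_kernel_nonneg[OF z, of n] by simp
qed simp

lemma fejer_integral_eq: "fejer_integral \<nu> n = (LINT z|\<nu>. (1 / real n) * (norm (geom_sum n z))\<^sup>2)"
  unfolding fejer_integral_def geom_sum_def by simp

lemma fejer_integral_nonneg: "0 \<le> fejer_integral \<nu> n"
  unfolding fejer_integral_def by simp

lemma corr_integral_eq:
  "(LINT z|\<nu>. corr_kernel n z) / real n = fejer_integral \<nu> n + (LINT z|\<nu>. interior_kernel n z)"
proof -
  have "(LINT z|\<nu>. corr_kernel n z) / real n = (LINT z|\<nu>. corr_kernel n z / real n)" by simp
  also have "(\<lambda>z. corr_kernel n z / real n)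
      = (\<lambda>z. (1 / real n) * (norm (geom_sum n z))\<^sup>2 + interior_kernel n z)"
    by (simp add: corr_kernel_def interior_kernel_def add_divide_distrib)
  also have "(LINT z|\<nu>. (1 / real n) * (norm (geom_sum n z))\<^sup>2 + interior_kernel n z)
      = fejer_integral \<nu> n + (LINT z|\<nu>. interior_kernel n z)"
    unfolding fejer_integral_eq
    by (intro Bochner_Integration.integral_add integrable_mult_right integrable_geom_sum_sq
        integrable_interior_kernel)
  finally show ?thesis .
qed

lemma spectral_sigma2_eq: "spectral_sigma2 \<nu> = (\<integral>\<^sup>+z. ennreal (sigma_kernel z) \<partial>\<nu>)"
  by (simp add: spectral_sigma2_def sigma_kernel_def)

lemma integrable_sigma_kernel:
  assumes "spectral_sigma2 \<nu> < \<infinity>"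
  shows "integrable \<nu> sigma_kernel"
proof (rule integrableI_nonneg)
  show "AE z in \<nu>. 0 \<le> sigma_kernel z" by (intro AE_I2 sigma_kernel_nonneg norm_le_1)
qed (use assms in \<open>auto simp: spectral_sigma2_eq intro: measurable_disc\<close>)

lemma enn2real_spectral_sigma2: "enn2real (spectral_sigma2 \<nu>) = (LINT z|\<nu>. sigma_kernel z)"
  unfolding spectral_sigma2_eq
  by (rule integral_eq_nn_integral[symmetric])
    (auto intro!: measurable_disc AE_I2 sigma_kernel_nonneg norm_le_1)

lemma interior_integral_limit:
  assumes "spectral_sigma2 \<nu> < \<infinity>"
  shows "(\<lambda>n. LINT z|\<nu>. interior_kernel n z) \<longlonglongrightarrow> enn2real (spectral_sigma2 \<nu>)"
  unfolding enn2real_spectral_sigma2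
proof (rule integral_dominated_convergence[where w = "\<lambda>z. 4 * sigma_kernel z"])
  show "integrable \<nu> (\<lambda>z. 4 * sigma_kernel z)"
    by (intro integrable_mult_right integrable_sigma_kernel assms)
  show "AE z in \<nu>. (\<lambda>n. interior_kernel n z) \<longlonglongrightarrow> sigma_kernel z"
    by (intro AE_I2 interior_kernel_limit norm_le_1)
  show "AE z in \<nu>. norm (interior_kernel n z) \<le> 4 * sigma_kernel z" for n
    by (intro AE_I2) (simp add: interior_kernel_nonneg interior_kernel_le norm_le_1)
qed (auto intro: measurable_disc)

text \<open>
  Fatou's lemma for the innovation part.
\<close>

lemma spectral_sigma2_finite:
  assumes "\<forall>\<^sub>F n in sequentially. (LINT z|\<nu>. interior_kernel n z) \<le> B"
  shows "spectral_sigma2 \<nu> < \<infinity>"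
proof -
  have "spectral_sigma2 \<nu> = (\<integral>\<^sup>+z. liminf (\<lambda>n. ennreal (interior_kernel n z)) \<partial>\<nu>)"
    unfolding spectral_sigma2_eq
  proof (intro nn_integral_cong)
    fix z assume "z \<in> space \<nu>"
    hence "(\<lambda>n. ennreal (interior_kernel n z)) \<longlonglongrightarrow> ennreal (sigma_kernel z)"
      by (intro tendsto_ennrealI interior_kernel_limit norm_le_1)
    from lim_imp_Liminf[OF _ this]
    show "ennreal (sigma_kernel z) = liminf (\<lambda>n. ennreal (interior_kernel n z))" by simp
  qed
  also have "\<dots> \<le> liminf (\<lambda>n. \<integral>\<^sup>+z. ennreal (interior_kernel n z) \<partial>\<nu>)"
    by (intro nn_integral_liminf) (auto intro: measurable_disc)
  also have "\<dots> \<le> liminf (\<lambda>_. ennreal B)"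
  proof (rule Liminf_mono)
    show "\<forall>\<^sub>F n in sequentially. (\<integral>\<^sup>+z. ennreal (interior_kernel n z) \<partial>\<nu>) \<le> ennreal B"
      using assms
    proof eventually_elim
      case (elim n)
      have "(\<integral>\<^sup>+z. ennreal (interior_kernel n z) \<partial>\<nu>) = ennreal (LINT z|\<nu>. interior_kernel n z)"
        by (intro nn_integral_eq_integral integrable_interior_kernel AE_I2 interior_kernel_nonneg norm_le_1)
      thus ?case using elim by (simp add: ennreal_leI)
    qed
  qed
  also have "\<dots> = ennreal B" by (simp add: Liminf_const)
  finally show ?thesis by (simp add: le_less_trans)
qed

text \<open>
  Since the Fejer integrals are nonnegative, a convergent variance ratio bounds the innovation part. This makes
  \<open>\<sigma>\<^sup>2\<close> finite, and then the innovation part converges on its own.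
\<close>

theorem variance_limit_iff:
  fixes V :: "nat \<Rightarrow> real"
  assumes V: "\<And>n. V n = (LINT z|\<nu>. corr_kernel n z)"
  shows "(\<exists>K. (\<lambda>n. V n / real n) \<longlonglongrightarrow> K)
      \<longleftrightarrow> spectral_sigma2 \<nu> < \<infinity> \<and> (\<exists>L. fejer_integral \<nu> \<longlonglongrightarrow> L)"
    and "(\<lambda>n. V n / real n) \<longlonglongrightarrow> K \<Longrightarrow> fejer_integral \<nu> \<longlonglongrightarrow> L
      \<Longrightarrow> K = enn2real (spectral_sigma2 \<nu>) + L"
proof -
  have eq: "(\<lambda>n. V n / real n) = (\<lambda>n. fejer_integral \<nu> n + (LINT z|\<nu>. interior_kernel n z))"
    unfolding V corr_integral_eq ..
  have fin: "spectral_sigma2 \<nu> < \<infinity>" if lim: "(\<lambda>n. V n / real n) \<longlonglongrightarrow> K" for K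
  proof (rule spectral_sigma2_finite)
    have "\<forall>\<^sub>F n in sequentially. V n / real n < K + 1"
      using lim by (rule order_tendstoD) simp
    thus "\<forall>\<^sub>F n in sequentially. (LINT z|\<nu>. interior_kernel n z) \<le> K + 1"
    proof eventually_elim
      case (elim n)
      thus ?case using fun_cong[OF eq, of n] fejer_integral_nonneg[of n] by linarith
    qed
  qed
  have fejer: "fejer_integral \<nu> \<longlonglongrightarrow> K - enn2real (spectral_sigma2 \<nu>)"
    if lim: "(\<lambda>n. V n / real n) \<longlonglongrightarrow> K" for K
    using tendsto_diff[OF lim interior_integral_limit[OF fin[OF lim]]]
    by (simp add: fun_cong[OF eq, simplified])
  show "(\<exists>K. (\<lambda>n. V n / real n) \<longlonglongrightarrow> K)
      \<longleftrightarrow> spectral_sigma2 \<nu> < \<infinity> \<and> (\<exists>L. fejer_integral \<nu> \<longlonglongrightarrow> L)"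
    using fin fejer tendsto_add[OF _ interior_integral_limit] unfolding eq by blast
  show "K = enn2real (spectral_sigma2 \<nu>) + L"
    if "(\<lambda>n. V n / real n) \<longlonglongrightarrow> K" "fejer_integral \<nu> \<longlonglongrightarrow> L"
    using LIMSEQ_unique[OF fejer[OF that(1)] that(2)] by simp
qed

text \<open>
  Under the map \<open>z \<mapsto> |1 - z|\<close> the comparison of kernels reduces the claim to the half-line.
\<close>

theorem fejer_limit_iff_distance_limit:
  assumes fin: "spectral_sigma2 \<nu> < \<infinity>" and c: "0 \<le> c"
  shows "fejer_integral \<nu> \<longlonglongrightarrow> pi * c
    \<longleftrightarrow> ((\<lambda>x. measure \<nu> {z \<in> unit_disc. norm (1 - z) \<le> x} / x) \<longlongrightarrow> c) (at_right 0)"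
proof -
  define R where "R = distr \<nu> borel (\<lambda>z. norm (1 - z))"
  have m: "(\<lambda>z. norm (1 - z)) \<in> borel_measurable \<nu>" by (rule measurable_disc) simp
  have R: "finite_measure R" unfolding R_def by (rule finite_measure_distr[OF m])
  have R_measure: "measure R {..x} = measure \<nu> {z \<in> unit_disc. norm (1 - z) \<le> x}" for x
    unfolding R_def using m
    by (subst measure_distr) (auto simp: space_disc intro!: arg_cong[where f = "measure \<nu>"])
  have R_neg: "measure R {..<0} = 0"
    unfolding R_def using m by (subst measure_distr) (auto simp: vimage_def)
  have R_int: "(LINT t|R. line_kernel (s * t)) = (LINT z|\<nu>. line_kernel (s * norm (1 - z)))" for s
    unfolding R_def by (rule integral_distr[OF m]) simp
  have "(\<lambda>n. LINT z|\<nu>. (1 / real n) * (norm (geom_sum n z))\<^sup>2 - real n * line_kernel (real n * norm (1 - z)))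
      \<longlonglongrightarrow> (LINT z|\<nu>. 0)"
  proof (rule integral_dominated_convergence[where w = "\<lambda>z. 4 * sigma_kernel z + 8"])
    show "integrable \<nu> (\<lambda>z. 4 * sigma_kernel z + 8)"
      by (intro Bochner_Integration.integrable_add integrable_mult_right integrable_sigma_kernel fin) simp
    show "AE z in \<nu>. (\<lambda>n. (1 / real n) * (norm (geom_sum n z))\<^sup>2 - real n * line_kernel (real n * norm (1 - z))) \<longlonglongrightarrow> 0"
      by (intro AE_I2 kernel_comparison_limit norm_le_1)
    show "AE z in \<nu>. norm ((1 / real n) * (norm (geom_sum n z))\<^sup>2 - real n * line_kernel (real n * norm (1 - z)))
        \<le> 4 * sigma_kernel z + 8" for n
      unfolding real_norm_def by (intro AE_I2 kernel_comparison norm_le_1)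
  qed (auto intro: measurable_disc)
  moreover have "(LINT z|\<nu>. (1 / real n) * (norm (geom_sum n z))\<^sup>2 - real n * line_kernel (real n * norm (1 - z)))
      = fejer_integral \<nu> n - real n * (LINT t|R. line_kernel (real n * t))" for n
  proof -
    have "integrable \<nu> (\<lambda>z. line_kernel (real n * norm (1 - z)))"
      by (rule integrable_disc[where B = 1]) (auto simp: line_kernel_le_1)
    thus ?thesis
      unfolding R_int fejer_integral_eq
      by (subst Bochner_Integration.integral_diff) (auto intro: integrable_geom_sum_sq)
  qed
  ultimately have diff: "(\<lambda>n. fejer_integral \<nu> n - real n * (LINT t|R. line_kernel (real n * t))) \<longlonglongrightarrow> 0"
    by simp
  have "fejer_integral \<nu> \<longlonglongrightarrow> pi * c
      \<longleftrightarrow> (\<lambda>n. real n * (LINT t|R. line_kernel (real n * t))) \<longlonglongrightarrow> pi * c"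
    using tendsto_diff[OF _ diff, of "fejer_integral \<nu>" "pi * c"]
      tendsto_add[OF _ diff, of "\<lambda>n. real n * (LINT t|R. line_kernel (real n * t))" "pi * c"]
    by auto
  also have "\<dots> \<longleftrightarrow> ((\<lambda>x. measure R {..x} / x) \<longlongrightarrow> c) (at_right 0)"
    by (rule kernel_limit_iff_cdf_limit[OF R _ R_neg c]) (simp add: R_def)
  finally show ?thesis unfolding R_measure .
qed

end

section \<open>Neighbourhoods of one in the disc\<close>

text \<open>
  If each of two functions is bounded by the other at a slightly larger argument, up to \<open>o(x)\<close>,
  then the limit of one of the ratios at \<open>0\<close> carries over to the other.
\<close>

lemma ratio_limit_transfer:
  fixes f g :: "real \<Rightarrow> real"
  assumes fg: "\<And>a. 1 < a \<Longrightarrow> \<exists>e. ((\<lambda>x. e x / x) \<longlongrightarrow> 0) (at_right 0)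
      \<and> (\<forall>\<^sub>F x in at_right 0. f x \<le> g (a * x) + e x)"
    and gf: "\<And>a. 1 < a \<Longrightarrow> \<exists>e. ((\<lambda>x. e x / x) \<longlongrightarrow> 0) (at_right 0)
      \<and> (\<forall>\<^sub>F x in at_right 0. g x \<le> f (a * x) + e x)"
    and lim: "((\<lambda>x. g x / x) \<longlongrightarrow> c) (at_right 0)"
  shows "((\<lambda>x. f x / x) \<longlongrightarrow> c) (at_right 0)"
proof (rule order_tendstoI)
  have scale: "filterlim (\<lambda>x. a * x) (at_right 0) (at_right 0)" if "a > 0" for a :: real
    using that by real_asymp
  {
    fix b assume b: "c < b"
    have "((\<lambda>a. a * c) \<longlongrightarrow> 1 * c) (at_right 1)" by (intro tendsto_intros)
    with b have "\<forall>\<^sub>F a in at_right 1. a * c < b" by (intro order_tendstoD) auto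
    from eventually_conj[OF this eventually_at_right_less[of 1]]
    obtain a where a: "a * c < b" "1 < a"
      by (auto dest!: eventually_happens'[rotated])
    obtain e where e: "((\<lambda>x. e x / x) \<longlongrightarrow> 0) (at_right 0)"
      "\<forall>\<^sub>F x in at_right 0. f x \<le> g (a * x) + e x" using fg[OF a(2)] by blast
    have "((\<lambda>x. a * (g (a * x) / (a * x)) + e x / x) \<longlongrightarrow> a * c + 0) (at_right 0)"
      using a(2) by (intro tendsto_intros e filterlim_compose[OF lim scale]) simp
    with a(1) have "\<forall>\<^sub>F x in at_right 0. a * (g (a * x) / (a * x)) + e x / x < b"
      by (intro order_tendstoD) auto
    from this e(2) eventually_at_right_less[of 0]
    show "\<forall>\<^sub>F x in at_right 0. f x / x < b"
    proof eventually_elim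
      case (elim x)
      have "f x / x \<le> (g (a * x) + e x) / x" using elim by (intro divide_right_mono) auto
      also have "\<dots> = a * (g (a * x) / (a * x)) + e x / x" using a(2) by (simp add: add_divide_distrib)
      finally show ?case using elim by simp
    qed
  next
    fix b assume b: "b < c"
    have "((\<lambda>a. c / a) \<longlongrightarrow> c / 1) (at_right 1)" by (intro tendsto_intros) auto
    with b have "\<forall>\<^sub>F a in at_right 1. b < c / a" by (intro order_tendstoD) auto
    from eventually_conj[OF this eventually_at_right_less[of 1]]
    obtain a where a: "b < c / a" "1 < a"
      by (auto dest!: eventually_happens'[rotated])
    obtain e where e: "((\<lambda>x. e x / x) \<longlongrightarrow> 0) (at_right 0)"
      "\<forall>\<^sub>F x in at_right 0. g x \<le> f (a * x) + e x" using gf[OF a(2)] by blast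
    have scale': "filterlim (\<lambda>x. (1 / a) * x) (at_right 0) (at_right 0)"
      using a(2) by (intro scale) simp
    have "((\<lambda>x. (1 / a) * (g ((1 / a) * x) / ((1 / a) * x)) - (1 / a) * (e ((1 / a) * x) / ((1 / a) * x)))
        \<longlongrightarrow> (1 / a) * c - (1 / a) * 0) (at_right 0)"
      by (intro tendsto_intros filterlim_compose[OF lim scale'] filterlim_compose[OF e(1) scale'])
    with a(1) have "\<forall>\<^sub>F x in at_right 0. b < (1 / a) * (g ((1 / a) * x) / ((1 / a) * x))
        - (1 / a) * (e ((1 / a) * x) / ((1 / a) * x))"
      by (intro order_tendstoD) auto
    from this eventually_compose_filterlim[OF e(2) scale'] eventually_at_right_less[of 0]
    show "\<forall>\<^sub>F x in at_right 0. b < f x / x"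
    proof eventually_elim
      case (elim x)
      have "(1 / a) * (g ((1 / a) * x) / ((1 / a) * x)) - (1 / a) * (e ((1 / a) * x) / ((1 / a) * x))
          = (g ((1 / a) * x) - e ((1 / a) * x)) / x"
        using a(2) elim by (simp add: diff_divide_distrib)
      also have "\<dots> \<le> f x / x"
        using elim a(2) by (intro divide_right_mono) auto
      finally show ?case using elim by simp
    qed
  }
qed

text \<open>
  The box of the statement with a real parameter in place of \<open>1 / n\<close>, which makes it comparable with the cusps.
\<close>

definition polar_box :: "real \<Rightarrow> complex set" where
  "polar_box x = {z \<in> unit_disc. \<exists>r u. z = complex_of_real (1 - r) * cis u \<and> 0 \<le> r \<and> r \<le> x \<and> \<bar>u\<bar> \<le> x}"

lemma box_region_eq: "0 < n \<Longrightarrow> box_region n = polar_box (1 / real n)"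
proof (intro equalityI subsetI)
  fix z assume n: "0 < n" and "z \<in> box_region n"
  then obtain r \<theta> where z: "z = complex_of_real r * cis \<theta>" "1 - 1 / real n \<le> r" "r \<le> 1"
      "- (1 / real n) \<le> \<theta>" "\<theta> \<le> 1 / real n"
    by (auto simp: box_region_def)
  have "1 / real n \<le> 1" using n by simp
  hence "0 \<le> r" using z(2) by linarith
  hence "norm z \<le> 1" using z(1,3) by (simp add: norm_mult)
  moreover have "\<exists>r u. z = complex_of_real (1 - r) * cis u \<and> 0 \<le> r \<and> r \<le> 1 / real n \<and> \<bar>u\<bar> \<le> 1 / real n"
    by (rule exI[of _ "1 - r"], rule exI[of _ \<theta>]) (use z in \<open>auto simp: abs_le_iff\<close>)
  ultimately show "z \<in> polar_box (1 / real n)" by (simp add: polar_box_def)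
next
  fix z assume "z \<in> polar_box (1 / real n)"
  then obtain r u where "z = complex_of_real (1 - r) * cis u" "0 \<le> r" "r \<le> 1 / real n" "\<bar>u\<bar> \<le> 1 / real n"
    by (auto simp: polar_box_def)
  thus "z \<in> box_region n"
    unfolding box_region_def by (intro CollectI exI[of _ "1 - r"] exI[of _ u]) (auto simp: abs_le_iff)
qed

lemma polar_box_closed: "closed (polar_box x)"
proof -
  have "polar_box x = unit_disc \<inter> (\<lambda>p. complex_of_real (1 - fst p) * cis (snd p)) ` ({0..x} \<times> {-x..x})"
    by (force simp: polar_box_def abs_le_iff)
  moreover have "compact ((\<lambda>p. complex_of_real (1 - fst p) * cis (snd p)) ` ({0..x} \<times> {-x..x}))"
    by (intro compact_continuous_image continuous_intros compact_Times) auto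
  ultimately show ?thesis
    by (simp add: closed_Int compact_imp_closed)
qed

lemma cusp_region_closed: "closed (cusp_region x)"
proof -
  let ?K = "({0..x} \<times> {-x..x}) \<inter> {p. fst p \<le> \<bar>snd p\<bar>}"
  have "cusp_region x = unit_disc \<inter> (\<lambda>p. complex_of_real (1 - fst p) * cis (snd p)) ` ?K"
  proof (intro equalityI subsetI)
    fix z assume "z \<in> cusp_region x"
    then obtain r u where *: "z \<in> unit_disc" "z = complex_of_real (1 - r) * cis u"
      "0 \<le> r" "r \<le> \<bar>u\<bar>" "\<bar>u\<bar> \<le> x" by (auto simp: cusp_region_def)
    hence "(r, u) \<in> ?K" by auto
    thus "z \<in> unit_disc \<inter> (\<lambda>p. complex_of_real (1 - fst p) * cis (snd p)) ` ?K"
      using * by force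
  next
    fix z assume "z \<in> unit_disc \<inter> (\<lambda>p. complex_of_real (1 - fst p) * cis (snd p)) ` ?K"
    then obtain r u where "z \<in> unit_disc" "z = complex_of_real (1 - r) * cis u"
      "0 \<le> r" "r \<le> \<bar>u\<bar>" "\<bar>u\<bar> \<le> x" by (auto simp: abs_le_iff)
    thus "z \<in> cusp_region x" unfolding cusp_region_def by blast
  qed
  moreover have "closed {p :: real \<times> real. fst p \<le> \<bar>snd p\<bar>}"
    by (intro closed_Collect_le continuous_intros)
  hence "compact ?K" by (intro compact_Int_closed compact_Times) auto
  hence "compact ((\<lambda>p. complex_of_real (1 - fst p) * cis (snd p)) ` ?K)"
    by (intro compact_continuous_image continuous_intros)
  ultimately show ?thesis
    by (simp add: closed_Int compact_imp_closed)
qed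

lemma cusp_region_subset_polar_box: "cusp_region x \<subseteq> polar_box x"
  unfolding cusp_region_def polar_box_def by (auto intro: order_trans)

lemma polar_box_mono: "x \<le> y \<Longrightarrow> polar_box x \<subseteq> polar_box y"
  unfolding polar_box_def by (auto intro: order_trans)

lemma norm_one_minus_cis: "norm (1 - cis u) = 2 * \<bar>sin (u / 2)\<bar>"
  using dist_exp_i_1[of u] by (simp add: cis_conv_exp norm_minus_commute)

lemma norm_one_minus_cis_le: "norm (1 - cis u) \<le> \<bar>u\<bar>"
  using abs_sin_x_le_abs_x[of "u / 2"] by (simp add: norm_one_minus_cis)

lemma norm_one_minus_polar:
  assumes "0 \<le> r"
  shows "norm (1 - complex_of_real (1 - r) * cis u) \<le> \<bar>u\<bar> + r"
    and "norm (1 - cis u) \<le> norm (1 - complex_of_real (1 - r) * cis u) + r"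
proof -
  have eq: "1 - complex_of_real (1 - r) * cis u = (1 - cis u) + complex_of_real r * cis u"
    by (simp add: algebra_simps)
  have n: "norm (complex_of_real r * cis u) = r" using assms by (simp add: norm_mult)
  show "norm (1 - complex_of_real (1 - r) * cis u) \<le> \<bar>u\<bar> + r"
    unfolding eq using norm_triangle_ineq[of "1 - cis u" "complex_of_real r * cis u"]
      norm_one_minus_cis_le[of u] n by linarith
  show "norm (1 - cis u) \<le> norm (1 - complex_of_real (1 - r) * cis u) + r"
    unfolding eq using norm_triangle_ineq4[of "(1 - cis u) + complex_of_real r * cis u" "complex_of_real r * cis u"] n
    by simp
qed

lemma sigma_kernel_ge:
  assumes z: "norm z \<le> 1" "z \<noteq> 1" and t: "norm (1 - z) \<le> b" and r: "a \<le> 1 - norm z" "0 \<le> a"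
  shows "a / b\<^sup>2 \<le> sigma_kernel z"
  unfolding sigma_kernel_def
proof (rule frac_le)
  show "a \<le> 1 - (norm z)\<^sup>2"
    using r z power_le_one[of "norm z" 1] mult_left_le[of "norm z" "norm z"] by (simp add: power2_eq_square)
  show "(norm (1 - z))\<^sup>2 \<le> b\<^sup>2" using t by (intro power_mono) auto
  show "0 < (norm (1 - z))\<^sup>2" using z by simp
qed (use one_minus_norm_sq_nonneg[OF z(1)] r in auto)

text \<open>
  The part of the disc near \<open>1\<close> in which the integrand of \<open>\<sigma>\<^sup>2\<close> is of the order \<open>1 / x\<close> or larger. For small
  \<open>x\<close> it contains all points in which cusps, boxes and balls around \<open>1\<close> differ, apart from a small dilation, and by
  \<open>measure_large_sigma_set\<close> its mass is \<open>o(x)\<close>.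
\<close>

definition large_sigma_set :: "real \<Rightarrow> real \<Rightarrow> complex set" where
  "large_sigma_set d x = {z \<in> unit_disc. z \<noteq> 1 \<and> norm (1 - z) \<le> 3 * x \<and> d / (9 * x) \<le> sigma_kernel z}"

text \<open>
  A point of the box with depth \<open>r < d x\<close> is close to the circle and has distance at most \<open>(1 + d) x\<close> from \<open>1\<close>.
  A deeper point has a large value of the integrand of \<open>\<sigma>\<^sup>2\<close>.
\<close>

lemma polar_box_subset:
  assumes x: "0 < x" "x < 1" and d: "0 < d" "d \<le> 1"
  shows "polar_box x \<subseteq> {z \<in> unit_disc. norm (1 - z) \<le> (1 + d) * x} \<union> large_sigma_set d x"
proof
  fix z assume "z \<in> polar_box x"
  then obtain r u where z1: "norm z \<le> 1" and z: "z = complex_of_real (1 - r) * cis u"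
    and r: "0 \<le> r" "r \<le> x" and u: "\<bar>u\<bar> \<le> x" by (auto simp: polar_box_def)
  have norm: "norm z = 1 - r"
    unfolding z norm_mult norm_of_real norm_cis using r x by simp
  have le: "norm (1 - z) \<le> \<bar>u\<bar> + r" unfolding z by (rule norm_one_minus_polar[OF r(1)])
  show "z \<in> {z \<in> unit_disc. norm (1 - z) \<le> (1 + d) * x} \<union> large_sigma_set d x"
  proof (cases "r < d * x")
    case True
    hence "norm (1 - z) \<le> (1 + d) * x" using le u by (simp add: distrib_right)
    thus ?thesis using z1 by simp
  next
    case False
    have "z \<noteq> 1" using norm False d x by auto
    moreover have "norm (1 - z) \<le> 3 * x" using le u r x by linarith
    moreover have "(d * x) / (3 * x)\<^sup>2 \<le> sigma_kernel z"
      by (rule sigma_kernel_ge) (use False norm d x z1 calculation in auto)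
    hence "d / (9 * x) \<le> sigma_kernel z" using x by (simp add: power2_eq_square)
    ultimately show ?thesis using z1 by (simp add: large_sigma_set_def)
  qed
qed

text \<open>
  A point close to \<open>1\<close> fails to lie in the cusp for one of two reasons: it is deep compared with \<open>x\<close>, or it is
  deep compared with its own argument. In both cases the integrand of \<open>\<sigma>\<^sup>2\<close> is large there.
\<close>

lemma subset_cusp_region:
  assumes x: "0 < x" "x < 1" and d: "0 < d" "d \<le> 1 / 2" and sin: "(1 - d) * x \<le> 2 * sin (x / 2)"
  shows "{z \<in> unit_disc. norm (1 - z) \<le> (1 - 2 * d) * x} \<subseteq> cusp_region x \<union> large_sigma_set d x"
proof
  fix z :: complex assume "z \<in> {z \<in> unit_disc. norm (1 - z) \<le> (1 - 2 * d) * x}"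
  hence z1: "norm z \<le> 1" and t: "norm (1 - z) \<le> (1 - 2 * d) * x" by auto
  define r where "r = 1 - norm z"
  define u where "u = Arg z"
  have z: "z = complex_of_real (1 - r) * cis u"
    using rcis_cmod_Arg[of z] by (simp add: r_def u_def rcis_def)
  have u: "\<bar>u\<bar> \<le> pi" using Arg_bounded[of z] by (auto simp: u_def)
  have r: "0 \<le> r" "r \<le> norm (1 - z)"
    using z1 norm_triangle_ineq2[of 1 z] by (auto simp: r_def)
  have "(1 - 2 * d) * x \<le> 1 * x" using x d by (intro mult_right_mono) auto
  hence tx: "norm (1 - z) \<le> x" using t by linarith
  have bad: "z \<in> large_sigma_set d x" if "d / (9 * x) \<le> a / b\<^sup>2" "a \<le> r" "0 < a" "norm (1 - z) \<le> b" for a b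
  proof -
    have "z \<noteq> 1" using that by (auto simp: r_def)
    moreover have "a / b\<^sup>2 \<le> sigma_kernel z"
      by (rule sigma_kernel_ge) (use that z1 calculation in \<open>auto simp: r_def\<close>)
    ultimately show ?thesis using z1 tx x that by (auto simp: large_sigma_set_def)
  qed
  show "z \<in> cusp_region x \<union> large_sigma_set d x"
  proof (cases "d * x \<le> r")
    case True
    have "z \<in> large_sigma_set d x"
      by (rule bad[of "d * x" "3 * x"]) (use True x d tx in \<open>auto simp: power2_eq_square\<close>)
    thus ?thesis ..
  next
    case False
    have "norm (1 - cis u) \<le> norm (1 - z) + r"
      unfolding z by (rule norm_one_minus_polar[OF r(1)])
    also have "\<dots> < (1 - 2 * d) * x + d * x" using t False by linarith
    also have "\<dots> = (1 - d) * x" by (simp add: algebra_simps)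
    also note sin
    finally have "\<bar>sin (u / 2)\<bar> < sin (x / 2)" by (simp add: norm_one_minus_cis)
    moreover have "\<bar>sin (u / 2)\<bar> = sin (\<bar>u\<bar> / 2)"
      using u sin_ge_zero[of "\<bar>u\<bar> / 2"] by (cases "u \<ge> 0") auto
    ultimately have less: "sin (\<bar>u\<bar> / 2) < sin (x / 2)" by simp
    have ux: "\<bar>u\<bar> \<le> x"
    proof (rule ccontr)
      assume "\<not> \<bar>u\<bar> \<le> x"
      hence "sin (x / 2) \<le> sin (\<bar>u\<bar> / 2)"
        using x u by (intro sin_monotone_2pi_le) auto
      thus False using less by simp
    qed
    show ?thesis
    proof (cases "r \<le> \<bar>u\<bar>")
      case True
      hence "z \<in> cusp_region x"
        unfolding cusp_region_def using z z1 r ux by auto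
      thus ?thesis ..
    next
      case False
      have le: "norm (1 - z) \<le> 2 * r"
        using norm_one_minus_polar(1)[OF r(1), of u] False unfolding z[symmetric] by linarith
      have "r \<le> x" using r tx by linarith
      have "r > 0" using False by linarith
      have "d / (9 * x) \<le> 1 / (4 * r)"
        by (rule frac_le) (use d x \<open>r \<le> x\<close> \<open>r > 0\<close> in auto)
      also have "1 / (4 * r) = r / (2 * r)\<^sup>2" using \<open>r > 0\<close> by (simp add: power2_eq_square)
      finally have "z \<in> large_sigma_set d x"
        by (rule bad) (use \<open>r > 0\<close> le in auto)
      thus ?thesis ..
    qed
  qed
qed

context disc_measure
begin

lemma large_sigma_set_sets: "large_sigma_set d x \<in> sets \<nu>"
proof (rule sets_discI)
  have "large_sigma_set d x = unit_disc \<inter> {z. z \<noteq> 1 \<and> norm (1 - z) \<le> 3 * x \<and> d / (9 * x) \<le> sigma_kernel z}"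
    by (auto simp: large_sigma_set_def)
  also have "\<dots> \<in> sets borel" by (intro sets.Int) measurable
  finally show "large_sigma_set d x \<in> sets borel" .
qed (auto simp: large_sigma_set_def)

text \<open>
  Markov's inequality bounds the mass by a constant times \<open>x\<close> times the integral of the integrand of \<open>\<sigma>\<^sup>2\<close> over the punctured
  ball of radius \<open>3 x\<close>, and these integrals tend to \<open>0\<close>.
\<close>

lemma measure_large_sigma_set:
  assumes fin: "spectral_sigma2 \<nu> < \<infinity>" and d: "0 < d"
  shows "((\<lambda>x. measure \<nu> (large_sigma_set d x) / x) \<longlongrightarrow> 0) (at_right 0)"
proof -
  define A :: "real \<Rightarrow> complex set" where "A = (\<lambda>x. {z. z \<noteq> 1 \<and> norm (1 - z) \<le> 3 * x})"
  have A [measurable]: "A x \<in> sets borel" for x unfolding A_def by measurable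
  define h where "h = (\<lambda>x. LINT z|\<nu>. indicator (A x) z * sigma_kernel z)"
  have int: "integrable \<nu> (\<lambda>z. indicator (A x) z * sigma_kernel z)" for x
    by (rule Bochner_Integration.integrable_bound[OF integrable_sigma_kernel[OF fin]])
      (auto intro!: measurable_disc AE_I2 simp: indicator_def)
  have h: "(h \<longlongrightarrow> 0) (at_right 0)"
  proof (rule tendsto_at_right_sequentially[of 0 1])
    fix S :: "nat \<Rightarrow> real" assume S: "\<And>n. 0 < S n" "S \<longlonglongrightarrow> 0"
    have "(\<lambda>n. h (S n)) \<longlonglongrightarrow> (LINT z|\<nu>. 0)"
      unfolding h_def
    proof (rule integral_dominated_convergence[where w = sigma_kernel])
      show "AE z in \<nu>. (\<lambda>n. indicator (A (S n)) z * sigma_kernel z) \<longlonglongrightarrow> 0"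
      proof (intro AE_I2)
        fix z :: complex
        show "(\<lambda>n. indicator (A (S n)) z * sigma_kernel z) \<longlonglongrightarrow> 0"
        proof (cases "z = 1")
          case False
          hence "0 < norm (1 - z) / 3" by simp
          from order_tendstoD(2)[OF S(2) this]
          have "\<forall>\<^sub>F n in sequentially. indicator (A (S n)) z * sigma_kernel z = 0"
            by eventually_elim (auto simp: A_def indicator_def)
          thus ?thesis by (rule tendsto_eventually)
        qed (simp add: A_def)
      qed
      show "AE z in \<nu>. norm (indicator (A (S n)) z * sigma_kernel z) \<le> sigma_kernel z" for n
        by (intro AE_I2) (auto simp: indicator_def sigma_kernel_nonneg norm_le_1)
    qed (auto intro: measurable_disc integrable_sigma_kernel fin)
    thus "(\<lambda>n. h (S n)) \<longlonglongrightarrow> 0" by simp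
  qed simp
  show ?thesis
  proof (rule tendsto_sandwich[of "\<lambda>_. 0"])
    show "\<forall>\<^sub>F x in at_right 0. measure \<nu> (large_sigma_set d x) / x \<le> (9 / d) * h x"
      using eventually_at_right_less[of 0]
    proof eventually_elim
      case (elim x)
      have "d / (9 * x) * measure \<nu> (large_sigma_set d x)
          = (LINT z|\<nu>. d / (9 * x) * indicator (large_sigma_set d x) z)"
        using large_sigma_set_sets sets.sets_into_space by (auto simp: Int_absorb2)
      also have "\<dots> \<le> h x"
        unfolding h_def
      proof (intro integral_mono int)
        show "integrable \<nu> (\<lambda>z. d / (9 * x) * indicator (large_sigma_set d x) z)"
          using large_sigma_set_sets
          by (intro integrable_mult_right integrable_real_indicator) (auto simp: emeasure_eq_measure)
        fix z assume "z \<in> space \<nu>"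
        thus "d / (9 * x) * indicator (large_sigma_set d x) z \<le> indicator (A x) z * sigma_kernel z"
          using sigma_kernel_nonneg[OF norm_le_1]
          by (auto simp: large_sigma_set_def A_def indicator_def)
      qed
      finally show ?case using elim d by (simp add: field_simps)
    qed
    show "((\<lambda>x. (9 / d) * h x) \<longlongrightarrow> 0) (at_right 0)"
      using tendsto_mult[OF tendsto_const[of "9 / d"] h] by simp
  qed (auto simp: eventually_at_filter)
qed

lemma distance_ball_sets: "{z \<in> unit_disc. norm (1 - z) \<le> x} \<in> sets \<nu>"
proof (rule sets_discI)
  have "{z \<in> unit_disc. norm (1 - z) \<le> x} = unit_disc \<inter> {z. norm (1 - z) \<le> x}" by auto
  also have "\<dots> \<in> sets borel" by (intro sets.Int) measurable
  finally show "{z \<in> unit_disc. norm (1 - z) \<le> x} \<in> sets borel" .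
qed auto

text \<open>
  A set between the cusp and the box differs from balls around \<open>1\<close> of slightly different radii by a mass \<open>o(x)\<close>.
\<close>

lemma region_limit_iff:
  assumes fin: "spectral_sigma2 \<nu> < \<infinity>"
    and W: "\<And>x. W x \<in> sets \<nu>" "\<And>x. cusp_region x \<subseteq> W x" "\<And>x. W x \<subseteq> polar_box x"
  shows "((\<lambda>x. measure \<nu> (W x) / x) \<longlongrightarrow> c) (at_right 0)
    \<longleftrightarrow> ((\<lambda>x. measure \<nu> {z \<in> unit_disc. norm (1 - z) \<le> x} / x) \<longlongrightarrow> c) (at_right 0)"
proof -
  let ?N = "\<lambda>x. {z \<in> unit_disc. norm (1 - z) \<le> (x::real)}"
  have small: "\<forall>\<^sub>F x in at_right 0. 0 < (x::real) \<and> x < 1"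
    by (intro eventually_conj eventually_at_right_less eventually_at_rightI[of 0 1]) auto
  have 1: "\<exists>e. ((\<lambda>x. e x / x) \<longlongrightarrow> 0) (at_right 0)
      \<and> (\<forall>\<^sub>F x in at_right 0. measure \<nu> (W x) \<le> measure \<nu> (?N (a * x)) + e x)" if a: "1 < a" for a
  proof (intro exI conjI)
    define d where "d = min (a - 1) 1"
    have d: "0 < d" "d \<le> 1" "1 + d \<le> a" using a by (auto simp: d_def)
    show "((\<lambda>x. measure \<nu> (large_sigma_set d x) / x) \<longlongrightarrow> 0) (at_right 0)"
      by (rule measure_large_sigma_set[OF fin d(1)])
    show "\<forall>\<^sub>F x in at_right 0. measure \<nu> (W x) \<le> measure \<nu> (?N (a * x)) + measure \<nu> (large_sigma_set d x)"
      using small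
    proof eventually_elim
      case (elim x)
      have "(1 + d) * x \<le> a * x" using d elim by (intro mult_right_mono) auto
      hence "?N ((1 + d) * x) \<subseteq> ?N (a * x)" by auto
      hence "W x \<subseteq> ?N (a * x) \<union> large_sigma_set d x"
        using polar_box_subset[of x d] W(3)[of x] elim d by blast
      hence "measure \<nu> (W x) \<le> measure \<nu> (?N (a * x) \<union> large_sigma_set d x)"
        by (intro finite_measure_mono sets.Un distance_ball_sets large_sigma_set_sets)
      also have "\<dots> \<le> measure \<nu> (?N (a * x)) + measure \<nu> (large_sigma_set d x)"
        by (intro measure_Un_le distance_ball_sets large_sigma_set_sets)
      finally show ?case .
    qed
  qed
  have 2: "\<exists>e. ((\<lambda>x. e x / x) \<longlongrightarrow> 0) (at_right 0)
      \<and> (\<forall>\<^sub>F x in at_right 0. measure \<nu> (?N x) \<le> measure \<nu> (W (a * x)) + e x)" if a: "1 < a" for a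
  proof (intro exI conjI)
    \<comment> \<open>chosen so that the radius \<open>(1 - 2 * d) * (a * x)\<close> is exactly \<open>x\<close>\<close>
    define d where "d = (1 - 1 / a) / 2"
    have d: "0 < d" "d \<le> 1 / 2" "(1 - 2 * d) * a = 1" using a by (auto simp: d_def field_simps)
    have scale: "filterlim (\<lambda>x. a * x) (at_right 0) (at_right 0)" using a by real_asymp
    from filterlim_compose[OF measure_large_sigma_set[OF fin d(1)] scale]
    have "((\<lambda>x. a * (measure \<nu> (large_sigma_set d (a * x)) / (a * x))) \<longlongrightarrow> a * 0) (at_right 0)"
      by (intro tendsto_mult tendsto_const)
    thus "((\<lambda>x. measure \<nu> (large_sigma_set d (a * x)) / x) \<longlongrightarrow> 0) (at_right 0)"
      using a by simp
    have "\<forall>\<^sub>F x in at_right 0. (1 - d) * x \<le> 2 * sin (x / 2)"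
      using d(1) by real_asymp
    from eventually_compose_filterlim[OF eventually_conj[OF this small] scale]
    show "\<forall>\<^sub>F x in at_right 0. measure \<nu> (?N x) \<le> measure \<nu> (W (a * x)) + measure \<nu> (large_sigma_set d (a * x))"
    proof eventually_elim
      case (elim x)
      have "(1 - 2 * d) * (a * x) = x" using d(3) by (simp flip: mult.assoc)
      with subset_cusp_region[of "a * x" d] elim d
      have "?N x \<subseteq> cusp_region (a * x) \<union> large_sigma_set d (a * x)" by simp
      hence "?N x \<subseteq> W (a * x) \<union> large_sigma_set d (a * x)"
        using W(2)[of "a * x"] by blast
      hence "measure \<nu> (?N x) \<le> measure \<nu> (W (a * x) \<union> large_sigma_set d (a * x))"
        by (intro finite_measure_mono sets.Un W large_sigma_set_sets)
      also have "\<dots> \<le> measure \<nu> (W (a * x)) + measure \<nu> (large_sigma_set d (a * x))"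
        by (intro measure_Un_le W large_sigma_set_sets)
      finally show ?case .
    qed
  qed
  show ?thesis
    using ratio_limit_transfer[where f = "\<lambda>x. measure \<nu> (W x)" and g = "\<lambda>x. measure \<nu> (?N x)"]
      ratio_limit_transfer[where g = "\<lambda>x. measure \<nu> (W x)" and f = "\<lambda>x. measure \<nu> (?N x)"] 1 2
    by blast
qed

lemma polar_box_sets: "polar_box x \<in> sets \<nu>"
  by (rule sets_discI) (auto simp: polar_box_closed borel_closed, auto simp: polar_box_def)

lemma cusp_region_sets: "cusp_region x \<in> sets \<nu>"
  by (rule sets_discI) (auto simp: cusp_region_closed borel_closed, auto simp: cusp_region_def)

theorem fejer_limit_iff_cusp:
  assumes "spectral_sigma2 \<nu> < \<infinity>" and "0 \<le> c"
  shows "fejer_integral \<nu> \<longlonglongrightarrow> pi * c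
    \<longleftrightarrow> ((\<lambda>x. measure \<nu> (cusp_region x) / x) \<longlongrightarrow> c) (at_right 0)"
  unfolding fejer_limit_iff_distance_limit[OF assms]
  by (rule region_limit_iff[symmetric, OF assms(1)])
    (auto intro: cusp_region_sets subsetD[OF cusp_region_subset_polar_box])

theorem fejer_limit_iff_box:
  assumes "spectral_sigma2 \<nu> < \<infinity>" and "0 \<le> c"
  shows "fejer_integral \<nu> \<longlonglongrightarrow> pi * c \<longleftrightarrow> (\<lambda>n. real n * measure \<nu> (box_region n)) \<longlonglongrightarrow> c"
proof -
  have "fejer_integral \<nu> \<longlonglongrightarrow> pi * c
      \<longleftrightarrow> ((\<lambda>x. measure \<nu> (polar_box x) / x) \<longlongrightarrow> c) (at_right 0)"
    unfolding fejer_limit_iff_distance_limit[OF assms]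
    by (rule region_limit_iff[symmetric, OF assms(1)])
      (auto intro: polar_box_sets subsetD[OF cusp_region_subset_polar_box])
  also have "\<dots> \<longleftrightarrow> (\<lambda>n. real n * measure \<nu> (polar_box (1 / real n))) \<longlonglongrightarrow> c"
    by (rule mono_ratio_limit_iff[symmetric])
      (auto intro!: finite_measure_mono polar_box_sets polar_box_mono)
  also have "(\<lambda>n. real n * measure \<nu> (polar_box (1 / real n))) = (\<lambda>n. real n * measure \<nu> (box_region n))"
  proof
    fix n :: nat
    show "real n * measure \<nu> (polar_box (1 / real n)) = real n * measure \<nu> (box_region n)"
      by (cases "n = 0") (simp_all add: box_region_eq)
  qed
  finally show ?thesis .
qed

end

section \<open>Square-integrable functions and spectral moments\<close>

lemma borel_measurable_cnj [measurable (raw)]: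
  "f \<in> borel_measurable M \<Longrightarrow> (\<lambda>x. cnj (f x)) \<in> borel_measurable M"
  by (rule measurable_compose[of f M borel cnj borel])
    (auto intro!: borel_measurable_continuous_onI continuous_intros)

text \<open>
  The vector \<open>f + c h\<close>. All linear operations needed below have this shape.
\<close>

definition L2_comb :: "('a \<Rightarrow> complex) \<Rightarrow> complex \<Rightarrow> ('a \<Rightarrow> complex) \<Rightarrow> 'a \<Rightarrow> complex" where
  "L2_comb f c h = (\<lambda>x. f x + c * h x)"

definition L2_norm_sq :: "'a measure \<Rightarrow> ('a \<Rightarrow> complex) \<Rightarrow> real" where
  "L2_norm_sq \<pi> f = (LINT x|\<pi>. (norm (f x))\<^sup>2)"

lemma L2_norm_sq_nonneg: "0 \<le> L2_norm_sq \<pi> f"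
  by (simp add: L2_norm_sq_def)

lemma L2_comb_closed:
  assumes "f \<in> L2 \<pi>" "h \<in> L2 \<pi>"
  shows "L2_comb f c h \<in> L2 \<pi>"
proof -
  have [measurable]: "f \<in> borel_measurable \<pi>" "h \<in> borel_measurable \<pi>"
    using assms by (auto simp: L2_def)
  have "integrable \<pi> (\<lambda>x. 2 * (norm (f x))\<^sup>2 + 2 * (norm c)\<^sup>2 * (norm (h x))\<^sup>2)"
    using assms by (intro Bochner_Integration.integrable_add integrable_mult_right) (auto simp: L2_def)
  moreover have "(norm (f x + c * h x))\<^sup>2 \<le> 2 * (norm (f x))\<^sup>2 + 2 * (norm c)\<^sup>2 * (norm (h x))\<^sup>2" for x
  proof -
    have "(norm (f x + c * h x))\<^sup>2 \<le> (norm (f x) + norm (c * h x))\<^sup>2"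
      by (intro power_mono norm_triangle_ineq) auto
    also have "\<dots> \<le> 2 * (norm (f x))\<^sup>2 + 2 * (norm (c * h x))\<^sup>2"
      using sum_squares_bound[of "norm (f x)" "norm (c * h x)"] by (simp add: power2_sum)
    finally show ?thesis by (simp add: norm_mult power_mult_distrib)
  qed
  ultimately have "integrable \<pi> (\<lambda>x. (norm (L2_comb f c h x))\<^sup>2)"
    unfolding L2_comb_def
    by - (erule Bochner_Integration.integrable_bound, auto intro!: AE_I2 order.trans[OF _ abs_ge_self])
  thus ?thesis by (simp add: L2_def L2_comb_def)
qed

lemma L2_zero: "(\<lambda>_. 0) \<in> L2 \<pi>"
  by (simp add: L2_def)

lemma integrable_L2_inner:
  assumes "f \<in> L2 \<pi>" "h \<in> L2 \<pi>"
  shows "integrable \<pi> (\<lambda>x. f x * cnj (h x))"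
proof -
  have [measurable]: "f \<in> borel_measurable \<pi>" "h \<in> borel_measurable \<pi>"
    using assms by (auto simp: L2_def)
  have "integrable \<pi> (\<lambda>x. (norm (f x))\<^sup>2 + (norm (h x))\<^sup>2)"
    using assms by (intro Bochner_Integration.integrable_add) (auto simp: L2_def)
  moreover have "norm (f x * cnj (h x)) \<le> (norm (f x))\<^sup>2 + (norm (h x))\<^sup>2" for x
    using sum_squares_bound[of "norm (f x)" "norm (h x)"]
      mult_nonneg_nonneg[OF norm_ge_zero[of "f x"] norm_ge_zero[of "h x"]]
    unfolding norm_mult complex_mod_cnj by linarith
  ultimately show ?thesis
    by - (erule Bochner_Integration.integrable_bound, auto intro!: AE_I2 order.trans[OF _ abs_ge_self])
qed

lemma L2_inner_comb_left:
  assumes "f \<in> L2 \<pi>" "h \<in> L2 \<pi>" "k \<in> L2 \<pi>"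
  shows "L2_inner \<pi> (L2_comb f c h) k = L2_inner \<pi> f k + c * L2_inner \<pi> h k"
proof -
  have "L2_inner \<pi> (L2_comb f c h) k = (LINT x|\<pi>. f x * cnj (k x) + c * (h x * cnj (k x)))"
    by (simp add: L2_inner_def L2_comb_def distrib_right mult.assoc)
  thus ?thesis
    using assms by (simp add: L2_inner_def integrable_L2_inner)
qed

lemma L2_inner_cnj: "L2_inner \<pi> h f = cnj (L2_inner \<pi> f h)"
proof -
  have "L2_inner \<pi> h f = (LINT x|\<pi>. cnj (f x * cnj (h x)))"
    unfolding L2_inner_def by (rule Bochner_Integration.integral_cong) (simp_all add: mult.commute)
  also have "\<dots> = cnj (L2_inner \<pi> f h)"
    unfolding L2_inner_def by (rule Bochner_Integration.integral_cnj)
  finally show ?thesis .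
qed

lemma L2_inner_comb_right:
  assumes "f \<in> L2 \<pi>" "h \<in> L2 \<pi>" "k \<in> L2 \<pi>"
  shows "L2_inner \<pi> k (L2_comb f c h) = L2_inner \<pi> k f + cnj c * L2_inner \<pi> k h"
  using L2_inner_comb_left[OF assms, of c] by (metis L2_inner_cnj complex_cnj_add complex_cnj_mult)

lemma L2_inner_self: "L2_inner \<pi> f f = of_real (L2_norm_sq \<pi> f)"
  unfolding L2_inner_def L2_norm_sq_def complex_norm_square[symmetric] of_real_power[symmetric]
  by (rule integral_complex_of_real)

lemma L2_inner_cong_AE:
  assumes "AE x in \<pi>. f x = f' x" "f \<in> L2 \<pi>" "f' \<in> L2 \<pi>" "h \<in> L2 \<pi>"
  shows "L2_inner \<pi> f h = L2_inner \<pi> f' h"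
proof -
  have [measurable]: "f \<in> borel_measurable \<pi>" "f' \<in> borel_measurable \<pi>" "h \<in> borel_measurable \<pi>"
    using assms by (auto simp: L2_def)
  show ?thesis
    unfolding L2_inner_def using assms(1) by (intro integral_cong_AE) auto
qed

lemma L2_inner_zero: "L2_inner \<pi> (\<lambda>_. 0) h = 0" "L2_inner \<pi> h (\<lambda>_. 0) = 0"
  by (simp_all add: L2_inner_def)

lemma L2_eq_AE_I:
  assumes f: "f \<in> L2 \<pi>" and f': "f' \<in> L2 \<pi>"
    and eq: "\<And>h. h \<in> L2 \<pi> \<Longrightarrow> L2_inner \<pi> f h = L2_inner \<pi> f' h"
  shows "AE x in \<pi>. f x = f' x"
proof -
  let ?d = "L2_comb f (-1) f'"
  have d: "?d \<in> L2 \<pi>" by (rule L2_comb_closed[OF f f'])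
  have "L2_inner \<pi> ?d ?d = 0"
    using L2_inner_comb_left[OF f f' d, of "-1"] eq[OF d] by simp
  hence "(LINT x|\<pi>. (norm (?d x))\<^sup>2) = 0"
    unfolding L2_inner_self by (simp add: L2_norm_sq_def)
  moreover have "integrable \<pi> (\<lambda>x. (norm (?d x))\<^sup>2)" using d by (simp add: L2_def)
  ultimately have "AE x in \<pi>. (norm (?d x))\<^sup>2 = 0"
    by (subst (asm) integral_nonneg_eq_0_iff_AE) auto
  thus ?thesis by eventually_elim (simp add: L2_comb_def)
qed

text \<open>
  The expression for \<open>q\<close> is the expansion of a quadratic form at \<open>f + c h\<close>. The four values of \<open>c\<close> isolate
  the coefficient \<open>B\<close> of \<open>cnj c\<close>, which is the sesquilinear value at \<open>(f, h)\<close>.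
\<close>

lemma polarization_coefficient:
  fixes q :: "complex \<Rightarrow> complex"
  assumes expand: "\<And>c. q c = A + cnj c * B + c * C + (c * cnj c) * D"
  shows "4 * B = q 1 + \<i> * q \<i> - q (-1) - \<i> * q (- \<i>)"
  unfolding expand by (simp add: algebra_simps)

lemma parallelogram4:
  assumes f: "f \<in> L2 \<pi>" and h: "h \<in> L2 \<pi>"
  shows "L2_norm_sq \<pi> (L2_comb f 1 h) + L2_norm_sq \<pi> (L2_comb f \<i> h) + L2_norm_sq \<pi> (L2_comb f (-1) h)
    + L2_norm_sq \<pi> (L2_comb f (- \<i>) h) = 4 * (L2_norm_sq \<pi> f + L2_norm_sq \<pi> h)"
proof -
  have "of_real (L2_norm_sq \<pi> (L2_comb f c h)) = L2_inner \<pi> f f + cnj c * L2_inner \<pi> f h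
      + c * L2_inner \<pi> h f + c * cnj c * L2_inner \<pi> h h" for c
    unfolding L2_inner_self[symmetric] using f h
    by (simp add: L2_inner_comb_left L2_inner_comb_right L2_comb_closed algebra_simps)
  hence "complex_of_real (L2_norm_sq \<pi> (L2_comb f 1 h) + L2_norm_sq \<pi> (L2_comb f \<i> h) + L2_norm_sq \<pi> (L2_comb f (-1) h)
    + L2_norm_sq \<pi> (L2_comb f (- \<i>) h)) = 4 * (L2_inner \<pi> f f + L2_inner \<pi> h h)"
    by (simp add: algebra_simps)
  also have "\<dots> = of_real (4 * (L2_norm_sq \<pi> f + L2_norm_sq \<pi> h))"
    by (simp add: L2_inner_self)
  finally show ?thesis by (simp only: of_real_eq_iff)
qed

lemma L2_adjointD:
  assumes "L2_adjoint \<pi> T T'" "f \<in> L2 \<pi>"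
  shows "T f \<in> L2 \<pi>" "T' f \<in> L2 \<pi>"
    and "h \<in> L2 \<pi> \<Longrightarrow> L2_inner \<pi> (T f) h = L2_inner \<pi> f (T' h)"
  using assms by (auto simp: L2_adjoint_def)

lemma L2_adjoint_comb:
  assumes T: "L2_adjoint \<pi> T T'" and f: "f \<in> L2 \<pi>" "h \<in> L2 \<pi>" and k: "k \<in> L2 \<pi>"
  shows "L2_inner \<pi> (T (L2_comb f c h)) k = L2_inner \<pi> (T f) k + c * L2_inner \<pi> (T h) k"
  using f k L2_comb_closed[OF f, of c]
  by (simp add: L2_adjointD[OF T] L2_inner_comb_left)

lemma L2_quadratic_expand:
  assumes T: "L2_adjoint \<pi> T T'" and f: "f \<in> L2 \<pi>" "h \<in> L2 \<pi>"
  shows "L2_inner \<pi> (T (L2_comb f c h)) (L2_comb f c h)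
    = L2_inner \<pi> (T f) f + cnj c * L2_inner \<pi> (T f) h + c * L2_inner \<pi> (T h) f
      + (c * cnj c) * L2_inner \<pi> (T h) h"
  using f L2_adjointD(1)[OF T] L2_comb_closed[OF f, of c]
  by (simp add: L2_adjoint_comb[OF T] L2_inner_comb_right algebra_simps)

lemma L2_adjoint_power:
  assumes T: "L2_adjoint \<pi> T T'"
  shows "L2_adjoint \<pi> (T ^^ n) (T' ^^ n)"
proof (induction n)
  case (Suc n)
  have "T' ^^ Suc n = (T' ^^ n) \<circ> T'" by (rule funpow_Suc_right)
  thus ?case
    using L2_adjointD[OF T] L2_adjointD[OF Suc] by (simp add: L2_adjoint_def del: funpow.simps(2)) simp
qed (simp add: L2_adjoint_def)

locale L2_spectral =
  fixes \<pi> :: "'a measure" and T T' :: "('a \<Rightarrow> complex) \<Rightarrow> 'a \<Rightarrow> complex"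
    and E :: "complex set \<Rightarrow> ('a \<Rightarrow> complex) \<Rightarrow> 'a \<Rightarrow> complex"
  assumes adjoint: "L2_adjoint \<pi> T T'"
    and resolution: "resolution_of_identity \<pi> T E"
begin

abbreviation ip (\<open>\<langle>_, _\<rangle>\<close>) where "\<langle>f, h\<rangle> \<equiv> L2_inner \<pi> f h"
abbreviation norm_sq where "norm_sq \<equiv> L2_norm_sq \<pi>"
abbreviation disc_sets where "disc_sets \<equiv> sets borel_disc"
abbreviation \<mu> where "\<mu> f \<equiv> scalar_spectral_measure \<pi> E f"

lemma pvm: "projection_valued_measure \<pi> E"
  using resolution by (simp add: resolution_of_identity_def)

lemma E_adj: "A \<in> disc_sets \<Longrightarrow> L2_adjoint \<pi> (E A) (E A)"
  using pvm by (simp add: projection_valued_measure_def)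

lemma E_L2: "A \<in> disc_sets \<Longrightarrow> f \<in> L2 \<pi> \<Longrightarrow> E A f \<in> L2 \<pi>"
  using L2_adjointD[OF E_adj] by blast

lemma E_mult: "A \<in> disc_sets \<Longrightarrow> B \<in> disc_sets \<Longrightarrow> f \<in> L2 \<pi> \<Longrightarrow> AE x in \<pi>. E A (E B f) x = E (A \<inter> B) f x"
  using pvm by (simp add: projection_valued_measure_def)

lemma E_mult_ip:
  "A \<in> disc_sets \<Longrightarrow> B \<in> disc_sets \<Longrightarrow> f \<in> L2 \<pi> \<Longrightarrow> h \<in> L2 \<pi> \<Longrightarrow> \<langle>E A (E B f), h\<rangle> = \<langle>E (A \<inter> B) f, h\<rangle>"
  by (rule L2_inner_cong_AE[OF E_mult]) (auto intro: E_L2)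

lemma E_sums:
  "range A \<subseteq> disc_sets \<Longrightarrow> disjoint_family A \<Longrightarrow> f \<in> L2 \<pi> \<Longrightarrow> h \<in> L2 \<pi>
    \<Longrightarrow> (\<lambda>i::nat. \<langle>E (A i) f, h\<rangle>) sums \<langle>E (\<Union>i. A i) f, h\<rangle>"
  using pvm by (simp add: projection_valued_measure_def)

lemma unit_disc_measurable: "unit_disc \<in> disc_sets"
  using sets.top[of borel_disc] unfolding space_restrict_space by simp

lemma E_disc_ip: "f \<in> L2 \<pi> \<Longrightarrow> h \<in> L2 \<pi> \<Longrightarrow> \<langle>E unit_disc f, h\<rangle> = \<langle>f, h\<rangle>"
  using pvm by (intro L2_inner_cong_AE)
    (auto simp: projection_valued_measure_def intro!: E_L2 unit_disc_measurable)

lemma E_empty_ip: "f \<in> L2 \<pi> \<Longrightarrow> h \<in> L2 \<pi> \<Longrightarrow> \<langle>E {} f, h\<rangle> = 0"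
proof -
  assume f: "f \<in> L2 \<pi>" "h \<in> L2 \<pi>"
  have "(\<lambda>i::nat. \<langle>E {} f, h\<rangle>) sums \<langle>E (\<Union>i::nat. {}) f, h\<rangle>"
    by (rule E_sums[OF _ _ f]) (auto simp: disjoint_family_on_def)
  hence "summable (\<lambda>i::nat. \<langle>E {} f, h\<rangle>)" by (rule sums_summable)
  thus ?thesis by (simp add: summable_const_iff)
qed

lemma E_Un_ip:
  assumes A: "A \<in> disc_sets" "B \<in> disc_sets" "A \<inter> B = {}" and f: "f \<in> L2 \<pi>" "h \<in> L2 \<pi>"
  shows "\<langle>E (A \<union> B) f, h\<rangle> = \<langle>E A f, h\<rangle> + \<langle>E B f, h\<rangle>"
proof -
  let ?F = "\<lambda>i::nat. if i = 0 then A else if i = 1 then B else {}"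
  have "(\<lambda>i. \<langle>E (?F i) f, h\<rangle>) sums \<langle>E (\<Union>i. ?F i) f, h\<rangle>"
    by (rule E_sums[OF _ _ f]) (use A in \<open>auto simp: disjoint_family_on_def\<close>)
  moreover have "(\<Union>i. ?F i) = A \<union> B" by (auto split: if_splits)
  moreover have "(\<lambda>i. \<langle>E (?F i) f, h\<rangle>) sums (\<Sum>i\<in>{0,1}. \<langle>E (?F i) f, h\<rangle>)"
    by (rule sums_finite) (use E_empty_ip[OF f] in auto)
  ultimately have "\<langle>E (A \<union> B) f, h\<rangle> = (\<Sum>i\<in>{0,1}. \<langle>E (?F i) f, h\<rangle>)"
    by (simp only: sums_unique2)
  thus ?thesis by simp
qed

lemma E_compl_ip:
  assumes A: "A \<in> disc_sets" and f: "f \<in> L2 \<pi>" "h \<in> L2 \<pi>"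
  shows "\<langle>f, h\<rangle> = \<langle>E A f, h\<rangle> + \<langle>E (unit_disc - A) f, h\<rangle>"
proof -
  have "A \<subseteq> unit_disc" using sets.sets_into_space[OF A] by (simp add: space_restrict_space)
  hence "A \<union> (unit_disc - A) = unit_disc" by blast
  thus ?thesis
    using E_Un_ip[of A "unit_disc - A" f h] E_disc_ip[OF f] A f sets.Diff[OF unit_disc_measurable A] by simp
qed

lemma E_self_ip:
  assumes "A \<in> disc_sets" "f \<in> L2 \<pi>"
  shows "\<langle>E A f, f\<rangle> = of_real (norm_sq (E A f))"
proof -
  have "\<langle>E A f, f\<rangle> = \<langle>E A (E A f), f\<rangle>" using E_mult_ip[of A A f f] assms by simp
  also have "\<dots> = \<langle>E A f, E A f\<rangle>" using assms by (intro L2_adjointD(3)[OF E_adj] E_L2)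
  finally show ?thesis by (simp add: L2_inner_self)
qed

lemma sets_spectral: "sets (\<mu> f) = disc_sets"
  and space_spectral: "space (\<mu> f) = unit_disc"
proof -
  have "disc_sets \<subseteq> Pow unit_disc" using sets.space_closed[of borel_disc] by (simp add: space_restrict_space)
  thus "sets (\<mu> f) = disc_sets" "space (\<mu> f) = unit_disc"
    unfolding scalar_spectral_measure_def
    using sigma_algebra.sigma_sets_eq[OF sets.sigma_algebra_axioms[of borel_disc]]
    by (simp_all add: sets_measure_of space_measure_of_conv space_restrict_space)
qed

lemma emeasure_spectral:
  assumes f: "f \<in> L2 \<pi>" and A: "A \<in> disc_sets"
  shows "emeasure (\<mu> f) A = ennreal (norm_sq (E A f))"
proof -
  have sa: "sigma_algebra unit_disc disc_sets"
    using sets.sigma_algebra_axioms[of borel_disc] by (simp add: space_restrict_space)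
  have Re: "Re \<langle>E B f, f\<rangle> = norm_sq (E B f)" if "B \<in> disc_sets" for B
    by (simp add: E_self_ip[OF that f])
  have "emeasure (\<mu> f) A = ennreal (Re \<langle>E A f, f\<rangle>)"
    unfolding scalar_spectral_measure_def
  proof (rule emeasure_measure_of_sigma[OF sa _ _ A])
    show "positive disc_sets (\<lambda>A. ennreal (Re \<langle>E A f, f\<rangle>))"
      by (simp add: positive_def E_empty_ip f)
    show "countably_additive disc_sets (\<lambda>A. ennreal (Re \<langle>E A f, f\<rangle>))"
      unfolding countably_additive_def
    proof (intro allI impI)
      fix B :: "nat \<Rightarrow> complex set"
      assume B: "range B \<subseteq> disc_sets" "disjoint_family B"
      have s: "(\<lambda>i. Re \<langle>E (B i) f, f\<rangle>) sums Re \<langle>E (\<Union>i. B i) f, f\<rangle>"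
        by (rule sums_Re[OF E_sums[OF B f f]])
      have "0 \<le> Re \<langle>E (B i) f, f\<rangle>" for i
      proof -
        have "B i \<in> disc_sets" using B by blast
        from Re[OF this] show ?thesis by (simp only: L2_norm_sq_nonneg)
      qed
      from suminf_ennreal2[OF this sums_summable[OF s]]
      show "(\<Sum>i. ennreal (Re \<langle>E (B i) f, f\<rangle>)) = ennreal (Re \<langle>E (\<Union>i. B i) f, f\<rangle>)"
        by (simp only: sums_unique[OF s, symmetric])
    qed
  qed
  thus ?thesis by (simp add: Re[OF A])
qed

lemma norm_sq_disc:
  assumes f: "f \<in> L2 \<pi>"
  shows "norm_sq (E unit_disc f) = norm_sq f"
proof -
  have "complex_of_real (norm_sq (E unit_disc f)) = \<langle>E unit_disc f, f\<rangle>"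
    by (rule E_self_ip[OF unit_disc_measurable f, symmetric])
  also have "\<dots> = \<langle>f, f\<rangle>" by (rule E_disc_ip[OF f f])
  also have "\<dots> = of_real (norm_sq f)" by (rule L2_inner_self)
  finally show ?thesis by (simp only: of_real_eq_iff)
qed

lemma finite_spectral: "f \<in> L2 \<pi> \<Longrightarrow> finite_measure (\<mu> f)"
  by (rule finite_measureI) (simp add: space_spectral emeasure_spectral unit_disc_measurable)

lemma measure_spectral: "f \<in> L2 \<pi> \<Longrightarrow> A \<in> disc_sets \<Longrightarrow> measure (\<mu> f) A = norm_sq (E A f)"
  by (simp add: measure_def emeasure_spectral L2_norm_sq_nonneg)

lemma T_quadratic: "f \<in> L2 \<pi> \<Longrightarrow> \<langle>T f, f\<rangle> = (LINT z|\<mu> f. z)"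
  using resolution by (simp add: resolution_of_identity_def)

text \<open>
  The range of the projection \<open>E A\<close>, as a set of functions that is closed under almost sure equality within \<open>L2\<close>.
\<close>

definition spectral_range :: "complex set \<Rightarrow> ('a \<Rightarrow> complex) set" where
  "spectral_range A = {f \<in> L2 \<pi>. AE x in \<pi>. E A f x = f x}"

lemma spectral_range_L2: "f \<in> spectral_range A \<Longrightarrow> f \<in> L2 \<pi>"
  by (simp add: spectral_range_def)

lemma spectral_range_ip: "A \<in> disc_sets \<Longrightarrow> f \<in> spectral_range A \<Longrightarrow> h \<in> L2 \<pi> \<Longrightarrow> \<langle>E A f, h\<rangle> = \<langle>f, h\<rangle>"
  by (rule L2_inner_cong_AE[OF _ E_L2]) (simp_all only: spectral_range_def mem_Collect_eq)

lemma spectral_rangeI: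
  assumes "A \<in> disc_sets" "f \<in> L2 \<pi>" "\<And>h. h \<in> L2 \<pi> \<Longrightarrow> \<langle>E A f, h\<rangle> = \<langle>f, h\<rangle>"
  shows "f \<in> spectral_range A"
  unfolding spectral_range_def mem_Collect_eq
  by (rule conjI[OF assms(2) L2_eq_AE_I[OF E_L2[OF assms(1,2)] assms(2,3)]])

lemma E_spectral_range: "A \<in> disc_sets \<Longrightarrow> f \<in> L2 \<pi> \<Longrightarrow> E A f \<in> spectral_range A"
  using E_mult[of A A f] unfolding Int_absorb spectral_range_def mem_Collect_eq by (intro conjI E_L2)

lemma spectral_range_disc: "f \<in> L2 \<pi> \<Longrightarrow> f \<in> spectral_range unit_disc"
  by (rule spectral_rangeI) (simp_all add: unit_disc_measurable E_disc_ip)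

lemma E_spectral_range_closed:
  assumes A: "A \<in> disc_sets" and B: "B \<in> disc_sets" and f: "f \<in> spectral_range A"
  shows "E B f \<in> spectral_range A"
proof (rule spectral_rangeI[OF A E_L2[OF B spectral_range_L2[OF f]]])
  fix h assume h: "h \<in> L2 \<pi>"
  note fL = spectral_range_L2[OF f]
  have "\<langle>E A (E B f), h\<rangle> = \<langle>E (B \<inter> A) f, h\<rangle>"
    using E_mult_ip[OF A B fL h] by (simp add: Int_commute)
  also have "\<dots> = \<langle>E B (E A f), h\<rangle>" by (rule E_mult_ip[OF B A fL h, symmetric])
  also have "\<dots> = \<langle>E A f, E B h\<rangle>" by (rule L2_adjointD(3)[OF E_adj[OF B] E_L2[OF A fL] h])
  also have "\<dots> = \<langle>f, E B h\<rangle>" by (rule spectral_range_ip[OF A f E_L2[OF B h]])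
  also have "\<dots> = \<langle>E B f, h\<rangle>" by (rule L2_adjointD(3)[OF E_adj[OF B] fL h, symmetric])
  finally show "\<langle>E A (E B f), h\<rangle> = \<langle>E B f, h\<rangle>" .
qed

lemma spectral_range_comb:
  assumes A: "A \<in> disc_sets" and f: "f \<in> spectral_range A" and h: "h \<in> spectral_range A"
  shows "L2_comb f c h \<in> spectral_range A"
proof (rule spectral_rangeI[OF A L2_comb_closed[OF spectral_range_L2[OF f] spectral_range_L2[OF h]]])
  fix k assume k: "k \<in> L2 \<pi>"
  show "\<langle>E A (L2_comb f c h), k\<rangle> = \<langle>L2_comb f c h, k\<rangle>"
    by (simp add: L2_adjoint_comb[OF E_adj[OF A] spectral_range_L2[OF f] spectral_range_L2[OF h] k]
        L2_inner_comb_left[OF spectral_range_L2[OF f] spectral_range_L2[OF h] k] spectral_range_ip[OF A f k] spectral_range_ip[OF A h k])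
qed

text \<open>
  The projections are self-adjoint and \<open>E (unit_disc - A)\<close> annihilates the range of \<open>E A\<close>.
\<close>

lemma spectral_range_orthogonal:
  assumes A: "A \<in> disc_sets" and f: "f \<in> spectral_range A" and h: "h \<in> spectral_range (unit_disc - A)"
  shows "\<langle>f, h\<rangle> = 0"
proof -
  have C: "unit_disc - A \<in> disc_sets" by (rule sets.Diff[OF unit_disc_measurable A])
  note fL = spectral_range_L2[OF f] and hL = spectral_range_L2[OF h]
  have "\<langle>f, h\<rangle> = cnj \<langle>h, f\<rangle>" by (rule L2_inner_cnj)
  also have "\<langle>h, f\<rangle> = \<langle>E (unit_disc - A) h, f\<rangle>" by (rule spectral_range_ip[OF C h fL, symmetric])
  also have "\<dots> = \<langle>h, E (unit_disc - A) f\<rangle>" by (rule L2_adjointD(3)[OF E_adj[OF C] hL fL])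
  also have "\<dots> = cnj \<langle>E (unit_disc - A) f, h\<rangle>" by (rule L2_inner_cnj)
  also have "\<langle>E (unit_disc - A) f, h\<rangle> = 0"
    using E_compl_ip[OF A fL hL, unfolded spectral_range_ip[OF A f hL]] by simp
  finally show ?thesis by simp
qed

text \<open>
  If \<open>f\<close> and \<open>h\<close> lie in complementary spectral ranges, the cross terms in the scalar spectral measure of \<open>f + c h\<close>
  vanish, so that only the modulus of \<open>c\<close> matters.
\<close>

lemma spectral_rotation:
  assumes A: "A \<in> disc_sets" and f: "f \<in> spectral_range A" and h: "h \<in> spectral_range (unit_disc - A)" and c: "norm c = 1"
  shows "\<mu> (L2_comb f c h) = \<mu> (L2_comb f 1 h)"
proof (rule measure_eqI)
  note fL = spectral_range_L2[OF f] and hL = spectral_range_L2[OF h]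
  fix B assume "B \<in> sets (\<mu> (L2_comb f c h))"
  hence B: "B \<in> disc_sets" by (simp add: sets_spectral)
  have C: "unit_disc - A \<in> disc_sets" by (rule sets.Diff[OF unit_disc_measurable A])
  have 1: "\<langle>E B f, h\<rangle> = 0" by (rule spectral_range_orthogonal[OF A E_spectral_range_closed[OF A B f] h])
  have "\<langle>E B h, f\<rangle> = cnj \<langle>f, E B h\<rangle>" by (rule L2_inner_cnj)
  also have "\<langle>f, E B h\<rangle> = 0" by (rule spectral_range_orthogonal[OF A f E_spectral_range_closed[OF C B h]])
  finally have 2: "\<langle>E B h, f\<rangle> = 0" by simp
  have eq: "complex_of_real (norm_sq (E B (L2_comb f d h))) = \<langle>E B f, f\<rangle> + \<langle>E B h, h\<rangle>" if "norm d = 1" for d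
  proof -
    have dd: "d * cnj d = 1" using that by (simp add: complex_norm_square[symmetric])
    show ?thesis
      unfolding E_self_ip[OF B L2_comb_closed[OF fL hL], symmetric]
        L2_quadratic_expand[OF E_adj[OF B] fL hL] 1 2 dd by simp
  qed
  have "complex_of_real (norm_sq (E B (L2_comb f c h))) = complex_of_real (norm_sq (E B (L2_comb f 1 h)))"
    unfolding eq[OF c] by (rule eq[symmetric]) simp
  hence "norm_sq (E B (L2_comb f c h)) = norm_sq (E B (L2_comb f 1 h))"
    by (simp only: of_real_eq_iff)
  thus "emeasure (\<mu> (L2_comb f c h)) B = emeasure (\<mu> (L2_comb f 1 h)) B"
    by (simp only: emeasure_spectral[OF L2_comb_closed[OF fL hL] B])
qed (simp add: sets_spectral)

text \<open>
  By \<open>spectral_rotation\<close> the quadratic form of \<open>T\<close> takes the same value at all four points of the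
  polarization identity, and these cancel.
\<close>

lemma T_orthogonal:
  assumes A: "A \<in> disc_sets" and f: "f \<in> spectral_range A" and h: "h \<in> spectral_range (unit_disc - A)"
  shows "\<langle>T f, h\<rangle> = 0"
proof -
  note fL = spectral_range_L2[OF f] and hL = spectral_range_L2[OF h]
  define q where "q = (\<lambda>c. \<langle>T (L2_comb f c h), L2_comb f c h\<rangle>)"
  have q: "q c = q 1" if "norm c = 1" for c
    unfolding q_def T_quadratic[OF L2_comb_closed[OF fL hL]] spectral_rotation[OF A f h that] ..
  have "4 * \<langle>T f, h\<rangle> = q 1 + \<i> * q \<i> - q (-1) - \<i> * q (- \<i>)"
    by (rule polarization_coefficient) (simp only: q_def L2_quadratic_expand[OF adjoint fL hL])
  also have "\<dots> = 0" using q[of \<i>] q[of "-1"] q[of "-\<i>"] by simp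
  finally show ?thesis by simp
qed

lemma T_L2: "f \<in> L2 \<pi> \<Longrightarrow> T f \<in> L2 \<pi>"
  using L2_adjointD[OF adjoint] by blast

text \<open>
  An image \<open>T f\<close> is orthogonal to the range of the complementary projection, hence annihilated by that projection.
\<close>

lemma T_spectral_range_closed:
  assumes A: "A \<in> disc_sets" and f: "f \<in> spectral_range A"
  shows "T f \<in> spectral_range A"
proof (rule spectral_rangeI[OF A T_L2[OF spectral_range_L2[OF f]]])
  fix u assume u: "u \<in> L2 \<pi>"
  note Tf = T_L2[OF spectral_range_L2[OF f]]
  have C: "unit_disc - A \<in> disc_sets" by (rule sets.Diff[OF unit_disc_measurable A])
  have "\<langle>E (unit_disc - A) (T f), u\<rangle> = \<langle>T f, E (unit_disc - A) u\<rangle>"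
    by (rule L2_adjointD(3)[OF E_adj[OF C] Tf u])
  also have "\<dots> = 0" by (rule T_orthogonal[OF A f E_spectral_range[OF C u]])
  finally show "\<langle>E A (T f), u\<rangle> = \<langle>T f, u\<rangle>"
    by (simp only: E_compl_ip[OF A Tf u] add_0_right)
qed

lemma spectral_AE:
  assumes A: "A \<in> disc_sets" and f: "f \<in> spectral_range A"
  shows "AE z in \<mu> f. z \<in> A"
proof -
  note fL = spectral_range_L2[OF f]
  have C: "unit_disc - A \<in> disc_sets" by (rule sets.Diff[OF unit_disc_measurable A])
  have "complex_of_real (norm_sq (E (unit_disc - A) f)) = \<langle>E (unit_disc - A) f, f\<rangle>"
    by (rule E_self_ip[OF C fL, symmetric])
  also have "\<dots> = 0" using E_compl_ip[OF A fL fL, unfolded spectral_range_ip[OF A f fL]] by simp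
  finally have "emeasure (\<mu> f) (unit_disc - A) = 0"
    by (simp add: emeasure_spectral[OF fL C])
  moreover have "unit_disc - A \<in> sets (\<mu> f)" using C by (simp only: sets_spectral)
  ultimately show ?thesis
    by (intro AE_I[where N = "unit_disc - A"]) (auto simp: space_spectral)
qed

lemma measurable_spectral: "g \<in> measurable borel N \<Longrightarrow> g \<in> measurable (\<mu> f) N"
  using measurable_cong_sets[OF sets_spectral refl, of f N]
  by (simp add: measurable_restrict_space1)

lemma integrable_spectral:
  fixes g :: "complex \<Rightarrow> 'b::{banach, second_countable_topology}"
  assumes "f \<in> L2 \<pi>" "g \<in> borel_measurable borel" "\<And>z. norm z \<le> 1 \<Longrightarrow> norm (g z) \<le> B"
  shows "integrable (\<mu> f) g"
proof -
  interpret finite_measure "\<mu> f" by (rule finite_spectral[OF assms(1)])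
  show ?thesis
    by (rule integrable_const_bound[of _ B])
      (auto intro!: AE_I2 assms(3) measurable_spectral[OF assms(2)] simp: space_spectral)
qed

text \<open>
  The scalar spectral measure of \<open>f\<close> lives on \<open>A\<close>, where \<open>z\<close> differs from \<open>c\<close> by at most \<open>e\<close>.
\<close>

lemma T_quadratic_near:
  assumes A: "A \<in> disc_sets" "A \<subseteq> cball c e" and f: "f \<in> spectral_range A"
  shows "norm (\<langle>T f, f\<rangle> - c * of_real (norm_sq f)) \<le> e * norm_sq f"
proof -
  note fL = spectral_range_L2[OF f]
  interpret finite_measure "\<mu> f" by (rule finite_spectral[OF fL])
  have mass: "measure (\<mu> f) (space (\<mu> f)) = norm_sq f"
    unfolding space_spectral measure_spectral[OF fL unit_disc_measurable] by (rule norm_sq_disc[OF fL])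
  have int: "integrable (\<mu> f) (\<lambda>z. z)"
    by (rule integrable_spectral[OF fL, of _ 1]) auto
  have "\<langle>T f, f\<rangle> - c * of_real (norm_sq f) = (LINT z|\<mu> f. z - c)"
    unfolding T_quadratic[OF fL] using int
    by (subst Bochner_Integration.integral_diff) (simp_all add: mass scaleR_conv_of_real mult.commute)
  also have "norm \<dots> \<le> (LINT z|\<mu> f. norm (z - c))"
    by (rule integral_norm_bound)
  also have "\<dots> \<le> (LINT z|\<mu> f. e)"
  proof (rule integral_mono_AE)
    show "integrable (\<mu> f) (\<lambda>z. norm (z - c))"
      using int by (intro integrable_norm Bochner_Integration.integrable_diff) auto
    show "AE z in \<mu> f. norm (z - c) \<le> e"
      using spectral_AE[OF A(1) f]
      by eventually_elim (use A(2) in \<open>auto simp: dist_norm norm_minus_commute\<close>)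
  qed simp
  also have "\<dots> = e * norm_sq f" by (simp add: mass mult.commute)
  finally show ?thesis .
qed

text \<open>
  Polarization of \<open>T_quadratic_near\<close>. The four error terms add up by the parallelogram law, which is why the
  bound involves the sum of the squared norms.
\<close>

lemma T_near:
  assumes A: "A \<in> disc_sets" "A \<subseteq> cball c e" and u: "u \<in> spectral_range A" and h: "h \<in> spectral_range A"
  shows "norm (\<langle>T u, h\<rangle> - c * \<langle>u, h\<rangle>) \<le> e * (norm_sq u + norm_sq h)"
proof -
  note uL = spectral_range_L2[OF u] and hL = spectral_range_L2[OF h]
  have id: "L2_adjoint \<pi> (\<lambda>f. f) (\<lambda>f. f)" by (simp add: L2_adjoint_def)
  define q where "q = (\<lambda>d. \<langle>T (L2_comb u d h), L2_comb u d h\<rangle>)"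
  define r where "r = (\<lambda>d. \<langle>L2_comb u d h, L2_comb u d h\<rangle>)"
  define s where "s = (\<lambda>d. q d - c * r d)"
  have 1: "4 * \<langle>T u, h\<rangle> = q 1 + \<i> * q \<i> - q (-1) - \<i> * q (- \<i>)"
    by (rule polarization_coefficient) (simp only: q_def L2_quadratic_expand[OF adjoint uL hL])
  have 2: "4 * \<langle>u, h\<rangle> = r 1 + \<i> * r \<i> - r (-1) - \<i> * r (- \<i>)"
    by (rule polarization_coefficient) (simp only: r_def L2_quadratic_expand[OF id uL hL])
  have "4 * (\<langle>T u, h\<rangle> - c * \<langle>u, h\<rangle>) = 4 * \<langle>T u, h\<rangle> - c * (4 * \<langle>u, h\<rangle>)"
    by (simp add: algebra_simps)
  also have "\<dots> = s 1 + \<i> * s \<i> - s (-1) - \<i> * s (- \<i>)"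
    unfolding 1 2 s_def by (simp add: algebra_simps)
  finally have eq: "4 * (\<langle>T u, h\<rangle> - c * \<langle>u, h\<rangle>) = s 1 + \<i> * s \<i> - s (-1) - \<i> * s (- \<i>)" .
  have s: "norm (s d) \<le> e * norm_sq (L2_comb u d h)" for d
    unfolding s_def q_def r_def L2_inner_self
    by (rule T_quadratic_near[OF A spectral_range_comb[OF A(1) u h]])
  have "4 * norm (\<langle>T u, h\<rangle> - c * \<langle>u, h\<rangle>) = norm (4 * (\<langle>T u, h\<rangle> - c * \<langle>u, h\<rangle>))"
    by (simp only: norm_mult norm_numeral)
  also have "\<dots> \<le> norm (s 1) + norm (\<i> * s \<i>) + norm (s (-1)) + norm (\<i> * s (- \<i>))"
    unfolding eq
    by (intro order.trans[OF norm_triangle_ineq4] add_right_mono order.trans[OF norm_triangle_ineq]) simp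
  also have "\<dots> = norm (s 1) + norm (s \<i>) + norm (s (-1)) + norm (s (- \<i>))"
    by (simp add: norm_mult)
  also have "\<dots> \<le> e * norm_sq (L2_comb u 1 h) + e * norm_sq (L2_comb u \<i> h) + e * norm_sq (L2_comb u (-1) h)
      + e * norm_sq (L2_comb u (- \<i>) h)"
    by (intro add_mono s)
  also have "\<dots> = e * (norm_sq (L2_comb u 1 h) + norm_sq (L2_comb u \<i> h) + norm_sq (L2_comb u (-1) h)
      + norm_sq (L2_comb u (- \<i>) h))" by (simp add: distrib_left)
  also have "\<dots> = 4 * (e * (norm_sq u + norm_sq h))"
    unfolding parallelogram4[OF uL hL] by simp
  finally show ?thesis by simp
qed

text \<open>
  A crude bound on the operator norm is enough here: it enters only constants that do not depend on the partition.
\<close>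

lemma norm_sq_T_le:
  assumes u: "u \<in> L2 \<pi>"
  shows "norm_sq (T u) \<le> 4 * norm_sq u"
proof -
  \<comment> \<open>testing with \<open>T u / 2\<close> makes the coefficient of \<open>norm_sq (T u)\<close> smaller on the right than on the left\<close>
  define h where "h = L2_comb (\<lambda>_. 0) (1/2) (T u)"
  note Tu = T_L2[OF u]
  have h: "h \<in> L2 \<pi>" unfolding h_def by (rule L2_comb_closed[OF L2_zero Tu])
  have h1: "\<langle>T u, h\<rangle> = (1/2) * of_real (norm_sq (T u))"
    unfolding h_def L2_inner_comb_right[OF L2_zero Tu Tu] by (simp add: L2_inner_zero L2_inner_self)
  have h2: "norm_sq h = norm_sq (T u) / 4"
    unfolding h_def L2_norm_sq_def L2_comb_def by (simp add: norm_mult power_mult_distrib power_divide norm_divide)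
  have "norm (\<langle>T u, h\<rangle> - 0 * \<langle>u, h\<rangle>) \<le> 1 * (norm_sq u + norm_sq h)"
    by (rule T_near[OF unit_disc_measurable order_refl spectral_range_disc[OF u] spectral_range_disc[OF h]])
  hence "norm ((1/2) * complex_of_real (norm_sq (T u))) \<le> norm_sq u + norm_sq (T u) / 4"
    unfolding h1 h2 by simp
  also have "norm ((1/2) * complex_of_real (norm_sq (T u))) = norm_sq (T u) / 2"
    by (simp add: norm_mult norm_divide L2_norm_sq_nonneg)
  finally show ?thesis by simp
qed

lemma T_power_L2: "f \<in> L2 \<pi> \<Longrightarrow> (T ^^ n) f \<in> L2 \<pi>"
  by (induction n) (auto intro: T_L2)

lemma norm_sq_T_power_le:
  assumes "f \<in> L2 \<pi>"
  shows "norm_sq ((T ^^ n) f) \<le> 4 ^ n * norm_sq f"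
proof (induction n)
  case (Suc n)
  have "norm_sq ((T ^^ Suc n) f) \<le> 4 * norm_sq ((T ^^ n) f)"
    using norm_sq_T_le[OF T_power_L2[OF assms]] by simp
  thus ?case using Suc by simp
qed simp

lemma T_power_spectral_range: "A \<in> disc_sets \<Longrightarrow> f \<in> spectral_range A \<Longrightarrow> (T ^^ n) f \<in> spectral_range A"
  by (induction n) (auto intro: T_spectral_range_closed)

text \<open>
  Each application of \<open>T\<close> multiplies by approximately \<open>c\<close>. The error of step \<open>k\<close> is proportional to the squared
  norm of \<open>(T ^^ k) f\<close>, hence the geometric sum.
\<close>

lemma T_power_near:
  assumes A: "A \<in> disc_sets" "A \<subseteq> cball c e" and c: "norm c \<le> 1" and f: "f \<in> spectral_range A"
  shows "norm (\<langle>(T ^^ n) f, f\<rangle> - c ^ n * of_real (norm_sq f)) \<le> (\<Sum>k<n. 4 ^ k + 1) * e * norm_sq f"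
proof (induction n)
  case 0
  thus ?case by (simp add: L2_inner_self)
next
  case (Suc n)
  note fL = spectral_range_L2[OF f]
  have e: "0 \<le> e * (norm_sq ((T ^^ n) f) + norm_sq f)"
    by (rule order.trans[OF norm_ge_zero T_near[OF A T_power_spectral_range[OF A(1) f] f]])
  have "norm (\<langle>T ((T ^^ n) f), f\<rangle> - c * \<langle>(T ^^ n) f, f\<rangle>) \<le> e * (norm_sq ((T ^^ n) f) + norm_sq f)"
    by (rule T_near[OF A T_power_spectral_range[OF A(1) f] f])
  also have "\<dots> \<le> e * (4 ^ n * norm_sq f + norm_sq f)"
  proof (cases "e \<ge> 0")
    case True
    thus ?thesis using norm_sq_T_power_le[OF fL, of n] by (intro mult_left_mono add_right_mono)
  next
    case False
    hence "norm_sq ((T ^^ n) f) + norm_sq f \<le> 0" using e by (simp add: zero_le_mult_iff)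
    hence "norm_sq f = 0" "norm_sq ((T ^^ n) f) = 0"
      using L2_norm_sq_nonneg[of \<pi> f] L2_norm_sq_nonneg[of \<pi> "(T ^^ n) f"] by linarith+
    thus ?thesis by simp
  qed
  finally have step: "norm (\<langle>T ((T ^^ n) f), f\<rangle> - c * \<langle>(T ^^ n) f, f\<rangle>) \<le> (4 ^ n + 1) * e * norm_sq f"
    by (simp add: algebra_simps)
  have "norm (c * (\<langle>(T ^^ n) f, f\<rangle> - c ^ n * of_real (norm_sq f)))
      \<le> 1 * norm (\<langle>(T ^^ n) f, f\<rangle> - c ^ n * of_real (norm_sq f))"
    unfolding norm_mult using c by (intro mult_right_mono) auto
  also have "\<dots> \<le> (\<Sum>k<n. 4 ^ k + 1) * e * norm_sq f" using Suc by simp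
  finally have IH: "norm (c * (\<langle>(T ^^ n) f, f\<rangle> - c ^ n * of_real (norm_sq f))) \<le> (\<Sum>k<n. 4 ^ k + 1) * e * norm_sq f" .
  have "\<langle>(T ^^ Suc n) f, f\<rangle> - c ^ Suc n * of_real (norm_sq f)
      = (\<langle>T ((T ^^ n) f), f\<rangle> - c * \<langle>(T ^^ n) f, f\<rangle>)
        + c * (\<langle>(T ^^ n) f, f\<rangle> - c ^ n * of_real (norm_sq f))"
    by (simp add: algebra_simps)
  also have "norm \<dots> \<le> (4 ^ n + 1) * e * norm_sq f + (\<Sum>k<n. 4 ^ k + 1) * e * norm_sq f"
    by (rule norm_triangle_le[OF add_mono[OF step IH]])
  also have "\<dots> = (\<Sum>k<Suc n. 4 ^ k + 1) * e * norm_sq f"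
    by (simp add: algebra_simps)
  finally show ?case .
qed

lemma disc_partition:
  assumes "e > 0"
  shows "\<exists>A c. range A \<subseteq> disc_sets \<and> disjoint_family A \<and> (\<Union>i::nat. A i) = unit_disc
    \<and> (\<forall>i. norm (c i :: complex) \<le> 1 \<and> A i \<subseteq> cball (c i) e)"
proof -
  have cover: "unit_disc \<subseteq> (\<Union>x\<in>unit_disc. ball x e)"
  proof
    fix x assume "x \<in> unit_disc"
    moreover have "x \<in> ball x e" using assms by simp
    ultimately show "x \<in> (\<Union>x\<in>unit_disc. ball x e)" by blast
  qed
  obtain k where k: "k \<subseteq> unit_disc" "finite k" "unit_disc \<subseteq> (\<Union>x\<in>k. ball x e)"
    by (rule compactE_image[OF compact_cball _ cover, OF open_ball])
  have "(0::complex) \<in> unit_disc" by simp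
  hence ne: "k \<noteq> {}" using k(3) by blast
  define c where "c = from_nat_into k"
  have c: "range c = k" unfolding c_def by (rule range_from_nat_into[OF ne countable_finite[OF k(2)]])
  define B where "B = (\<lambda>i. ball (c i) e \<inter> unit_disc)"
  have B: "B i \<in> disc_sets" for i
    unfolding B_def by (subst sets_restrict_space_iff) auto
  have c1: "norm (c i) \<le> 1" for i
  proof -
    have "c i \<in> k" using c by blast
    hence "c i \<in> unit_disc" using k(1) by blast
    thus ?thesis by simp
  qed
  have "range B \<subseteq> disc_sets" using B by blast
  hence sets: "range (disjointed B) \<subseteq> disc_sets" by (rule sets.range_disjointed_sets)
  have "unit_disc \<subseteq> (\<Union>i. ball (c i) e)" using k(3) unfolding c[symmetric] by blast
  hence "(\<Union>i. B i) = unit_disc" unfolding B_def by blast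
  hence union: "(\<Union>i. disjointed B i) = unit_disc" by (simp only: UN_disjointed_eq)
  have sub: "disjointed B i \<subseteq> cball (c i) e" for i
    using disjointed_subset[of B i] ball_subset_cball[of "c i" e] unfolding B_def by blast
  show ?thesis
    by (intro exI[of _ "disjointed B"] exI[of _ c] conjI allI sets disjoint_family_disjointed union c1 sub)
qed

text \<open>
  Over a partition of the disc into sets of small diameter, both sides are sums of contributions of the
  pieces: on the left because \<open>T ^^ n\<close> preserves the spectral ranges, on the right by additivity of the
  integral. On each piece both contributions are close to a constant power times the mass of the piece.
\<close>

theorem spectral_moments:
  assumes g: "g \<in> L2 \<pi>"
  shows "\<langle>(T ^^ n) g, g\<rangle> = (LINT z|\<mu> g. z ^ n)"
proof -
  interpret finite_measure "\<mu> g" by (rule finite_spectral[OF g])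
  define b where "b = (\<Sum>k<n. 4 ^ k + 1) + real n"
  have "0 \<le> b" unfolding b_def by (intro add_nonneg_nonneg sum_nonneg) auto
  have mass: "measure (\<mu> g) (space (\<mu> g)) = norm_sq g"
    unfolding space_spectral measure_spectral[OF g unit_disc_measurable] by (rule norm_sq_disc[OF g])
  have int: "integrable (\<mu> g) (\<lambda>z. z ^ n)"
    by (rule integrable_spectral[OF g, of _ 1]) (auto simp: norm_power power_le_one)
  have "norm (\<langle>(T ^^ n) g, g\<rangle> - (LINT z|\<mu> g. z ^ n)) \<le> b * norm_sq g * e" if e: "e > 0" for e
  proof -
    from disc_partition[OF e] obtain A c where Ac: "range A \<subseteq> disc_sets \<and> disjoint_family A
      \<and> (\<Union>i::nat. A i) = unit_disc \<and> (\<forall>i. norm (c i :: complex) \<le> 1 \<and> A i \<subseteq> cball (c i) e)"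
      by (elim exE)
    note A = Ac[THEN conjunct1] Ac[THEN conjunct2, THEN conjunct1]
      Ac[THEN conjunct2, THEN conjunct2, THEN conjunct1]
    have c: "norm (c i) \<le> 1" "A i \<subseteq> cball (c i) e" for i
      using Ac[THEN conjunct2, THEN conjunct2, THEN conjunct2, THEN spec, of i] by (rule conjunct1, rule conjunct2)
    have Ai: "A i \<in> disc_sets" for i using A(1) by blast
    have Ai': "A i \<in> sets (\<mu> g)" for i using Ai by (simp only: sets_spectral)
    note adj = L2_adjoint_power[OF adjoint, of n]
    have piece: "\<langle>(T ^^ n) (E (A i) g), g\<rangle> = \<langle>(T ^^ n) (E (A i) g), E (A i) g\<rangle>" for i
    proof -
      have r: "(T ^^ n) (E (A i) g) \<in> spectral_range (A i)" by (intro T_power_spectral_range Ai E_spectral_range g)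
      show ?thesis
        by (rule trans[OF spectral_range_ip[OF Ai r g, symmetric] L2_adjointD(3)[OF E_adj[OF Ai] spectral_range_L2[OF r] g]])
    qed
    have s1: "(\<lambda>i. \<langle>(T ^^ n) (E (A i) g), E (A i) g\<rangle>) sums \<langle>(T ^^ n) g, g\<rangle>"
    proof -
      have "(\<lambda>i. \<langle>E (A i) g, (T' ^^ n) g\<rangle>) sums \<langle>E (\<Union>i. A i) g, (T' ^^ n) g\<rangle>"
        by (rule E_sums[OF A(1,2) g L2_adjointD(2)[OF adj g]])
      thus ?thesis
        unfolding A(3) E_disc_ip[OF g L2_adjointD(2)[OF adj g]]
          L2_adjointD(3)[OF adj g g, symmetric]
          L2_adjointD(3)[OF adj E_L2[OF Ai g] g, symmetric] piece .
    qed
    have s3: "(\<lambda>i. norm_sq (E (A i) g)) sums norm_sq g"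
    proof -
      have "(\<lambda>i. measure (\<mu> g) (A i)) sums measure (\<mu> g) (\<Union>i. A i)"
        using Ai' A(2) by (intro finite_measure_UNION) auto
      thus ?thesis
        unfolding A(3) measure_spectral[OF g Ai] measure_spectral[OF g unit_disc_measurable] norm_sq_disc[OF g] .
    qed
    have s2: "(\<lambda>i. LINT z:A i|\<mu> g. z ^ n) sums (LINT z|\<mu> g. z ^ n)"
    proof -
      have "(\<Union>i. A i) \<in> sets (\<mu> g)" unfolding A(3) sets_spectral by (rule unit_disc_measurable)
      hence si: "set_integrable (\<mu> g) (\<Union>i. A i) (\<lambda>z. z ^ n)"
        unfolding set_integrable_def by (rule integrable_mult_indicator[OF _ int])
      have *: "(LINT z:(\<Union>i. A i)|\<mu> g. z ^ n) = (\<Sum>i. LINT z:A i|\<mu> g. z ^ n)"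
        by (rule lebesgue_integral_countable_add[OF Ai' _ si])
          (rule disjoint_family_onD[OF A(2) UNIV_I UNIV_I])
      have **: "(LINT z:(\<Union>i. A i)|\<mu> g. z ^ n) = (LINT z|\<mu> g. z ^ n)"
        unfolding A(3) using set_integral_space[OF int] unfolding space_spectral .
      have "summable (\<lambda>i. LINT z:A i|\<mu> g. z ^ n)"
      proof (rule summable_comparison_test'[OF sums_summable[OF s3], of 0])
        fix i
        have "norm (LINT z:A i|\<mu> g. z ^ n) \<le> (LINT z|\<mu> g. norm (indicator (A i) z *\<^sub>R z ^ n))"
          unfolding set_lebesgue_integral_def by (rule integral_norm_bound)
        also have "\<dots> \<le> (LINT z|\<mu> g. indicator (A i) z)"
        proof (rule integral_mono)
          show "integrable (\<mu> g) (\<lambda>z. norm (indicator (A i) z *\<^sub>R z ^ n))"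
            by (rule integrable_norm[OF integrable_mult_indicator[OF Ai' int]])
          show "integrable (\<mu> g) (\<lambda>z. indicator (A i) z :: real)"
            using Ai' by (intro integrable_real_indicator) (auto simp: emeasure_eq_measure)
          fix z assume "z \<in> space (\<mu> g)"
          thus "norm (indicator (A i) z *\<^sub>R z ^ n) \<le> indicator (A i) z"
            by (auto simp: space_spectral norm_power power_le_one indicator_def)
        qed
        also have "\<dots> = norm_sq (E (A i) g)"
          using Ai'[THEN sets.sets_into_space] by (simp add: measure_spectral[OF g Ai] Int_absorb2)
        finally show "norm (LINT z:A i|\<mu> g. z ^ n) \<le> norm_sq (E (A i) g)" .
      qed
      from summable_sums[OF this] show ?thesis unfolding *[symmetric] ** .
    qed
    have bound: "norm (\<langle>(T ^^ n) (E (A i) g), E (A i) g\<rangle> - (LINT z:A i|\<mu> g. z ^ n)) \<le> (b * e) * norm_sq (E (A i) g)" for i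
    proof -
      let ?f = "E (A i) g"
      have 1: "norm (\<langle>(T ^^ n) ?f, ?f\<rangle> - c i ^ n * of_real (norm_sq ?f)) \<le> (\<Sum>k<n. 4 ^ k + 1) * e * norm_sq ?f"
        by (rule T_power_near[OF Ai c(2) c(1) E_spectral_range[OF Ai g]])
      have i1: "integrable (\<mu> g) (\<lambda>z. indicator (A i) z *\<^sub>R (z ^ n))"
        by (rule integrable_mult_indicator[OF Ai' int])
      have i2: "integrable (\<mu> g) (\<lambda>z. indicator (A i) z *\<^sub>R (c i ^ n))"
        by (rule integrable_mult_indicator[OF Ai']) simp
      have "c i ^ n * of_real (norm_sq ?f) = (LINT z|\<mu> g. indicator (A i) z *\<^sub>R (c i ^ n))"
        using Ai'[THEN sets.sets_into_space]
        by (simp add: measure_spectral[OF g Ai] scaleR_conv_of_real Int_absorb2 mult.commute)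
      hence "c i ^ n * of_real (norm_sq ?f) - (LINT z:A i|\<mu> g. z ^ n)
          = (LINT z|\<mu> g. indicator (A i) z *\<^sub>R (c i ^ n) - indicator (A i) z *\<^sub>R (z ^ n))"
        unfolding set_lebesgue_integral_def using i1 i2 by simp
      also have "norm \<dots> \<le> (LINT z|\<mu> g. norm (indicator (A i) z *\<^sub>R (c i ^ n) - indicator (A i) z *\<^sub>R (z ^ n)))"
        by (rule integral_norm_bound)
      also have "\<dots> \<le> (LINT z|\<mu> g. (real n * e) * indicator (A i) z)"
      proof (rule integral_mono)
        show "integrable (\<mu> g) (\<lambda>z. norm (indicator (A i) z *\<^sub>R (c i ^ n) - indicator (A i) z *\<^sub>R (z ^ n)))"
          using i1 i2 by (intro integrable_norm Bochner_Integration.integrable_diff)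
        show "integrable (\<mu> g) (\<lambda>z. (real n * e) * indicator (A i) z)"
          using Ai' by (intro integrable_mult_right integrable_real_indicator) (auto simp: emeasure_eq_measure)
        fix z assume z: "z \<in> space (\<mu> g)"
        show "norm (indicator (A i) z *\<^sub>R (c i ^ n) - indicator (A i) z *\<^sub>R (z ^ n)) \<le> (real n * e) * indicator (A i) z"
        proof (cases "z \<in> A i")
          case True
          have "norm (c i ^ n - z ^ n) \<le> real n * norm (c i - z)"
            using norm_power_diff[of "c i" z n] c(1) z by (simp add: space_spectral)
          also have "\<dots> \<le> real n * e"
            using True c(2)[of i] by (intro mult_left_mono) (auto simp: dist_norm)
          finally show ?thesis using True by simp
        qed simp
      qed
      also have "\<dots> = real n * e * norm_sq ?f"
        using Ai'[THEN sets.sets_into_space] by (simp add: measure_spectral[OF g Ai] Int_absorb2)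
      finally have 2: "norm (c i ^ n * of_real (norm_sq ?f) - (LINT z:A i|\<mu> g. z ^ n)) \<le> real n * e * norm_sq ?f" .
      have "norm (\<langle>(T ^^ n) ?f, ?f\<rangle> - (LINT z:A i|\<mu> g. z ^ n))
          \<le> (\<Sum>k<n. 4 ^ k + 1) * e * norm_sq ?f + real n * e * norm_sq ?f"
        using norm_triangle_mono[OF 1 2] by simp
      thus ?thesis by (simp add: b_def algebra_simps)
    qed
    have s4: "(\<lambda>i. (b * e) * norm_sq (E (A i) g)) sums ((b * e) * norm_sq g)" by (rule sums_mult[OF s3])
    have s5: "(\<lambda>i. \<langle>(T ^^ n) (E (A i) g), E (A i) g\<rangle> - (LINT z:A i|\<mu> g. z ^ n))
        sums (\<langle>(T ^^ n) g, g\<rangle> - (LINT z|\<mu> g. z ^ n))" by (rule sums_diff[OF s1 s2])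
    have "norm (\<langle>(T ^^ n) g, g\<rangle> - (LINT z|\<mu> g. z ^ n)) \<le> (b * e) * norm_sq g"
      by (rule norm_sums_le[OF s5 s4 bound])
    thus ?thesis by (simp add: mult_ac)
  qed
  note close = this
  have "norm (\<langle>(T ^^ n) g, g\<rangle> - (LINT z|\<mu> g. z ^ n)) \<le> 0"
  proof (rule field_le_epsilon)
    fix d :: real assume d: "d > 0"
    define K where "K = b * norm_sq g"
    have K: "0 \<le> K" unfolding K_def using \<open>0 \<le> b\<close> L2_norm_sq_nonneg by (intro mult_nonneg_nonneg)
    have "norm (\<langle>(T ^^ n) g, g\<rangle> - (LINT z|\<mu> g. z ^ n)) \<le> K * (d / (K + 1))"
      unfolding K_def by (rule close) (use d K in \<open>simp add: K_def add_nonneg_pos\<close>)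
    also have "\<dots> \<le> d" using K d by (simp add: field_simps)
    finally show "norm (\<langle>(T ^^ n) g, g\<rangle> - (LINT z|\<mu> g. z ^ n)) \<le> 0 + d" by simp
  qed
  thus ?thesis by simp
qed

end

section \<open>Covariances of the Markov chain\<close>

context stationary_markov_chain
begin

lemma chain_measurable [measurable]: "\<xi> i \<in> measurable M S"
  by (rule measurable_chain)

lemma sets_marginal: "sets \<pi> = sets S" and space_marginal: "space \<pi> = space S"
  using marginal by (auto simp flip: marginal)

lemma measurable_marginal: "measurable \<pi> N = measurable S N"
  by (rule measurable_cong_sets[OF sets_marginal refl])

text \<open>
  Stationarity of the whole path, projected to two coordinates.
\<close>

lemma distr_pair_shift:
  "distr M (S \<Otimes>\<^sub>M S) (\<lambda>\<omega>. (\<xi> (i + k) \<omega>, \<xi> (j + k) \<omega>)) = distr M (S \<Otimes>\<^sub>M S) (\<lambda>\<omega>. (\<xi> i \<omega>, \<xi> j \<omega>))"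
proof -
  have m: "(\<lambda>\<omega> i. \<xi> (i + k) \<omega>) \<in> measurable M (\<Pi>\<^sub>M i\<in>UNIV. S)" for k
    by (rule measurable_PiM_single') (auto intro: measurable_space[OF chain_measurable])
  have p: "(\<lambda>x. (x i, x j)) \<in> measurable (\<Pi>\<^sub>M i\<in>UNIV. S) (S \<Otimes>\<^sub>M S)"
    by measurable
  have "distr M (S \<Otimes>\<^sub>M S) (\<lambda>\<omega>. (\<xi> (i + k) \<omega>, \<xi> (j + k) \<omega>))
      = distr (distr M (\<Pi>\<^sub>M i\<in>UNIV. S) (\<lambda>\<omega> i. \<xi> (i + k) \<omega>)) (S \<Otimes>\<^sub>M S) (\<lambda>x. (x i, x j))" for k
    by (subst distr_distr[OF p m]) (simp add: comp_def)
  from this[of k] this[of 0] stationary[of k] show ?thesis by simp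
qed

lemma integral_pair_shift:
  fixes f :: "_ \<Rightarrow> real"
  assumes "f \<in> borel_measurable (S \<Otimes>\<^sub>M S)"
  shows "(LINT \<omega>|M. f (\<xi> (i + k) \<omega>, \<xi> (j + k) \<omega>)) = (LINT \<omega>|M. f (\<xi> i \<omega>, \<xi> j \<omega>))"
proof -
  have "(LINT \<omega>|M. f (\<xi> i \<omega>, \<xi> j \<omega>)) = (LINT x|distr M (S \<Otimes>\<^sub>M S) (\<lambda>\<omega>. (\<xi> i \<omega>, \<xi> j \<omega>)). f x)" for i j
    by (rule integral_distr[symmetric]) (use assms in auto)
  thus ?thesis using distr_pair_shift[of i k j] by simp
qed

lemma distr_chain: "distr M S (\<xi> i) = \<pi>"
proof -
  have "distr M S (\<xi> j) = distr (distr M (S \<Otimes>\<^sub>M S) (\<lambda>\<omega>. (\<xi> j \<omega>, \<xi> j \<omega>))) S fst" for j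
    by (subst distr_distr) (auto simp: comp_def)
  from this[of i] this[of 0] distr_pair_shift[of 0 i 0] marginal show ?thesis by simp
qed

lemma integral_chain:
  fixes f :: "_ \<Rightarrow> real"
  shows "f \<in> borel_measurable S \<Longrightarrow> (LINT \<omega>|M. f (\<xi> i \<omega>)) = (LINT x|\<pi>. f x)"
  by (subst distr_chain[of i, symmetric], subst integral_distr) auto

lemma integrable_chain_iff:
  fixes f :: "_ \<Rightarrow> real"
  shows "f \<in> borel_measurable S \<Longrightarrow> integrable M (\<lambda>\<omega>. f (\<xi> i \<omega>)) \<longleftrightarrow> integrable \<pi> f"
  by (subst distr_chain[of i, symmetric], subst integrable_distr_eq) auto

lemma prob_space_kernel: "x \<in> space S \<Longrightarrow> prob_space (Q x)"
  using measurable_space[OF kernel] by (simp add: space_prob_algebra)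

lemma sets_kernel: "x \<in> space S \<Longrightarrow> sets (Q x) = sets S"
  using measurable_space[OF kernel] by (simp add: space_prob_algebra)

lemma kernel_subprob [measurable]: "Q \<in> measurable S (subprob_algebra S)"
  using kernel by (rule measurable_prob_algebraD)

lemma measurable_kernel_measure: "A \<in> sets S \<Longrightarrow> (\<lambda>x. measure (Q x) A) \<in> borel_measurable S"
  by (rule measurable_compose[OF kernel_subprob measurable_measure_subprob_algebra])

lemma measurable_kernel_nn: "h \<in> borel_measurable S \<Longrightarrow> (\<lambda>x. \<integral>\<^sup>+s. h s \<partial>Q x) \<in> borel_measurable S"
  by (rule measurable_compose[OF kernel_subprob nn_integral_measurable_subprob_algebra])

lemma kernel_measure_le_1: "x \<in> space S \<Longrightarrow> measure (Q x) A \<le> 1"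
  by (rule prob_space.prob_le_1[OF prob_space_kernel])

lemma integrable_kernel_measure:
  "A \<in> sets S \<Longrightarrow> integrable M (\<lambda>\<omega>. measure (Q (\<xi> n \<omega>)) A)"
  by (rule integrable_const_bound[of _ 1])
    (auto intro!: AE_I2 kernel_measure_le_1 measurable_compose[OF chain_measurable measurable_kernel_measure]
      measurable_space[OF chain_measurable])

lemma subalgebra_present: "subalgebra M (vimage_algebra (space M) (\<xi> n) S)"
  unfolding subalgebra_def
  using measurable_sets[OF chain_measurable]
    sets_vimage_algebra2[of "\<xi> n" "space M" S] measurable_space[OF chain_measurable, of _ n]
  by auto

lemma sets_past: "sets (past_algebra M S \<xi> n)
    = sigma_sets (space M) (\<Union>k\<in>{..n}. {\<xi> k -` A \<inter> space M | A. A \<in> sets S})"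
  unfolding past_algebra_def by (rule sets_measure_of) auto

lemma space_past: "space (past_algebra M S \<xi> n) = space M"
  unfolding past_algebra_def by (rule space_measure_of) auto

lemma subalgebra_past: "subalgebra M (past_algebra M S \<xi> n)"
  unfolding subalgebra_def space_past sets_past
  by (intro conjI refl sets.sigma_sets_subset) (auto intro: measurable_sets[OF chain_measurable])

lemma sigma_finite_sub: "subalgebra M F \<Longrightarrow> sigma_finite_subalgebra M F"
  by (intro finite_measure_subalgebra_is_sigma_finite finite_measure_subalgebra.intro
      finite_measure_axioms finite_measure_subalgebra_axioms.intro)

lemma integrable_future_indicator:
  "A \<in> sets S \<Longrightarrow> integrable M (\<lambda>\<omega>. indicator A (\<xi> n \<omega>) :: real)"
  by (rule integrable_const_bound[of _ 1]) (auto simp: indicator_def)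

text \<open>
  The defining property of a conditional expectation on the event that \<open>\<xi> 0\<close> lies in \<open>B\<close>, whenever the
  conditional expectation is the transition probability from \<open>\<xi> n\<close>.
\<close>

lemma rectangle_cond_exp:
  assumes A: "A \<in> sets S" and B: "B \<in> sets S" and F: "subalgebra M F"
    and V: "\<xi> 0 -` B \<inter> space M \<in> sets F"
    and eq: "AE \<omega> in M. real_cond_exp M F (\<lambda>\<omega>. indicat_real A (\<xi> m \<omega>)) \<omega> = measure (Q (\<xi> n \<omega>)) A"
  shows "(LINT \<omega>|M. indicat_real B (\<xi> 0 \<omega>) * indicat_real A (\<xi> m \<omega>))
    = (LINT \<omega>|M. indicat_real B (\<xi> 0 \<omega>) * measure (Q (\<xi> n \<omega>)) A)"
proof -
  interpret F: sigma_finite_subalgebra M F by (rule sigma_finite_sub[OF F])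
  let ?V = "\<xi> 0 -` B \<inter> space M"
  let ?c = "real_cond_exp M F (\<lambda>\<omega>. indicat_real A (\<xi> m \<omega>))"
  have VM: "?V \<in> sets M" by (rule measurable_sets[OF chain_measurable B])
  have ind: "indicat_real ?V \<omega> = indicat_real B (\<xi> 0 \<omega>)" if "\<omega> \<in> space M" for \<omega>
    using that by (auto simp: indicator_def)
  have "(LINT \<omega>|M. indicat_real B (\<xi> 0 \<omega>) * indicat_real A (\<xi> m \<omega>)) = (LINT \<omega>:?V|M. indicat_real A (\<xi> m \<omega>))"
    unfolding set_lebesgue_integral_def by (rule Bochner_Integration.integral_cong) (auto simp: ind)
  also have "\<dots> = (LINT \<omega>:?V|M. ?c \<omega>)"
    by (rule F.real_cond_exp_intA[OF integrable_future_indicator[OF A] V])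
  also have "\<dots> = (LINT \<omega>:?V|M. measure (Q (\<xi> n \<omega>)) A)"
    unfolding set_lebesgue_integral_def
  proof (rule integral_cong_AE)
    show "AE \<omega> in M. indicat_real ?V \<omega> *\<^sub>R ?c \<omega> = indicat_real ?V \<omega> *\<^sub>R measure (Q (\<xi> n \<omega>)) A"
      using eq by eventually_elim simp
    show "(\<lambda>\<omega>. indicat_real ?V \<omega> *\<^sub>R ?c \<omega>) \<in> borel_measurable M"
      using VM by (intro borel_measurable_scaleR borel_measurable_indicator) auto
    show "(\<lambda>\<omega>. indicat_real ?V \<omega> *\<^sub>R measure (Q (\<xi> n \<omega>)) A) \<in> borel_measurable M"
      using VM by (intro borel_measurable_scaleR borel_measurable_indicator
          measurable_compose[OF chain_measurable measurable_kernel_measure[OF A]])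
  qed
  also have "\<dots> = (LINT \<omega>|M. indicat_real B (\<xi> 0 \<omega>) * measure (Q (\<xi> n \<omega>)) A)"
    unfolding set_lebesgue_integral_def by (rule Bochner_Integration.integral_cong) (auto simp: ind)
  finally show ?thesis .
qed

text \<open>
  The kernel is given as the conditional law of \<open>\<xi> 1\<close> given \<open>\<xi> 0\<close> only; stationarity transports this to all times.
\<close>

lemma cond_exp_present:
  assumes A: "A \<in> sets S"
  shows "AE \<omega> in M. real_cond_exp M (vimage_algebra (space M) (\<xi> n) S) (\<lambda>\<omega>. indicat_real A (\<xi> (n + 1) \<omega>)) \<omega>
    = measure (Q (\<xi> n \<omega>)) A"
proof -
  let ?F = "vimage_algebra (space M) (\<xi> n) S"
  interpret F: sigma_finite_subalgebra M ?F by (rule sigma_finite_sub[OF subalgebra_present])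
  show ?thesis
  proof (rule F.real_cond_exp_charact)
    fix V assume "V \<in> sets ?F"
    then obtain B where B: "B \<in> sets S" and V: "V = \<xi> n -` B \<inter> space M"
      using sets_vimage_algebra2[of "\<xi> n" "space M" S] measurable_space[OF chain_measurable, of _ n] by auto
    have ind: "indicat_real V \<omega> = indicat_real B (\<xi> n \<omega>)" if "\<omega> \<in> space M" for \<omega>
      using that by (auto simp: indicator_def V)
    have "(LINT \<omega>:V|M. indicat_real A (\<xi> (n + 1) \<omega>)) = (LINT \<omega>|M. indicat_real B (\<xi> (0 + n) \<omega>) * indicat_real A (\<xi> (1 + n) \<omega>))"
      unfolding set_lebesgue_integral_def by (rule Bochner_Integration.integral_cong) (auto simp: ind add.commute)
    also have "\<dots> = (LINT \<omega>|M. indicat_real B (\<xi> 0 \<omega>) * indicat_real A (\<xi> 1 \<omega>))"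
      using integral_pair_shift[of "\<lambda>(x, y). indicat_real B x * indicat_real A y" 0 n 1] A B by simp
    also have "\<dots> = (LINT \<omega>|M. indicat_real B (\<xi> 0 \<omega>) * measure (Q (\<xi> 0 \<omega>)) A)"
      by (rule rectangle_cond_exp[OF A B subalgebra_present in_vimage_algebra[OF B]
            regular_conditional_distribution[OF A]])
    also have "\<dots> = (LINT x|\<pi>. indicat_real B x * measure (Q x) A)"
      using A B by (intro integral_chain borel_measurable_times measurable_kernel_measure) auto
    also have "\<dots> = (LINT \<omega>|M. indicat_real B (\<xi> n \<omega>) * measure (Q (\<xi> n \<omega>)) A)"
      using A B by (intro integral_chain[symmetric] borel_measurable_times measurable_kernel_measure) auto
    also have "\<dots> = (LINT \<omega>:V|M. measure (Q (\<xi> n \<omega>)) A)"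
      unfolding set_lebesgue_integral_def by (rule Bochner_Integration.integral_cong) (auto simp: ind)
    finally show "(LINT \<omega>:V|M. indicat_real A (\<xi> (n + 1) \<omega>)) = (LINT \<omega>:V|M. measure (Q (\<xi> n \<omega>)) A)" .
  next
    show "(\<lambda>\<omega>. measure (Q (\<xi> n \<omega>)) A) \<in> borel_measurable ?F"
      by (rule measurable_compose[OF measurable_vimage_algebra1 measurable_kernel_measure[OF A]])
        (use measurable_space[OF chain_measurable] in auto)
  qed (use A in \<open>auto intro: integrable_future_indicator integrable_kernel_measure\<close>)
qed

lemma one_step_rectangle:
  assumes A: "A \<in> sets S" and B: "B \<in> sets S" and n: "0 \<le> n"
  shows "(LINT \<omega>|M. indicat_real B (\<xi> 0 \<omega>) * indicat_real A (\<xi> (n + 1) \<omega>))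
    = (LINT \<omega>|M. indicat_real B (\<xi> 0 \<omega>) * measure (Q (\<xi> n \<omega>)) A)"
proof (rule rectangle_cond_exp[OF A B subalgebra_past])
  show "\<xi> 0 -` B \<inter> space M \<in> sets (past_algebra M S \<xi> n)"
    unfolding sets_past by (rule sigma_sets.Basic) (use B n in auto)
  show "AE \<omega> in M. real_cond_exp M (past_algebra M S \<xi> n) (\<lambda>\<omega>. indicat_real A (\<xi> (n + 1) \<omega>)) \<omega>
      = measure (Q (\<xi> n \<omega>)) A"
    using markov[OF A, of n] cond_exp_present[OF A, of n] by eventually_elim simp
qed

lemma nn_one_step_rectangle:
  assumes A: "A \<in> sets S" and B: "B \<in> sets S" and n: "0 \<le> n"
  shows "(\<integral>\<^sup>+\<omega>. indicator B (\<xi> 0 \<omega>) * indicator A (\<xi> (n + 1) \<omega>) \<partial>M)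
    = (\<integral>\<^sup>+\<omega>. indicator B (\<xi> 0 \<omega>) * emeasure (Q (\<xi> n \<omega>)) A \<partial>M)"
proof -
  have i1: "integrable M (\<lambda>\<omega>. indicator B (\<xi> 0 \<omega>) * indicator A (\<xi> (n + 1) \<omega>) :: real)"
    by (rule integrable_const_bound[of _ 1]) (use A B in \<open>auto simp: indicator_def\<close>)
  have i2: "integrable M (\<lambda>\<omega>. indicator B (\<xi> 0 \<omega>) * measure (Q (\<xi> n \<omega>)) A)"
    by (rule integrable_const_bound[of _ 1])
      (use A B in \<open>auto intro!: AE_I2 kernel_measure_le_1 borel_measurable_times
          measurable_compose[OF chain_measurable measurable_kernel_measure]
          measurable_space[OF chain_measurable] simp: indicator_def\<close>)
  have "(\<integral>\<^sup>+\<omega>. indicator B (\<xi> 0 \<omega>) * indicator A (\<xi> (n + 1) \<omega>) \<partial>M)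
      = (\<integral>\<^sup>+\<omega>. ennreal (indicator B (\<xi> 0 \<omega>) * indicator A (\<xi> (n + 1) \<omega>)) \<partial>M)"
    by (intro nn_integral_cong) (auto simp: indicator_def)
  also have "\<dots> = ennreal (LINT \<omega>|M. indicator B (\<xi> 0 \<omega>) * indicator A (\<xi> (n + 1) \<omega>))"
    by (rule nn_integral_eq_integral[OF i1]) auto
  also have "\<dots> = ennreal (LINT \<omega>|M. indicator B (\<xi> 0 \<omega>) * measure (Q (\<xi> n \<omega>)) A)"
    by (simp only: one_step_rectangle[OF A B n])
  also have "\<dots> = (\<integral>\<^sup>+\<omega>. ennreal (indicator B (\<xi> 0 \<omega>) * measure (Q (\<xi> n \<omega>)) A) \<partial>M)"
    by (rule nn_integral_eq_integral[OF i2, symmetric]) auto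
  also have "\<dots> = (\<integral>\<^sup>+\<omega>. indicator B (\<xi> 0 \<omega>) * emeasure (Q (\<xi> n \<omega>)) A \<partial>M)"
  proof (intro nn_integral_cong)
    fix \<omega> assume "\<omega> \<in> space M"
    hence "prob_space (Q (\<xi> n \<omega>))" by (intro prob_space_kernel measurable_space[OF chain_measurable])
    then interpret q: prob_space "Q (\<xi> n \<omega>)" .
    show "ennreal (indicator B (\<xi> 0 \<omega>) * measure (Q (\<xi> n \<omega>)) A) = indicator B (\<xi> 0 \<omega>) * emeasure (Q (\<xi> n \<omega>)) A"
      by (auto simp: q.emeasure_eq_measure indicator_def)
  qed
  finally show ?thesis .
qed

text \<open>
  Rectangles determine measures: for fixed \<open>B\<close> both sides are integrals of \<open>h\<close> against measures that agree on
  the sets \<open>A\<close>, and for fixed \<open>h\<close> they are integrals of \<open>u\<close> against measures that agree on the sets \<open>B\<close>.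
\<close>

lemma nn_one_step:
  assumes u: "u \<in> borel_measurable S" and h: "h \<in> borel_measurable S" and n: "0 \<le> n"
  shows "(\<integral>\<^sup>+\<omega>. u (\<xi> 0 \<omega>) * h (\<xi> (n + 1) \<omega>) \<partial>M)
    = (\<integral>\<^sup>+\<omega>. u (\<xi> 0 \<omega>) * (\<integral>\<^sup>+s. h s \<partial>Q (\<xi> n \<omega>)) \<partial>M)"
proof -
  have mc: "(\<lambda>\<omega>. v (\<xi> i \<omega>)) \<in> borel_measurable M" if "v \<in> borel_measurable S" for v :: "'a \<Rightarrow> ennreal" and i
    by (rule measurable_compose[OF chain_measurable that])
  let ?Qh = "\<lambda>x. \<integral>\<^sup>+s. h s \<partial>Q x"
  note Qh = measurable_kernel_nn[OF h]
  have push: "(\<integral>\<^sup>+x. v x \<partial>distr (density M w) S (\<xi> i)) = (\<integral>\<^sup>+\<omega>. w \<omega> * v (\<xi> i \<omega>) \<partial>M)"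
    if "v \<in> borel_measurable S" "w \<in> borel_measurable M" for v w i
    using that by (subst nn_integral_distr) (auto simp: nn_integral_density mc)
  have rectangle: "(\<integral>\<^sup>+\<omega>. indicator B (\<xi> 0 \<omega>) * h (\<xi> (n + 1) \<omega>) \<partial>M)
    = (\<integral>\<^sup>+\<omega>. indicator B (\<xi> 0 \<omega>) * ?Qh (\<xi> n \<omega>) \<partial>M)" if B: "B \<in> sets S" for B
  proof -
    let ?N = "\<lambda>i. distr (density M (\<lambda>\<omega>. indicator B (\<xi> 0 \<omega>))) S (\<xi> i)"
    have w: "(\<lambda>\<omega>. indicator B (\<xi> 0 \<omega>) :: ennreal) \<in> borel_measurable M" using B by measurable
    have K: "Q \<in> measurable (?N n) (subprob_algebra S)" using kernel_subprob by simp
    have "?N (n + 1) = ?N n \<bind> Q"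
    proof (rule measure_eqI)
      show "sets (?N (n + 1)) = sets (?N n \<bind> Q)"
        using K not_empty by (subst sets_bind[of _ _ S]) (auto simp: sets_kernel dest: measurable_space[OF chain_measurable])
      fix A assume "A \<in> sets (?N (n + 1))"
      hence A: "A \<in> sets S" by simp
      have "emeasure (?N (n + 1)) A = (\<integral>\<^sup>+x. indicator A x \<partial>?N (n + 1))"
        using A by simp
      also have "\<dots> = (\<integral>\<^sup>+\<omega>. indicator B (\<xi> 0 \<omega>) * emeasure (Q (\<xi> n \<omega>)) A \<partial>M)"
        using A by (subst push[OF _ w]) (simp_all add: nn_one_step_rectangle[OF A B n])
      also have "\<dots> = (\<integral>\<^sup>+x. emeasure (Q x) A \<partial>?N n)"
        using A by (subst push[OF _ w]) (auto intro: measurable_compose[OF kernel_subprob measurable_emeasure_subprob_algebra])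
      also have "\<dots> = emeasure (?N n \<bind> Q) A"
        using A not_empty by (intro emeasure_bind[OF _ K, symmetric]) (auto dest: measurable_space[OF chain_measurable])
      finally show "emeasure (?N (n + 1)) A = emeasure (?N n \<bind> Q) A" .
    qed
    hence "(\<integral>\<^sup>+x. h x \<partial>?N (n + 1)) = (\<integral>\<^sup>+x. ?Qh x \<partial>?N n)"
      by (simp only: nn_integral_bind[OF h K])
    thus ?thesis by (simp only: push[OF h w] push[OF Qh w])
  qed
  let ?L = "\<lambda>w. distr (density M w) S (\<xi> 0)"
  have "?L (\<lambda>\<omega>. h (\<xi> (n + 1) \<omega>)) = ?L (\<lambda>\<omega>. ?Qh (\<xi> n \<omega>))"
  proof (rule measure_eqI)
    fix B assume "B \<in> sets (?L (\<lambda>\<omega>. h (\<xi> (n + 1) \<omega>)))"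
    hence B: "B \<in> sets S" by simp
    have "emeasure (?L w) B = (\<integral>\<^sup>+\<omega>. indicator B (\<xi> 0 \<omega>) * w \<omega> \<partial>M)" if "w \<in> borel_measurable M" for w
    proof -
      have "emeasure (?L w) B = (\<integral>\<^sup>+x. indicator B x \<partial>?L w)" using B by simp
      also have "\<dots> = (\<integral>\<^sup>+\<omega>. w \<omega> * indicator B (\<xi> 0 \<omega>) \<partial>M)"
        by (rule push[OF borel_measurable_indicator[OF B] that])
      finally show ?thesis by (simp only: mult.commute)
    qed
    thus "emeasure (?L (\<lambda>\<omega>. h (\<xi> (n + 1) \<omega>))) B = emeasure (?L (\<lambda>\<omega>. ?Qh (\<xi> n \<omega>))) B"
      by (simp only: mc[OF h] mc[OF Qh] rectangle[OF B])
  qed simp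
  hence "(\<integral>\<^sup>+x. u x \<partial>?L (\<lambda>\<omega>. h (\<xi> (n + 1) \<omega>))) = (\<integral>\<^sup>+x. u x \<partial>?L (\<lambda>\<omega>. ?Qh (\<xi> n \<omega>)))"
    by simp
  thus ?thesis
    by (simp only: push[OF u mc[OF h]] push[OF u mc[OF Qh]] mult.commute)
qed

end

text \<open>
  The transition operator on real functions. Real functions suffice because \<open>g\<close> is real, and the order
  structure gives access to nonnegative integrals.
\<close>

definition kernel_mean :: "('a \<Rightarrow> 'a measure) \<Rightarrow> ('a \<Rightarrow> real) \<Rightarrow> 'a \<Rightarrow> real" where
  "kernel_mean Q h x = (LINT s|Q x. h s)"

definition real_L2 :: "'a measure \<Rightarrow> ('a \<Rightarrow> real) set" where
  "real_L2 \<pi> = {h \<in> borel_measurable \<pi>. integrable \<pi> (\<lambda>x. (h x)\<^sup>2)}"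

lemma transition_operator_of_real:
  "transition_operator Q (\<lambda>x. complex_of_real (h x)) = (\<lambda>x. complex_of_real (kernel_mean Q h x))"
  unfolding transition_operator_def kernel_mean_def by (rule ext) (rule integral_complex_of_real)

lemma transition_operator_power_of_real:
  "(transition_operator Q ^^ n) (\<lambda>x. complex_of_real (h x)) = (\<lambda>x. complex_of_real ((kernel_mean Q ^^ n) h x))"
  by (induction n) (simp_all add: transition_operator_of_real)

lemma of_real_in_L2_iff: "(\<lambda>x. complex_of_real (h x)) \<in> L2 \<pi> \<longleftrightarrow> h \<in> real_L2 \<pi>"
proof
  assume "(\<lambda>x. complex_of_real (h x)) \<in> L2 \<pi>"
  hence m: "(\<lambda>x. complex_of_real (h x)) \<in> borel_measurable \<pi>" and i: "integrable \<pi> (\<lambda>x. (h x)\<^sup>2)"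
    by (auto simp: L2_def)
  have "(\<lambda>x. Re (complex_of_real (h x))) \<in> borel_measurable \<pi>"
    by (rule measurable_compose[OF m]) simp
  with i show "h \<in> real_L2 \<pi>" by (simp add: real_L2_def)
qed (auto simp: L2_def real_L2_def)

context stationary_markov_chain
begin

lemma real_L2_measurable: "h \<in> real_L2 \<pi> \<Longrightarrow> h \<in> borel_measurable S"
  by (simp add: real_L2_def measurable_marginal)

lemma real_L2_pos_part: "h \<in> real_L2 \<pi> \<Longrightarrow> (\<lambda>x. max 0 (h x)) \<in> real_L2 \<pi>"
  unfolding real_L2_def
  by (auto intro!: Bochner_Integration.integrable_bound[where f = "\<lambda>x. (h x)\<^sup>2" and M = \<pi>] AE_I2
      simp: max_def)

lemma real_L2_minus: "h \<in> real_L2 \<pi> \<Longrightarrow> (\<lambda>x. - h x) \<in> real_L2 \<pi>"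
  by (simp add: real_L2_def)

lemma integrable_chain_product:
  assumes u: "u \<in> real_L2 \<pi>" and h: "h \<in> real_L2 \<pi>"
  shows "integrable M (\<lambda>\<omega>. u (\<xi> i \<omega>) * h (\<xi> j \<omega>))"
proof (rule Bochner_Integration.integrable_bound)
  have "integrable M (\<lambda>\<omega>. (v (\<xi> i \<omega>))\<^sup>2)" if "v \<in> real_L2 \<pi>" for v i
    using that integrable_chain_iff[of "\<lambda>x. (v x)\<^sup>2" i] real_L2_measurable[OF that]
    by (simp add: real_L2_def)
  thus "integrable M (\<lambda>\<omega>. (u (\<xi> i \<omega>))\<^sup>2 + (h (\<xi> j \<omega>))\<^sup>2)"
    using u h by (intro Bochner_Integration.integrable_add)
  show "(\<lambda>\<omega>. u (\<xi> i \<omega>) * h (\<xi> j \<omega>)) \<in> borel_measurable M"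
    using real_L2_measurable[OF u] real_L2_measurable[OF h]
    by (intro borel_measurable_times measurable_compose[OF chain_measurable])
  show "AE \<omega> in M. norm (u (\<xi> i \<omega>) * h (\<xi> j \<omega>)) \<le> norm ((u (\<xi> i \<omega>))\<^sup>2 + (h (\<xi> j \<omega>))\<^sup>2)"
  proof (intro AE_I2)
    fix \<omega>
    have "2 * \<bar>u (\<xi> i \<omega>)\<bar> * \<bar>h (\<xi> j \<omega>)\<bar> \<le> \<bar>u (\<xi> i \<omega>)\<bar>\<^sup>2 + \<bar>h (\<xi> j \<omega>)\<bar>\<^sup>2"
      by (rule sum_squares_bound)
    moreover have "0 \<le> \<bar>u (\<xi> i \<omega>)\<bar> * \<bar>h (\<xi> j \<omega>)\<bar>" by simp
    ultimately show "norm (u (\<xi> i \<omega>) * h (\<xi> j \<omega>)) \<le> norm ((u (\<xi> i \<omega>))\<^sup>2 + (h (\<xi> j \<omega>))\<^sup>2)"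
      unfolding real_norm_def abs_mult power2_abs by linarith
  qed
qed

lemma real_L2_const: "(\<lambda>_. 1) \<in> real_L2 \<pi>"
proof -
  have "prob_space \<pi>" unfolding marginal[symmetric] by (rule prob_space_distr[OF chain_measurable])
  then interpret p: prob_space \<pi> .
  show ?thesis by (simp add: real_L2_def)
qed

lemma integrable_chain: "h \<in> real_L2 \<pi> \<Longrightarrow> integrable M (\<lambda>\<omega>. h (\<xi> i \<omega>))"
  using integrable_chain_product[OF real_L2_const, of h i] by simp

lemma nn_kernel_AE_finite:
  assumes h: "h \<in> real_L2 \<pi>" and pos: "\<And>x. 0 \<le> h x" and n: "0 \<le> n"
  shows "AE \<omega> in M. (\<integral>\<^sup>+s. ennreal (h s) \<partial>Q (\<xi> n \<omega>)) < \<infinity>"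
proof -
  have m: "(\<lambda>x. ennreal (h x)) \<in> borel_measurable S" using real_L2_measurable[OF h] by simp
  have "(\<integral>\<^sup>+\<omega>. (\<integral>\<^sup>+s. ennreal (h s) \<partial>Q (\<xi> n \<omega>)) \<partial>M) = (\<integral>\<^sup>+\<omega>. ennreal (h (\<xi> (n + 1) \<omega>)) \<partial>M)"
    using nn_one_step[of "\<lambda>_. 1" "\<lambda>x. ennreal (h x)" n] m n by simp
  also have "\<dots> = ennreal (LINT \<omega>|M. h (\<xi> (n + 1) \<omega>))"
    by (rule nn_integral_eq_integral[OF integrable_chain[OF h]]) (simp add: pos)
  also have "\<dots> < \<infinity>" by simp
  finally have "(\<integral>\<^sup>+\<omega>. (\<integral>\<^sup>+s. ennreal (h s) \<partial>Q (\<xi> n \<omega>)) \<partial>M) \<noteq> \<infinity>" by simp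
  from nn_integral_PInf_AE[OF measurable_compose[OF chain_measurable measurable_kernel_nn[OF m]] this]
  show ?thesis by eventually_elim (simp add: less_top)
qed

lemma measurable_kernel: "h \<in> borel_measurable S \<Longrightarrow> \<omega> \<in> space M \<Longrightarrow> h \<in> borel_measurable (Q (\<xi> n \<omega>))"
  using measurable_cong_sets[OF sets_kernel[OF measurable_space[OF chain_measurable]] refl] by blast

lemma kernel_integrable_AE:
  assumes h: "h \<in> real_L2 \<pi>" and pos: "\<And>x. 0 \<le> h x" and n: "0 \<le> n"
  shows "AE \<omega> in M. integrable (Q (\<xi> n \<omega>)) h \<and> ennreal (kernel_mean Q h (\<xi> n \<omega>)) = (\<integral>\<^sup>+s. ennreal (h s) \<partial>Q (\<xi> n \<omega>))"
  using nn_kernel_AE_finite[OF assms] AE_space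
proof eventually_elim
  case (elim \<omega>)
  have "integrable (Q (\<xi> n \<omega>)) h"
    using elim by (intro integrableI_nonneg measurable_kernel real_L2_measurable[OF h]) (auto simp: pos)
  moreover from this have "(\<integral>\<^sup>+s. ennreal (h s) \<partial>Q (\<xi> n \<omega>)) = ennreal (kernel_mean Q h (\<xi> n \<omega>))"
    unfolding kernel_mean_def by (intro nn_integral_eq_integral) (auto simp: pos)
  ultimately show ?case by simp
qed

text \<open>
  For nonnegative functions the identity is the one for nonnegative integrals, which also yields integrability.
\<close>

lemma one_step_nonneg:
  assumes u: "u \<in> real_L2 \<pi>" "\<And>x. 0 \<le> u x" and h: "h \<in> real_L2 \<pi>" "\<And>x. 0 \<le> h x"
    and n: "0 \<le> n" and m: "kernel_mean Q h \<in> borel_measurable S"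
  shows "has_bochner_integral M (\<lambda>\<omega>. u (\<xi> 0 \<omega>) * kernel_mean Q h (\<xi> n \<omega>))
    (LINT \<omega>|M. u (\<xi> 0 \<omega>) * h (\<xi> (n + 1) \<omega>))"
proof (rule has_bochner_integral_nn_integral)
  have um: "u \<in> borel_measurable S" and hm: "h \<in> borel_measurable S"
    using real_L2_measurable u h by auto
  show "(\<lambda>\<omega>. u (\<xi> 0 \<omega>) * kernel_mean Q h (\<xi> n \<omega>)) \<in> borel_measurable M"
    by (intro borel_measurable_times measurable_compose[OF chain_measurable] um m)
  have kpos: "0 \<le> kernel_mean Q h x" for x
    unfolding kernel_mean_def using h(2) by (intro Bochner_Integration.integral_nonneg)
  show "AE \<omega> in M. 0 \<le> u (\<xi> 0 \<omega>) * kernel_mean Q h (\<xi> n \<omega>)"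
    by (simp add: u(2) kpos)
  show "0 \<le> (LINT \<omega>|M. u (\<xi> 0 \<omega>) * h (\<xi> (n + 1) \<omega>))"
    using u(2) h(2) by (intro Bochner_Integration.integral_nonneg mult_nonneg_nonneg)
  have "(\<integral>\<^sup>+\<omega>. ennreal (u (\<xi> 0 \<omega>) * kernel_mean Q h (\<xi> n \<omega>)) \<partial>M)
      = (\<integral>\<^sup>+\<omega>. ennreal (u (\<xi> 0 \<omega>)) * (\<integral>\<^sup>+s. ennreal (h s) \<partial>Q (\<xi> n \<omega>)) \<partial>M)"
  proof (rule nn_integral_cong_AE)
    show "AE \<omega> in M. ennreal (u (\<xi> 0 \<omega>) * kernel_mean Q h (\<xi> n \<omega>))
        = ennreal (u (\<xi> 0 \<omega>)) * (\<integral>\<^sup>+s. ennreal (h s) \<partial>Q (\<xi> n \<omega>))"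
      using kernel_integrable_AE[OF h n]
    proof eventually_elim
      case (elim \<omega>)
      have "ennreal (u (\<xi> 0 \<omega>) * kernel_mean Q h (\<xi> n \<omega>))
          = ennreal (u (\<xi> 0 \<omega>)) * ennreal (kernel_mean Q h (\<xi> n \<omega>))"
        by (rule ennreal_mult[OF u(2) kpos])
      thus ?case using elim by simp
    qed
  qed
  also have "\<dots> = (\<integral>\<^sup>+\<omega>. ennreal (u (\<xi> 0 \<omega>)) * ennreal (h (\<xi> (n + 1) \<omega>)) \<partial>M)"
    using um hm by (intro nn_one_step[OF _ _ n, symmetric]) auto
  also have "\<dots> = (\<integral>\<^sup>+\<omega>. ennreal (u (\<xi> 0 \<omega>) * h (\<xi> (n + 1) \<omega>)) \<partial>M)"
    by (simp add: ennreal_mult u(2) h(2))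
  also have "\<dots> = ennreal (LINT \<omega>|M. u (\<xi> 0 \<omega>) * h (\<xi> (n + 1) \<omega>))"
    by (rule nn_integral_eq_integral[OF integrable_chain_product[OF u(1) h(1)]]) (simp add: u(2) h(2))
  finally show "(\<integral>\<^sup>+\<omega>. ennreal (u (\<xi> 0 \<omega>) * kernel_mean Q h (\<xi> n \<omega>)) \<partial>M)
      = ennreal (LINT \<omega>|M. u (\<xi> 0 \<omega>) * h (\<xi> (n + 1) \<omega>))" .
qed

text \<open>
  Bilinearity in the positive and negative parts. The kernel mean of a difference is the difference of the
  kernel means only almost surely, where both are finite.
\<close>

lemma one_step:
  assumes T: "\<And>h. h \<in> real_L2 \<pi> \<Longrightarrow> kernel_mean Q h \<in> real_L2 \<pi>"
    and u: "u \<in> real_L2 \<pi>" and h: "h \<in> real_L2 \<pi>" and n: "0 \<le> n"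
  shows "(LINT \<omega>|M. u (\<xi> 0 \<omega>) * h (\<xi> (n + 1) \<omega>)) = (LINT \<omega>|M. u (\<xi> 0 \<omega>) * kernel_mean Q h (\<xi> n \<omega>))"
proof -
  define p :: "('a \<Rightarrow> real) \<Rightarrow> 'a \<Rightarrow> real" where "p = (\<lambda>v x. max 0 (v x))"
  define m :: "('a \<Rightarrow> real) \<Rightarrow> 'a \<Rightarrow> real" where "m = (\<lambda>v x. max 0 (- v x))"
  have L: "p v \<in> real_L2 \<pi>" "m v \<in> real_L2 \<pi>" if "v \<in> real_L2 \<pi>" for v
    unfolding p_def m_def
    by (rule real_L2_pos_part[OF that], rule real_L2_pos_part[OF real_L2_minus[OF that]])
  have pos: "0 \<le> p v x" "0 \<le> m v x" for v x by (simp_all add: p_def m_def)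
  have split: "v x = p v x - m v x" for v x by (simp add: p_def m_def)
  have step: "has_bochner_integral M (\<lambda>\<omega>. a (\<xi> 0 \<omega>) * kernel_mean Q b (\<xi> n \<omega>))
      (LINT \<omega>|M. a (\<xi> 0 \<omega>) * b (\<xi> (n + 1) \<omega>))"
    if "a \<in> {p u, m u}" "b \<in> {p h, m h}" for a b
  proof (rule one_step_nonneg[OF _ _ _ _ n])
    show "a \<in> real_L2 \<pi>" "b \<in> real_L2 \<pi>" using that L u h by auto
    show "kernel_mean Q b \<in> borel_measurable S" by (intro real_L2_measurable T) fact
    show "0 \<le> a x" "0 \<le> b x" for x using that pos by auto
  qed
  let ?I = "\<lambda>a b. LINT \<omega>|M. a (\<xi> 0 \<omega>) * b (\<xi> (n + 1) \<omega>)"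
  let ?J = "(?I (p u) (p h) - ?I (p u) (m h)) - (?I (m u) (p h) - ?I (m u) (m h))"
  let ?f = "\<lambda>a b \<omega>. a (\<xi> 0 \<omega>) * kernel_mean Q b (\<xi> n \<omega>)"
  let ?F = "\<lambda>\<omega>. (?f (p u) (p h) \<omega> - ?f (p u) (m h) \<omega>) - (?f (m u) (p h) \<omega> - ?f (m u) (m h) \<omega>)"
  let ?g = "\<lambda>a b \<omega>. a (\<xi> 0 \<omega>) * b (\<xi> (n + 1) \<omega>)"
  let ?G = "\<lambda>\<omega>. (?g (p u) (p h) \<omega> - ?g (p u) (m h) \<omega>) - (?g (m u) (p h) \<omega> - ?g (m u) (m h) \<omega>)"
  have distrib: "(a - b) * (c - d) = (a * c - a * d) - (b * c - b * d)" for a b c d :: real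
    by (simp add: algebra_simps)
  have "has_bochner_integral M ?F ?J"
    by (intro has_bochner_integral_diff step[of "p u" "p h"] step[of "p u" "m h"]
        step[of "m u" "p h"] step[of "m u" "m h"]) simp_all
  hence "(LINT \<omega>|M. ?F \<omega>) = ?J"
    by (rule has_bochner_integral_integral_eq)
  also have "(LINT \<omega>|M. ?F \<omega>) = (LINT \<omega>|M. u (\<xi> 0 \<omega>) * kernel_mean Q h (\<xi> n \<omega>))"
  proof (rule integral_cong_AE)
    have mm: "?f a b \<in> borel_measurable M" if "a \<in> real_L2 \<pi>" "b \<in> real_L2 \<pi>" for a b
      by (rule borel_measurable_times[OF measurable_compose[OF chain_measurable real_L2_measurable[OF that(1)]]
            measurable_compose[OF chain_measurable real_L2_measurable[OF T[OF that(2)]]]])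
    show "?f u h \<in> borel_measurable M"
      by (rule mm[OF u h])
    show "?F \<in> borel_measurable M"
      by (intro borel_measurable_diff mm[OF L(1)[OF u] L(1)[OF h]] mm[OF L(1)[OF u] L(2)[OF h]]
          mm[OF L(2)[OF u] L(1)[OF h]] mm[OF L(2)[OF u] L(2)[OF h]])
    show "AE \<omega> in M. ?F \<omega> = ?f u h \<omega>"
      using kernel_integrable_AE[OF L(1)[OF h] pos(1) n] kernel_integrable_AE[OF L(2)[OF h] pos(2) n]
    proof eventually_elim
      case (elim \<omega>)
      have "kernel_mean Q h (\<xi> n \<omega>) = (LINT s|Q (\<xi> n \<omega>). p h s - m h s)"
        unfolding kernel_mean_def by (rule Bochner_Integration.integral_cong[OF refl split])
      also have "\<dots> = kernel_mean Q (p h) (\<xi> n \<omega>) - kernel_mean Q (m h) (\<xi> n \<omega>)"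
        unfolding kernel_mean_def using elim by (intro Bochner_Integration.integral_diff) auto
      finally show ?case by (simp only: split[of u] distrib)
    qed
  qed
  also have "?J = ?I u h"
  proof -
    have "has_bochner_integral M ?G ?J"
      by (intro has_bochner_integral_diff has_bochner_integral_integrable
          integrable_chain_product[OF L(1)[OF u] L(1)[OF h]] integrable_chain_product[OF L(1)[OF u] L(2)[OF h]]
          integrable_chain_product[OF L(2)[OF u] L(1)[OF h]] integrable_chain_product[OF L(2)[OF u] L(2)[OF h]])
    hence "(LINT \<omega>|M. ?G \<omega>) = ?J"
      by (rule has_bochner_integral_integral_eq)
    also have "?G = (\<lambda>\<omega>. u (\<xi> 0 \<omega>) * h (\<xi> (n + 1) \<omega>))"
      by (rule ext) (simp only: split[of u] split[of h] distrib)
    finally show ?thesis by simp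
  qed
  finally show ?thesis by simp
qed

text \<open>
  One application of the Markov property removes the last step of the chain and replaces \<open>h\<close> by its kernel
  mean, so the induction runs over all \<open>h\<close>.
\<close>

lemma covariance_kernel_power:
  assumes T: "\<And>h. h \<in> real_L2 \<pi> \<Longrightarrow> kernel_mean Q h \<in> real_L2 \<pi>"
    and u: "u \<in> real_L2 \<pi>" and h: "h \<in> real_L2 \<pi>"
  shows "(LINT \<omega>|M. u (\<xi> 0 \<omega>) * h (\<xi> (int n) \<omega>)) = (LINT x|\<pi>. u x * (kernel_mean Q ^^ n) h x)"
  using h
proof (induction n arbitrary: h)
  case 0
  have "(\<lambda>x. u x * h x) \<in> borel_measurable S"
    by (intro borel_measurable_times real_L2_measurable u 0)
  from integral_chain[OF this, of 0] show ?case by simp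
next
  case (Suc n)
  have "(LINT \<omega>|M. u (\<xi> 0 \<omega>) * h (\<xi> (int n + 1) \<omega>)) = (LINT \<omega>|M. u (\<xi> 0 \<omega>) * kernel_mean Q h (\<xi> (int n) \<omega>))"
    by (rule one_step[OF T u Suc.prems]) simp_all
  also have "\<dots> = (LINT x|\<pi>. u x * (kernel_mean Q ^^ n) (kernel_mean Q h) x)"
    by (rule Suc.IH[OF T[OF Suc.prems]])
  also have "(kernel_mean Q ^^ n) (kernel_mean Q h) = (kernel_mean Q ^^ Suc n) h"
    by (simp add: funpow_swap1)
  finally show ?case by (simp add: add.commute)
qed

lemma covariance_shift:
  assumes u: "u \<in> real_L2 \<pi>" and h: "h \<in> real_L2 \<pi>"
  shows "(LINT \<omega>|M. u (\<xi> i \<omega>) * h (\<xi> (i + j) \<omega>)) = (LINT \<omega>|M. u (\<xi> 0 \<omega>) * h (\<xi> j \<omega>))"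
proof -
  have [measurable]: "u \<in> borel_measurable S" "h \<in> borel_measurable S"
    using real_L2_measurable u h by auto
  have "(\<lambda>(x, y). u x * h y) \<in> borel_measurable (S \<Otimes>\<^sub>M S)" by measurable
  from integral_pair_shift[OF this, of 0 i j] show ?thesis by (simp add: add.commute)
qed

text \<open>
  Matches \<open>corr_kernel_Suc\<close> term by term.
\<close>

theorem second_moment_partial_sum_Suc:
  assumes g: "g \<in> real_L2 \<pi>"
  shows "(LINT \<omega>|M. (\<Sum>i=1..Suc n. g (\<xi> (int i) \<omega>))\<^sup>2)
    = (LINT \<omega>|M. (\<Sum>i=1..n. g (\<xi> (int i) \<omega>))\<^sup>2) + (LINT \<omega>|M. g (\<xi> 0 \<omega>) * g (\<xi> 0 \<omega>))
      + 2 * (\<Sum>k=1..n. LINT \<omega>|M. g (\<xi> 0 \<omega>) * g (\<xi> (int k) \<omega>))"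
proof -
  note int = integrable_chain_product[OF g g]
  let ?s = "\<lambda>\<omega>. \<Sum>i=1..n. g (\<xi> (int i) \<omega>)" and ?x = "\<lambda>\<omega>. g (\<xi> (int (Suc n)) \<omega>)"
  have i1: "integrable M (\<lambda>\<omega>. (?s \<omega>)\<^sup>2)"
    unfolding power2_eq_square sum_product by (intro Bochner_Integration.integrable_sum int)
  have i2: "integrable M (\<lambda>\<omega>. ?s \<omega> * ?x \<omega>)"
    unfolding sum_distrib_right by (intro Bochner_Integration.integrable_sum int)
  have "(LINT \<omega>|M. (\<Sum>i=1..Suc n. g (\<xi> (int i) \<omega>))\<^sup>2)
      = (LINT \<omega>|M. (?s \<omega>)\<^sup>2 + ?x \<omega> * ?x \<omega> + 2 * (?s \<omega> * ?x \<omega>))"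
    by (simp add: power2_eq_square algebra_simps)
  also have "\<dots> = (LINT \<omega>|M. (?s \<omega>)\<^sup>2) + (LINT \<omega>|M. ?x \<omega> * ?x \<omega>) + 2 * (LINT \<omega>|M. ?s \<omega> * ?x \<omega>)"
    using i1 i2 int by simp
  also have "(LINT \<omega>|M. ?x \<omega> * ?x \<omega>) = (LINT \<omega>|M. g (\<xi> 0 \<omega>) * g (\<xi> 0 \<omega>))"
    using covariance_shift[OF g g, of "int (Suc n)" 0] by simp
  also have "(LINT \<omega>|M. ?s \<omega> * ?x \<omega>) = (\<Sum>i=1..n. LINT \<omega>|M. g (\<xi> (int i) \<omega>) * ?x \<omega>)"
    unfolding sum_distrib_right by (rule Bochner_Integration.integral_sum) (rule int)
  also have "\<dots> = (\<Sum>i=1..n. LINT \<omega>|M. g (\<xi> 0 \<omega>) * g (\<xi> (int (Suc n - i)) \<omega>))"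
  proof (rule sum.cong[OF refl])
    fix i assume "i \<in> {1..n}"
    hence "int (Suc n) = int i + int (Suc n - i)" by auto
    thus "(LINT \<omega>|M. g (\<xi> (int i) \<omega>) * ?x \<omega>) = (LINT \<omega>|M. g (\<xi> 0 \<omega>) * g (\<xi> (int (Suc n - i)) \<omega>))"
      using covariance_shift[OF g g, of "int i" "int (Suc n - i)"] by (simp only:)
  qed
  also have "\<dots> = (\<Sum>k=1..n. LINT \<omega>|M. g (\<xi> 0 \<omega>) * g (\<xi> (int k) \<omega>))"
    by (rule sum.reindex_bij_witness[of _ "\<lambda>k. Suc n - k" "\<lambda>k. Suc n - k"]) auto
  finally show ?thesis .
qed

lemma variance_partial_sum:
  assumes g: "g \<in> real_L2 \<pi>" and mean: "(LINT x|\<pi>. g x) = 0"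
  shows "variance (\<lambda>\<omega>. \<Sum>i=1..n. g (\<xi> (int i) \<omega>)) = (LINT \<omega>|M. (\<Sum>i=1..n. g (\<xi> (int i) \<omega>))\<^sup>2)"
proof -
  have "(LINT \<omega>|M. (\<Sum>i=1..n. g (\<xi> (int i) \<omega>))) = (\<Sum>i=1..n. LINT \<omega>|M. g (\<xi> (int i) \<omega>))"
    by (rule Bochner_Integration.integral_sum) (rule integrable_chain[OF g])
  also have "\<dots> = 0" by (simp add: integral_chain[OF real_L2_measurable[OF g]] mean)
  finally show ?thesis by simp
qed

end

text \<open>
  The bridge between the chain and the disc: the covariances are the real parts of the moments of \<open>\<nu>\<close>, and both
  sides have the same increments in \<open>n\<close>.
\<close>

lemma variance_eq_corr_integral:
  assumes chain: "stationary_markov_chain M S \<xi> \<pi> Q"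
    and normal: "normal_operator \<pi> (transition_operator Q)"
    and g: "g \<in> real_L2_0 \<pi>"
    and \<nu>: "transition_spectral_measure \<pi> Q g \<nu>"
  shows "disc_measure \<nu>"
    and "prob_space.variance M (\<lambda>\<omega>. \<Sum>i=1..n. g (\<xi> (int i) \<omega>)) = (LINT z|\<nu>. corr_kernel n z)"
proof -
  interpret stationary_markov_chain M S \<xi> \<pi> Q by (rule chain)
  let ?T = "transition_operator Q" and ?g = "\<lambda>x. complex_of_real (g x)"
  obtain T' where T': "L2_adjoint \<pi> ?T T'" using normal by (auto simp: normal_operator_def)
  obtain E where E: "resolution_of_identity \<pi> ?T E" and \<nu>_eq: "\<nu> = scalar_spectral_measure \<pi> E ?g"
    using \<nu> by (auto simp: transition_spectral_measure_def)
  interpret L2_spectral \<pi> ?T T' E by (rule L2_spectral.intro[OF T' E])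
  have gL: "g \<in> real_L2 \<pi>" and mean: "(LINT x|\<pi>. g x) = 0"
    using g by (auto simp: real_L2_0_def real_L2_def)
  have gc: "?g \<in> L2 \<pi>" using gL by (simp add: of_real_in_L2_iff)
  show disc: "disc_measure \<nu>"
    unfolding \<nu>_eq disc_measure_def disc_measure_axioms_def
    using finite_spectral[OF gc] sets_spectral by simp
  interpret disc_measure \<nu> by (rule disc)
  have T: "kernel_mean Q h \<in> real_L2 \<pi>" if "h \<in> real_L2 \<pi>" for h
    using that T_L2[of "\<lambda>x. complex_of_real (h x)"]
    by (simp add: of_real_in_L2_iff transition_operator_of_real)
  have int: "integrable \<nu> (\<lambda>z. z ^ k)" for k
    by (rule integrable_disc[where B = 1]) (auto simp: norm_power power_le_one)
  have cov: "(LINT \<omega>|M. g (\<xi> 0 \<omega>) * g (\<xi> (int k) \<omega>)) = (LINT z|\<nu>. Re (z ^ k))" for k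
  proof -
    have "(LINT \<omega>|M. g (\<xi> 0 \<omega>) * g (\<xi> (int k) \<omega>)) = (LINT x|\<pi>. g x * (kernel_mean Q ^^ k) g x)"
      by (rule covariance_kernel_power[OF T gL gL])
    also have "complex_of_real \<dots> = L2_inner \<pi> ((?T ^^ k) ?g) ?g"
      unfolding transition_operator_power_of_real L2_inner_def
      by (simp add: mult.commute flip: of_real_mult)
    also have "\<dots> = (LINT z|\<nu>. z ^ k)"
      unfolding \<nu>_eq by (rule spectral_moments[OF gc])
    finally have "(LINT \<omega>|M. g (\<xi> 0 \<omega>) * g (\<xi> (int k) \<omega>)) = Re (LINT z|\<nu>. z ^ k)"
      by (metis Re_complex_of_real)
    also have "\<dots> = (LINT z|\<nu>. Re (z ^ k))"
      by (rule integral_Re[OF int, symmetric])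
    finally show ?thesis .
  qed
  have corr: "integrable \<nu> (corr_kernel n)" for n
  proof -
    have "corr_kernel n = (\<lambda>z. (norm (geom_sum n z))\<^sup>2 + real n * interior_kernel n z)"
      by (rule ext) (auto simp: corr_kernel_def interior_kernel_def)
    thus ?thesis by (simp add: integrable_geom_sum_sq integrable_interior_kernel)
  qed
  have "(LINT \<omega>|M. (\<Sum>i=1..n. g (\<xi> (int i) \<omega>))\<^sup>2) = (LINT z|\<nu>. corr_kernel n z)"
  proof (induction n)
    case 0
    have "corr_kernel 0 = (\<lambda>_. 0)" by (rule ext) (simp add: corr_kernel_def geom_sum_def)
    thus ?case by simp
  next
    case (Suc n)
    have re: "integrable \<nu> (\<lambda>z. Re (z ^ k))" for k by (rule integrable_Re[OF int])
    have "(LINT z|\<nu>. corr_kernel (Suc n) z)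
        = (LINT z|\<nu>. corr_kernel n z + Re (z ^ 0) + 2 * (\<Sum>k=1..n. Re (z ^ k)))"
      by (simp add: corr_kernel_Suc)
    also have "\<dots> = (LINT z|\<nu>. corr_kernel n z) + (LINT z|\<nu>. Re (z ^ 0))
        + 2 * (\<Sum>k=1..n. LINT z|\<nu>. Re (z ^ k))"
      by (simp only: Bochner_Integration.integral_add Bochner_Integration.integrable_add corr re
          Bochner_Integration.integral_sum Bochner_Integration.integrable_sum
          integral_mult_right_zero integrable_mult_right)
    finally show ?case
      unfolding second_moment_partial_sum_Suc[OF gL] Suc using cov[of 0] cov by simp
  qed
  thus "prob_space.variance M (\<lambda>\<omega>. \<Sum>i=1..n. g (\<xi> (int i) \<omega>)) = (LINT z|\<nu>. corr_kernel n z)"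
    using variance_partial_sum[OF gL mean, of n] by simp
qed

theorem theorem6:
  fixes M :: "'w measure"
    and S :: "'a measure"
    and \<xi> :: "int \<Rightarrow> 'w \<Rightarrow> 'a"
    and \<pi> :: "'a measure"
    and Q :: "'a \<Rightarrow> 'a measure"
    and g :: "'a \<Rightarrow> real"
    and X :: "int \<Rightarrow> 'w \<Rightarrow> real"
    and Sn :: "nat \<Rightarrow> 'w \<Rightarrow> real"
    and \<nu> :: "complex measure"
  assumes chain: "stationary_markov_chain M S \<xi> \<pi> Q"
    and normal: "normal_operator \<pi> (transition_operator Q)"
    and g: "g \<in> real_L2_0 \<pi>"
    and X: "\<And>i \<omega>. X i \<omega> = g (\<xi> i \<omega>)"
    and Sn: "\<And>n \<omega>. Sn n \<omega> = (\<Sum>i=1..n. X (int i) \<omega>)"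
    and \<nu>: "transition_spectral_measure \<pi> Q g \<nu>"
  shows
    "((\<exists>K::real. (\<lambda>n. prob_space.variance M (Sn n) / real n) \<longlonglongrightarrow> K)
        \<longleftrightarrow> spectral_sigma2 \<nu> < \<infinity> \<and> (\<exists>L::real. fejer_integral \<nu> \<longlonglongrightarrow> L)) \<and>
     (\<forall>K L::real.
        (\<lambda>n. prob_space.variance M (Sn n) / real n) \<longlonglongrightarrow> K \<longrightarrow>
        fejer_integral \<nu> \<longlonglongrightarrow> L \<longrightarrow>
        K = enn2real (spectral_sigma2 \<nu>) + L) \<and>
     (spectral_sigma2 \<nu> < \<infinity> \<longrightarrow>
        (\<forall>C::real. C \<ge> 0 \<longrightarrow>
           (fejer_integral \<nu> \<longlonglongrightarrow> pi * C
              \<longleftrightarrow> ((\<lambda>x. measure \<nu> (cusp_region x) / x) \<longlongrightarrow> C) (at_right 0)) \<and>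
           (fejer_integral \<nu> \<longlonglongrightarrow> pi * C
              \<longleftrightarrow> (\<lambda>n. real n * measure \<nu> (box_region n)) \<longlonglongrightarrow> C)))"
proof -
  interpret disc_measure \<nu> by (rule variance_eq_corr_integral(1)[OF chain normal g \<nu>])
  have "Sn n = (\<lambda>\<omega>. \<Sum>i=1..n. g (\<xi> (int i) \<omega>))" for n
    by (rule ext) (simp add: Sn X)
  hence V: "prob_space.variance M (Sn n) = (LINT z|\<nu>. corr_kernel n z)" for n
    using variance_eq_corr_integral(2)[OF chain normal g \<nu>, of n] by simp
  show ?thesis
    by (intro conjI allI impI variance_limit_iff(1)[OF V] variance_limit_iff(2)[OF V]
        fejer_limit_iff_cusp fejer_limit_iff_box)
qed

end
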